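(* Let $X$ be a Niemeier root system, let $\pi^X$ be its Coxeter Frame shape, let $d^X$ be the number of irreducible components of $X$, and let $\Gamma^X<SL_2(\mathbb{R})$ be the genus zero group attached to $X$. Then $$T^X=\frac{1}{\eta_{\pi^X}}$$ is the unique principal modulus for $\Gamma^X$ satisfying $T^X=q^{-1}-d^X+O(q)$ as $\tau\to i\infty$.
   Context: Throughout $\tau\in\mathbb{H}$ (upper half-plane), $q=e^{2\pi i\tau}$, and $\eta(\tau)=q^{1/24}\prod_{n\ge1}(1-q^n)$. Niemeier root systems: the 23 root systems of total rank 24 that are unions of irreducible simply-laced root systems all having the same Coxeter number $m$; they are (A-type) $A_1^{24}$, $A_2^{12}$, $A_3^8$, $A_4^6$, $A_5^4D_4$, $A_6^4$, $A_7^2D_5^2$, $A_8^3$, $A_9^2D_6$, $A_{11}D_7E_6$, $A_{12}^2$, $A_{15}D_9$, $A_{17}E_7$, $A_{24}$; (D-type) $D_4^6$, $D_6^4$, $D_8^3$, $D_{10}E_7^2$, $D_{12}^2$, $D_{16}E_8$, $D_{24}$; (E-type) $E_6^4$, $E_8^3$. The Coxeter number $m$ of $X$ is that of any irreducible component ($A_{m-1}$ and $D_{m/2+1}$ have Coxeter number $m$; $E_6,E_7,E_8$ have $12,18,30$). Frame shapes: a Frame shape is a formal product $\pi=\prod_i n_i^{k_i}$ ($n_i,k_i\in\mathbb{Z}$, $n_i>0$), and $\eta_\pi(\tau)=\prod_i\eta(n_i\tau)^{k_i}$. The Coxeter Frame shapes of irreducible root systems (encoding the characteristic polynomial $\prod_i(x^{n_i}-1)^{k_i}$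 of a Coxeter element) are $\pi^{A_{m-1}}=\frac{m}{1}$, $\pi^{D_{m/2+1}}=\frac{2\cdot m}{1\cdot(m/2)}$, $\pi^{E_6}=\frac{2\cdot3\cdot12}{1\cdot4\cdot6}$, $\pi^{E_7}=\frac{2\cdot3\cdot18}{1\cdot6\cdot9}$, $\pi^{E_8}=\frac{2\cdot3\cdot5\cdot30}{1\cdot6\cdot10\cdot15}$ (formal products, not numbers), and $\pi^X$ for a union $X$ is the formal product of the Coxeter Frame shapes of the irreducible components (with multiplicity). Groups: for a positive integer $n$ and a subgroup $S$ of the group of exact divisors of $n$ ($e\|n$ means $e|n$ and $\gcd(e,n/e)=1$; product $e*f=ef/\gcd(e,f)^2$), $$\Gamma_0(n)+S=\left\{\tfrac{1}{\sqrt e}\begin{pmatrix} ae & b \\ c n & de \end{pmatrix}\ :\ a,b,c,d\in\mathbb{Z},\ e\in S,\ ade-bcn/e=1\right\},$$ and $\Gamma_0(n)+e,f,\dots$ means $S=\{1,e,f,\dots\}$. The group $\Gamma^X$ is: $\Gamma_0(m)$ if $X$ is A-type with Coxeter number $m$; $\Gamma_0(m)+\frac m2$ if $X$ is D-type with Coxeter number $m$; $\Gamma_0(12)+4$ if $X=E_6^4$; $\Gamma_0(30)+6,10,15$ if $X=E_8^3$. A discrete $\Gamma<SL_2(\mathbb{R})$ commensurable with $SL_2(\mathbb{Z})$ has genus zero if the compact Riemann surface $X_\Gamma=\Gamma\backslash(\mathbb{H}\cup\mathbb{Q}\cup\{i\infty\})$ has genus zero; a principal modulus (Hauptmodul) for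 $\Gamma$ is a holomorphic function on $\mathbb{H}$ that generates the field of $\Gamma$-invariant functions (the function field of $X_\Gamma$). *)

theory Defs
  imports
    "HOL-Complex_Analysis.Complex_Analysis"
    "HOL-Library.Poly_Mapping"
    "HOL-Library.Landau_Symbols"
begin

section \<open>Niemeier root systems\<close>

text \<open>Simply-laced root systems are given by the multiset of the types of their irreducible
  components.  The labels are meant for \<open>An n\<close> with \<open>n \<ge> 1\<close> and \<open>Dn n\<close> with \<open>n \<ge> 4\<close>.\<close>

datatype irreducible_type = An nat | Dn nat | E6 | E7 | E8

type_synonym root_system = "irreducible_type multiset"

fun valid_type :: "irreducible_type \<Rightarrow> bool" where
  "valid_type (An n) \<longleftrightarrow> n \<ge> 1"
| "valid_type (Dn n) \<longleftrightarrow> n \<ge> 4"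
| "valid_type _ \<longleftrightarrow> True"

fun rank_type :: "irreducible_type \<Rightarrow> nat" where
  "rank_type (An n) = n"
| "rank_type (Dn n) = n"
| "rank_type E6 = 6"
| "rank_type E7 = 7"
| "rank_type E8 = 8"

fun coxeter_number_type :: "irreducible_type \<Rightarrow> nat" where
  "coxeter_number_type (An n) = n + 1"
| "coxeter_number_type (Dn n) = 2 * (n - 1)"
| "coxeter_number_type E6 = 12"
| "coxeter_number_type E7 = 18"
| "coxeter_number_type E8 = 30"

definition coxeter_number :: "root_system \<Rightarrow> nat" where
  "coxeter_number X = coxeter_number_type (SOME R. R \<in># X)"

definition niemeier_A :: "root_system set" where
  "niemeier_A =
    {replicate_mset 24 (An 1),
     replicate_mset 12 (An 2),
     replicate_mset 8 (An 3),
     replicate_mset 6 (An 4),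
     replicate_mset 4 (An 5) + {#Dn 4#},
     replicate_mset 4 (An 6),
     replicate_mset 2 (An 7) + replicate_mset 2 (Dn 5),
     replicate_mset 3 (An 8),
     replicate_mset 2 (An 9) + {#Dn 6#},
     {#An 11, Dn 7, E6#},
     replicate_mset 2 (An 12),
     {#An 15, Dn 9#},
     {#An 17, E7#},
     {#An 24#}}"

definition niemeier_D :: "root_system set" where
  "niemeier_D =
    {replicate_mset 6 (Dn 4),
     replicate_mset 4 (Dn 6),
     replicate_mset 3 (Dn 8),
     {#Dn 10#} + replicate_mset 2 E7,
     replicate_mset 2 (Dn 12),
     {#Dn 16, E8#},
     {#Dn 24#}}"

definition niemeier_E :: "root_system set" where
  "niemeier_E = {replicate_mset 4 E6, replicate_mset 3 E8}"

definition niemeier :: "root_system \<Rightarrow> bool" where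
  "niemeier X \<longleftrightarrow> X \<in> niemeier_A \<union> niemeier_D \<union> niemeier_E"

lemma niemeier_properties:
  assumes "niemeier X"
  shows "\<forall>R\<in>#X. valid_type R"
    and "(\<Sum>R\<in>#X. rank_type R) = 24"
    and "\<forall>R\<in>#X. coxeter_number_type R = coxeter_number X"
proof -
  have X: "(\<forall>R\<in>#X. valid_type R) \<and> (\<Sum>R\<in>#X. rank_type R) = 24 \<and>
      (\<forall>R\<in>#X. \<forall>R'\<in>#X. coxeter_number_type R = coxeter_number_type R')"
    using assms by (auto simp: niemeier_def niemeier_A_def niemeier_D_def niemeier_E_def)
  then show "\<forall>R\<in>#X. valid_type R" "(\<Sum>R\<in>#X. rank_type R) = 24"
    by blast+
  show "\<forall>R\<in>#X. coxeter_number_type R = coxeter_number X"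
    using X unfolding coxeter_number_def by (metis (mono_tags, lifting) someI)
qed


section \<open>Frame shapes and eta products\<close>

text \<open>The formal product of the \<open>n\<^sub>i\<close> to the power \<open>k\<^sub>i\<close> is the finitely supported exponent
  function, so that multiplication of Frame shapes is addition.\<close>

type_synonym frame_shape = "nat \<Rightarrow>\<^sub>0 int"

definition frame_quotient :: "nat list \<Rightarrow> nat list \<Rightarrow> frame_shape" where
  "frame_quotient ns ds =
     (\<Sum>n\<leftarrow>ns. Poly_Mapping.single n 1) - (\<Sum>d\<leftarrow>ds. Poly_Mapping.single d 1)"

fun coxeter_frame_type :: "irreducible_type \<Rightarrow> frame_shape" where
  "coxeter_frame_type (An n) = frame_quotient [n + 1] [1]"
| "coxeter_frame_type (Dn n) = frame_quotient [2, 2 * (n - 1)] [1, n - 1]"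
| "coxeter_frame_type E6 = frame_quotient [2, 3, 12] [1, 4, 6]"
| "coxeter_frame_type E7 = frame_quotient [2, 3, 18] [1, 6, 9]"
| "coxeter_frame_type E8 = frame_quotient [2, 3, 5, 30] [1, 6, 10, 15]"

definition coxeter_frame :: "root_system \<Rightarrow> frame_shape" where
  "coxeter_frame X = (\<Sum>R\<in>#X. coxeter_frame_type R)"

definition upper_half_plane :: "complex set" where
  "upper_half_plane = {\<tau>. Im \<tau> > 0}"

definition qexp :: "complex \<Rightarrow> complex" where
  "qexp \<tau> = exp (2 * of_real pi * \<i> * \<tau>)"

definition dedekind_eta :: "complex \<Rightarrow> complex" where
  "dedekind_eta \<tau> = qexp (\<tau> / 24) * prodinf (\<lambda>n. 1 - qexp \<tau> ^ Suc n)"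

definition eta_frame :: "frame_shape \<Rightarrow> complex \<Rightarrow> complex" where
  "eta_frame \<pi> \<tau> =
     (\<Prod>n\<in>Poly_Mapping.keys \<pi>. dedekind_eta (of_nat n * \<tau>) powi Poly_Mapping.lookup \<pi> n)"


section \<open>The groups\<close>

definition mat2 :: "real \<Rightarrow> real \<Rightarrow> real \<Rightarrow> real \<Rightarrow> real^2^2" where
  "mat2 a b c d = vector [vector [a, b], vector [c, d]]"

text \<open>\<open>S\<close> is meant to be a subgroup of the group of exact divisors of \<open>n\<close>.\<close>

definition Gamma0_plus :: "nat \<Rightarrow> nat set \<Rightarrow> (real^2^2) set" where
  "Gamma0_plus n S =
    {(1 / sqrt (real e)) *\<^sub>R mat2 (of_int a * real e) (of_int b) (of_int c * real n) (of_int d * real e)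
     | a b c d e. e \<in> S \<and>
        of_int a * of_int d * real e - of_int b * of_int c * real n / real e = (1 :: real)}"

definition Gamma0 :: "nat \<Rightarrow> (real^2^2) set" where
  "Gamma0 n = Gamma0_plus n {1}"

definition SL2Z :: "(real^2^2) set" where
  "SL2Z = {mat2 (of_int a) (of_int b) (of_int c) (of_int d) | a b c d. a * d - b * c = (1 :: int)}"

definition niemeier_group :: "root_system \<Rightarrow> (real^2^2) set" where
  "niemeier_group X =
    (let m = coxeter_number X in
     if X \<in> niemeier_A then Gamma0 m
     else if X \<in> niemeier_D then Gamma0_plus m {1, m div 2}
     else if X = replicate_mset 4 E6 then Gamma0_plus 12 {1, 4}
     else Gamma0_plus 30 {1, 6, 10, 15})"

definition moebius :: "real^2^2 \<Rightarrow> complex \<Rightarrow> complex" where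
  "moebius M \<tau> = (of_real (M$1$1) * \<tau> + of_real (M$1$2)) / (of_real (M$2$1) * \<tau> + of_real (M$2$2))"


section \<open>Function fields and principal moduli\<close>

text \<open>Meromorphy at a cusp \<open>\<sigma>(i\<infinity>)\<close> means having a Laurent expansion with finite
  principal part in the local parameter \<open>exp (2\<pi>i\<tau>/N)\<close>.  For \<open>\<Gamma>\<close> commensurable with
  \<open>SL\<^sub>2(\<int>)\<close>, every cusp is \<open>\<sigma>(i\<infinity>)\<close> for some \<open>\<sigma>\<close> in \<open>SL\<^sub>2(\<int>)\<close>, and an invariant
  function becomes periodic with some integral period \<open>N\<close> there.\<close>

definition meromorphic_at_cusp :: "(complex \<Rightarrow> complex) \<Rightarrow> real^2^2 \<Rightarrow> bool" where
  "meromorphic_at_cusp f \<sigma> \<longleftrightarrow>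
     (\<exists>N::nat. N > 0 \<and> (\<exists>g Y. g meromorphic_on {0} \<and>
        (\<forall>\<tau>. Im \<tau> > 0 \<and> Im \<tau> > Y \<longrightarrow> f (moebius \<sigma> \<tau>) = g (qexp (\<tau> / of_nat N)))))"

text \<open>Meromorphic functions on the compactified quotient \<open>X\<^sub>\<Gamma>\<close>, as functions on the upper half-plane.
  They are normalised to be continuous away from their poles and to be \<open>0\<close> at
  the poles (\<^term>\<open>f nicely_meromorphic_on A\<close>), so that the invariance can be
  required at every point.  The values outside the upper half-plane are irrelevant.\<close>

definition function_field :: "(real^2^2) set \<Rightarrow> (complex \<Rightarrow> complex) set" where
  "function_field \<Gamma> =
     {f. f nicely_meromorphic_on upper_half_plane \<and>
         (\<forall>M\<in>\<Gamma>. \<forall>\<tau>\<in>upper_half_plane. f (moebius M \<tau>) = f \<tau>) \<and>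
         (\<forall>\<sigma>\<in>SL2Z. meromorphic_at_cusp f \<sigma>)}"

text \<open>\<open>T\<close> generates the field if every element is a rational function of \<open>T\<close>; the identity is one
  of meromorphic functions, i.e. it may fail on a set without accumulation points in the upper half-plane.\<close>

definition principal_modulus :: "(real^2^2) set \<Rightarrow> (complex \<Rightarrow> complex) \<Rightarrow> bool" where
  "principal_modulus \<Gamma> T \<longleftrightarrow>
     T holomorphic_on upper_half_plane \<and> T \<in> function_field \<Gamma> \<and>
     (\<forall>f\<in>function_field \<Gamma>. \<exists>P Q :: complex poly.
        \<forall>\<^sub>\<approx>\<tau>\<in>upper_half_plane. poly Q (T \<tau>) \<noteq> 0 \<and> f \<tau> = poly P (T \<tau>) / poly Q (T \<tau>))"

text \<open>\<open>\<tau> \<rightarrow> i\<infinity>\<close> means that the imaginary part tends to infinity, uniformly in the real part.\<close>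

definition at_i_infinity :: "complex filter" where
  "at_i_infinity = filtercomap Im at_top"

definition has_principal_expansion :: "(complex \<Rightarrow> complex) \<Rightarrow> complex \<Rightarrow> bool" where
  "has_principal_expansion T c \<longleftrightarrow>
     (\<lambda>\<tau>. T \<tau> - (inverse (qexp \<tau>) + c)) \<in> O[at_i_infinity](qexp)"

end

theory Submission
  imports Defs
begin

text \<open>
  Write \<open>T\<close> for the eta quotient.  From Liouville's theorem applied to a quotient of theta functions one gets
  \<open>\<eta>(-1/\<tau>) = \<surd>(-i\<tau>) \<eta>(\<tau>)\<close>, the constant being determined by the values at the half-periods;
  hence the multiplier of \<open>\<eta>\<close> on \<open>SL\<^sub>2(\<int>)\<close> by the Euclidean algorithm.  Invariance of \<open>T\<close> under
  \<open>\<Gamma>\<^sub>0(n)\<close> needs to be checked on generators only; a finite list generates together with \<open>\<tau> \<mapsto> \<tau> + 1\<close>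
  once its isometric circles cover a period, and every coset \<open>e\<close> in \<open>S\<close> needs one more matrix.
  The orders at the cusps show that \<open>T\<close> has a pole only at the cusps equivalent to \<open>i\<infinity>\<close>, where it is simple.
  An element of the function field therefore becomes, after multiplication by a polynomial in \<open>T\<close> and
  subtraction of another one, bounded at all cusps, and such a function is constant by the maximum principle.
  For the uniqueness, let \<open>f\<close> be a second principal modulus with this expansion.  Since \<open>T\<close> is a rational function of
  \<open>f\<close> that takes \<open>\<infinity>\<close> to \<open>\<infinity>\<close>, \<open>f\<close> is finite wherever \<open>T\<close> is, so that \<open>f - T\<close> is constant.\<close>

section \<open>The q-Pochhammer symbol\<close>

text \<open>The quotient surface is never formed. Each group contains the principal congruence
  subgroup Gamma(m), m the Coxeter number, which is normal in SL2(Z). A cusp is therefore studied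
  through f(\<sigma>\<tau>) with \<sigma> in SL2(Z): all these functions have period m, and finitely
  many \<sigma> represent all of them. One Liouville theorem in this setting replaces the degree
  theory of the surface. The inversion of \<eta> comes out for the sixth power first: the Liouville
  constant contains squares of Euler products and is cubed when the three half-periods are
  multiplied, which is what lets Euler's identity cancel everything non-elementary. The root is then
  pinned down by continuity. What depends on the root system is reduced to integers: roots of unity
  are exponents modulo 24, square roots of gcds are compared after squaring, orders at cusps are
  cleared of denominators, and intervals are compared by cross-multiplication. So a single
  executable predicate, \<open>eta_data_ok\<close>, can be evaluated for all 23 cases.\<close>

lemma holomorphic_on_prodinf:
  fixes f :: "nat \<Rightarrow> complex \<Rightarrow> complex"
  assumes S: "open S" and hol: "\<And>k. f k holomorphic_on S"
    and bound: "\<And>z. z \<in> S \<Longrightarrow> \<exists>d>0. cball z d \<subseteq> S \<and>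
      (\<exists>M. summable M \<and> (\<forall>k. \<forall>w\<in>cball z d. norm (f k w - 1) \<le> M k))"
  shows "(\<lambda>z. prodinf (\<lambda>k. f k z)) holomorphic_on S"
proof (rule holomorphic_uniform_sequence[OF S])
  show "(\<lambda>z. \<Prod>k<n. f k z) holomorphic_on S" for n
    by (intro holomorphic_intros hol)
next
  fix z assume "z \<in> S"
  then obtain d M where d: "d > 0" "cball z d \<subseteq> S" and M: "summable M"
      "\<And>k w. w \<in> cball z d \<Longrightarrow> norm (f k w - 1) \<le> M k"
    using bound by meson
  have "uniformly_convergent_on (cball z d) (\<lambda>N w. \<Prod>n<N. f n w)"
  proof (rule uniformly_convergent_on_prod')
    show "continuous_on (cball z d) (f n)" for n
      using hol d(2) holomorphic_on_imp_continuous_on continuous_on_subset by blast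
    show "uniformly_convergent_on (cball z d) (\<lambda>N x. \<Sum>n<N. norm (f n x - 1))"
      by (rule Weierstrass_m_test'[OF _ M(1)]) (use M(2) in auto)
  qed auto
  then obtain g where g: "uniform_limit (cball z d) (\<lambda>N w. \<Prod>n<N. f n w) g sequentially"
    by (auto simp: uniformly_convergent_on_def)
  have "g w = prodinf (\<lambda>k. f k w)" if w: "w \<in> cball z d" for w
  proof -
    have "summable (\<lambda>k. norm (f k w - 1))"
      by (rule summable_comparison_test[OF _ M(1)]) (use M(2) w in auto)
    then have "convergent_prod (\<lambda>k. f k w)"
      by (intro abs_convergent_prod_imp_convergent_prod) (simp add: abs_convergent_prod_conv_summable)
    then have "(\<lambda>n. \<Prod>k\<le>n. f k w) \<longlonglongrightarrow> prodinf (\<lambda>k. f k w)"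
      by (rule convergent_prod_LIMSEQ)
    then have "(\<lambda>n. \<Prod>k<n. f k w) \<longlonglongrightarrow> prodinf (\<lambda>k. f k w)"
      by (subst LIMSEQ_lessThan_iff_atMost)
    moreover have "(\<lambda>n. \<Prod>k<n. f k w) \<longlonglongrightarrow> g w"
      using tendsto_uniform_limitI[OF g w] .
    ultimately show ?thesis using LIMSEQ_unique by blast
  qed
  then have "uniform_limit (cball z d) (\<lambda>N w. \<Prod>n<N. f n w) (\<lambda>w. prodinf (\<lambda>k. f k w)) sequentially"
    using g by (subst uniform_limit_cong') auto
  then show "\<exists>d>0. cball z d \<subseteq> S \<and>
      uniform_limit (cball z d) (\<lambda>n z. \<Prod>k<n. f k z) (\<lambda>z. prodinf (\<lambda>k. f k z)) sequentially"
    using d by blast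
qed

text \<open>In the usual notation this is (qu; q) with infinitely many factors. The parameter
  \<open>u\<close> lets one symbol serve \<eta> (\<open>u = 1\<close>) and the two products of the
  theta function (\<open>u = qexp z\<close> and \<open>u = qexp (- z)\<close>).\<close>

definition qpoch :: "complex \<Rightarrow> complex \<Rightarrow> complex" where
  "qpoch u q = prodinf (\<lambda>n. 1 - q ^ Suc n * u)"

lemma summable_qpoch:
  assumes "norm (q::complex) < 1"
  shows "summable (\<lambda>n. norm q ^ Suc n * K)"
  using assms by (intro summable_mult2) (simp add: summable_geometric)

lemma convergent_qpoch:
  assumes "norm q < 1"
  shows "convergent_prod (\<lambda>n. 1 - q ^ Suc n * u :: complex)"
  using summable_qpoch[OF assms, of "norm u"]
  by (intro abs_convergent_prod_imp_convergent_prod)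
     (simp add: abs_convergent_prod_conv_summable norm_mult norm_power)

lemma has_prod_qpoch:
  assumes "norm q < 1"
  shows "(\<lambda>n. 1 - q ^ Suc n * u) has_prod qpoch u q"
  unfolding qpoch_def using convergent_qpoch[OF assms] by (rule convergent_prod_has_prod)

lemma qpoch_LIMSEQ:
  assumes "norm q < 1"
  shows "(\<lambda>N. \<Prod>n<N. 1 - q ^ Suc n * u) \<longlonglongrightarrow> qpoch u q"
  using convergent_prod_LIMSEQ[OF convergent_qpoch[OF assms, of u]]
  unfolding qpoch_def by (subst LIMSEQ_lessThan_iff_atMost)

lemma qpoch_eq_0_iff:
  assumes "norm q < 1"
  shows "qpoch u q = 0 \<longleftrightarrow> (\<exists>n. q ^ Suc n * u = 1)"
  using has_prod_eq_0_iff[OF has_prod_qpoch[OF assms, of u]] by auto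

lemma qpoch_0_right [simp]: "qpoch u 0 = 1"
  by (simp add: qpoch_def)

lemma qpoch_shift:
  assumes "norm q < 1"
  shows "qpoch u q = (1 - q * u) * qpoch (q * u) q"
proof (rule LIMSEQ_unique)
  show "(\<lambda>N. \<Prod>n<Suc N. 1 - q ^ Suc n * u) \<longlonglongrightarrow> qpoch u q"
    using LIMSEQ_Suc[OF qpoch_LIMSEQ[OF assms, of u]] .
  have "(\<lambda>N. (1 - q * u) * (\<Prod>n<N. 1 - q ^ Suc n * (q * u))) \<longlonglongrightarrow> (1 - q * u) * qpoch (q * u) q"
    by (intro tendsto_intros qpoch_LIMSEQ assms)
  moreover have "(\<Prod>n<Suc N. 1 - q ^ Suc n * u) = (1 - q * u) * (\<Prod>n<N. 1 - q ^ Suc n * (q * u))" for N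
    by (subst prod.lessThan_Suc_shift) (simp add: mult_ac)
  ultimately show "(\<lambda>N. \<Prod>n<Suc N. 1 - q ^ Suc n * u) \<longlonglongrightarrow> (1 - q * u) * qpoch (q * u) q"
    by simp
qed

lemma qpoch_mult_minus:
  assumes "norm q < 1"
  shows "qpoch u q * qpoch (- u) q = qpoch (u\<^sup>2) (q\<^sup>2)"
proof (rule LIMSEQ_unique)
  have q2: "norm (q\<^sup>2) < 1"
    using assms by (simp add: norm_power power_less_one_iff)
  show "(\<lambda>N. \<Prod>n<N. 1 - (q\<^sup>2) ^ Suc n * u\<^sup>2) \<longlonglongrightarrow> qpoch (u\<^sup>2) (q\<^sup>2)"
    by (rule qpoch_LIMSEQ[OF q2])
  have "(\<lambda>N. (\<Prod>n<N. 1 - q ^ Suc n * u) * (\<Prod>n<N. 1 - q ^ Suc n * (- u))) \<longlonglongrightarrow> qpoch u q * qpoch (- u) q"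
    by (intro tendsto_mult qpoch_LIMSEQ assms)
  then show "(\<lambda>N. \<Prod>n<N. 1 - (q\<^sup>2) ^ Suc n * u\<^sup>2) \<longlonglongrightarrow> qpoch u q * qpoch (- u) q"
    by (simp add: prod.distrib[symmetric] algebra_simps power2_eq_square power_mult_distrib)
qed

text \<open>Separate the factors by the parity of the exponent: the even powers of \<open>q\<close>
  are powers of its square, and an odd power is such a power divided by \<open>q\<close>, which
  moves into the parameter \<open>u / q\<close>.\<close>

lemma qpoch_even_odd:
  assumes "norm q < 1" "q \<noteq> 0"
  shows "qpoch u q = qpoch u (q\<^sup>2) * qpoch (u / q) (q\<^sup>2)"
proof (rule LIMSEQ_unique)
  have q2: "norm (q\<^sup>2) < 1"
    using assms by (simp add: norm_power power_less_one_iff)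
  have "strict_mono (\<lambda>N::nat. 2 * N)" by (auto simp: strict_mono_def)
  from LIMSEQ_subseq_LIMSEQ[OF qpoch_LIMSEQ[OF assms(1), of u] this]
  show "(\<lambda>N. \<Prod>n<2*N. 1 - q ^ Suc n * u) \<longlonglongrightarrow> qpoch u q"
    by (simp add: o_def)
  have "(\<lambda>N. (\<Prod>n<N. 1 - (q\<^sup>2) ^ Suc n * u) * (\<Prod>n<N. 1 - (q\<^sup>2) ^ Suc n * (u / q)))
      \<longlonglongrightarrow> qpoch u (q\<^sup>2) * qpoch (u / q) (q\<^sup>2)"
    by (intro tendsto_mult qpoch_LIMSEQ q2)
  moreover have "(\<Prod>n<2*N. 1 - q ^ Suc n * u) =
      (\<Prod>n<N. 1 - (q\<^sup>2) ^ Suc n * u) * (\<Prod>n<N. 1 - (q\<^sup>2) ^ Suc n * (u / q))" for N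
  proof (induction N)
    case (Suc N)
    have "q * (q * u * (q ^ N * q ^ N)) = (q\<^sup>2) ^ Suc N * u" "q * u * (q ^ N * q ^ N) = (q\<^sup>2) ^ Suc N * (u / q)"
      using assms(2) by (simp_all add: power_mult_distrib power2_eq_square)
    moreover have "q ^ Suc (2 * N) * u = q * u * (q ^ N * q ^ N)"
        "q ^ Suc (Suc (2 * N)) * u = q * (q * u * (q ^ N * q ^ N))"
      by (simp_all add: mult_2 power_add)
    ultimately have "q ^ Suc (2 * N) * u = (q\<^sup>2) ^ Suc N * (u / q)"
        "q ^ Suc (Suc (2 * N)) * u = (q\<^sup>2) ^ Suc N * u" by simp_all
    moreover have "2 * Suc N = Suc (Suc (2 * N))" by simp
    ultimately show ?case by (simp only: prod.lessThan_Suc Suc.IH) (simp only: mult_ac)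
  qed auto
  ultimately show "(\<lambda>N. \<Prod>n<2*N. 1 - q ^ Suc n * u) \<longlonglongrightarrow> qpoch u (q\<^sup>2) * qpoch (u / q) (q\<^sup>2)"
    by simp
qed

lemma qpoch_1_nonzero:
  assumes "norm q < 1"
  shows "qpoch 1 q \<noteq> 0"
proof
  assume "qpoch 1 q = 0"
  then obtain n where "q ^ Suc n = 1" using qpoch_eq_0_iff[OF assms, of 1] by auto
  then have "norm q ^ Suc n = 1" by (metis norm_one norm_power)
  then show False using assms power_Suc_less_one[of "norm q" n]
    by (cases "norm q = 0") auto
qed

text \<open>With q the square of \<open>p\<close>, the last two factors multiply to the product of 1
  - q^(2n-1), so this is Euler's identity: the product of (1 + q^n)(1 - q^(2n-1)) over n >= 1 is 1.
  It is the reason why the half-period values of theta have an elementary product.\<close>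

lemma qpoch_half_periods:
  assumes "norm p < 1" "p \<noteq> 0"
  shows "qpoch (-1) (p\<^sup>2) * qpoch (1 / p) (p\<^sup>2) * qpoch (- (1 / p)) (p\<^sup>2) = 1"
proof -
  define q where "q = p\<^sup>2"
  have q: "norm q < 1" "q \<noteq> 0"
    using assms by (auto simp: q_def norm_power power_less_one_iff)
  have q2: "norm (q\<^sup>2) < 1"
    using q by (simp add: norm_power power_less_one_iff)
  have "qpoch (1 / p) q * qpoch (- (1 / p)) q = qpoch (1 / q) (q\<^sup>2)"
    using qpoch_mult_minus[OF q(1), of "1/p"] by (simp add: q_def power_divide)
  moreover have "qpoch 1 q * qpoch (-1) q = qpoch 1 (q\<^sup>2)"
    using qpoch_mult_minus[OF q(1), of 1] by simp
  moreover have "qpoch 1 q = qpoch 1 (q\<^sup>2) * qpoch (1 / q) (q\<^sup>2)"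
    using qpoch_even_odd[OF q, of 1] .
  ultimately show ?thesis
    using qpoch_1_nonzero[OF q(1)] qpoch_1_nonzero[OF q2]
    unfolding q_def[symmetric] by (simp add: field_simps)
qed

lemma holomorphic_qpoch_left:
  assumes "norm q < 1"
  shows "(\<lambda>u. qpoch u q) holomorphic_on UNIV"
  unfolding qpoch_def
proof (rule holomorphic_on_prodinf)
  fix z :: complex
  have "norm (1 - q ^ Suc k * w - 1) \<le> norm q ^ Suc k * (norm z + 1)" if "w \<in> cball z 1" for k w
  proof -
    have "norm w \<le> norm z + 1" using that norm_triangle_sub[of w z] by (auto simp: dist_norm norm_minus_commute)
    then show ?thesis by (auto simp: norm_mult norm_power intro!: mult_left_mono mult_nonneg_nonneg)
  qed
  then show "\<exists>d>0. cball z d \<subseteq> UNIV \<and>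
      (\<exists>M. summable M \<and> (\<forall>k. \<forall>w\<in>cball z d. norm (1 - q ^ Suc k * w - 1) \<le> M k))"
    using summable_qpoch[OF assms, of "norm z + 1"]
    by (intro exI[of _ 1] conjI exI[of _ "\<lambda>k. norm q ^ Suc k * (norm z + 1)"]) auto
qed (auto intro!: holomorphic_intros)

text \<open>The summable majorant exists only locally: on a disc reaching halfway from
  \<open>z\<close> to the unit circle it is geometric with ratio \<open>r < 1\<close>.\<close>

lemma holomorphic_qpoch_right: "(\<lambda>q. qpoch u q) holomorphic_on ball 0 1"
  unfolding qpoch_def
proof (rule holomorphic_on_prodinf)
  fix z :: complex assume "z \<in> ball 0 1"
  then have z: "norm z < 1" by simp
  define d where "d = (1 - norm z) / 2"
  define r where "r = norm z + d"
  have r: "0 \<le> r" "r < 1" and d: "d > 0" using z by (auto simp: r_def d_def field_simps add_nonneg_pos)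
  have "norm w \<le> r" if "w \<in> cball z d" for w
    using that norm_triangle_sub[of w z] by (auto simp: dist_norm norm_minus_commute r_def)
  then have sub: "cball z d \<subseteq> ball 0 1" using r by force
  have "norm (1 - w ^ Suc k * u - 1) \<le> r ^ Suc k * norm u" if "w \<in> cball z d" for k w
  proof -
    have "norm w \<le> r" using that norm_triangle_sub[of w z] by (auto simp: dist_norm norm_minus_commute r_def)
    then have "norm w ^ Suc k \<le> r ^ Suc k" by (intro power_mono) auto
    then show ?thesis by (auto simp: norm_mult norm_power simp del: power_Suc intro!: mult_right_mono)
  qed
  moreover have "summable (\<lambda>k. r ^ Suc k * norm u)"
    using r summable_qpoch[of "of_real r" "norm u"] by simp
  ultimately show "\<exists>d>0. cball z d \<subseteq> ball 0 1 \<and>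
      (\<exists>M. summable M \<and> (\<forall>k. \<forall>w\<in>cball z d. norm (1 - w ^ Suc k * u - 1) \<le> M k))"
    using d sub by (intro exI[of _ d] conjI exI[of _ "\<lambda>k. r ^ Suc k * norm u"]) auto
qed (auto intro!: holomorphic_intros)

section \<open>The theta function and the inversion of the eta function\<close>

text \<open>Jacobi's odd theta function in its product form, up to a factor depending on \<tau>
  alone. Leaving out the factor \<open>qpoch 1 (qexp \<tau>)\<close> makes the derivative at 0 equal
  to pi times the square of that factor.\<close>

definition theta :: "complex \<Rightarrow> complex \<Rightarrow> complex" where
  "theta \<tau> z = sin (of_real pi * z) * qpoch (qexp z) (qexp \<tau>) * qpoch (qexp (- z)) (qexp \<tau>)"

lemma qexp_add: "qexp (z + w) = qexp z * qexp w"
  by (simp add: qexp_def exp_add algebra_simps)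

lemma qexp_minus: "qexp (- z) = inverse (qexp z)"
  by (simp add: qexp_def exp_minus algebra_simps)

lemma qexp_nonzero [simp]: "qexp z \<noteq> 0"
  by (simp add: qexp_def)

lemma qexp_of_nat_mult: "qexp (of_nat n * z) = qexp z ^ n"
  by (simp add: qexp_def exp_of_nat_mult[symmetric] algebra_simps)

lemma qexp_of_int_mult: "qexp (of_int n * z) = qexp z powi n"
  by (simp add: qexp_def exp_power_int algebra_simps)

lemma norm_qexp: "norm (qexp z) = exp (- (2 * pi * Im z))"
  by (simp add: qexp_def)

lemma norm_qexp_less_1: "Im z > 0 \<Longrightarrow> norm (qexp z) < 1"
  by (simp add: norm_qexp)

lemma qexp_eq_1_iff: "qexp z = 1 \<longleftrightarrow> (\<exists>n::int. z = of_int n)"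
proof
  assume "qexp z = 1"
  then obtain n :: int where "Im (2 * of_real pi * \<i> * z) = of_int (2 * n) * pi"
      "Re (2 * of_real pi * \<i> * z) = 0"
    by (auto simp: qexp_def exp_eq_1)
  then have "z = of_int n" by (simp add: complex_eq_iff)
  then show "\<exists>n::int. z = of_int n" by blast
next
  assume "\<exists>n::int. z = of_int n"
  then show "qexp z = 1" by (auto simp: qexp_def exp_eq_1)
qed

lemma qexp_of_int [simp]: "qexp (of_int n) = 1"
  using qexp_eq_1_iff by blast

lemma qexp_1 [simp]: "qexp 1 = 1"
  using qexp_of_int[of 1] by simp

lemma qexp_half [simp]: "qexp (1 / 2) = - 1"
  by (simp add: qexp_def exp_pi_i)

lemma sin_qexp: "sin (of_real pi * z) = (qexp (z / 2) - qexp (- (z / 2))) / (2 * \<i>)"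
  by (simp add: sin_exp_eq qexp_def field_simps)

lemma holomorphic_qexp [holomorphic_intros]:
  "f holomorphic_on A \<Longrightarrow> (\<lambda>z. qexp (f z)) holomorphic_on A"
  unfolding qexp_def by (intro holomorphic_intros)

lemma theta_plus_1: "theta \<tau> (z + 1) = - theta \<tau> z"
proof -
  have "sin (of_real pi * (z + 1)) = - sin (of_real pi * z)"
    by (simp add: ring_distribs sin_add)
  moreover have "qexp (- (z + 1)) = qexp (- z)"
    by (simp only: qexp_minus qexp_add qexp_1 mult_1_right)
  ultimately show ?thesis by (simp add: theta_def qexp_add del: minus_add_distrib)
qed

text \<open>The shift replaces x = \<open>qexp z\<close> by qx. One product loses the factor 1 - qx,
  the other gains 1 - 1/x, and the sine, which is proportional to 1 - 1/x, becomes proportional to 1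
  - qx. Only the monomial factor survives.\<close>

lemma theta_plus_tau:
  assumes "Im \<tau> > 0"
  shows "theta \<tau> (z + \<tau>) = - inverse (qexp (\<tau> / 2)) * inverse (qexp z) * theta \<tau> z"
proof -
  define q x s t where "q = qexp \<tau>" and "x = qexp z" and "s = qexp (\<tau> / 2)" and "t = qexp (z / 2)"
  have nz: "q \<noteq> 0" "x \<noteq> 0" "s \<noteq> 0" "t \<noteq> 0" by (auto simp: q_def x_def s_def t_def)
  have q: "norm q < 1" using norm_qexp_less_1[OF assms] by (simp add: q_def)
  have st: "q = s * s" "x = t * t"
    by (simp_all add: q_def s_def x_def t_def qexp_add[symmetric])
  have A1: "qpoch x q = (1 - q * x) * qpoch (q * x) q"
    by (rule qpoch_shift[OF q])
  have A2: "qpoch (inverse (q * x)) q = (1 - inverse x) * qpoch (inverse x) q"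
  proof -
    have "q * inverse (q * x) = inverse x" using nz by (simp add: field_simps)
    then show ?thesis using qpoch_shift[OF q, of "inverse (q * x)"] by (simp only:)
  qed
  have "sin (of_real pi * (z + \<tau>)) = (s * t - inverse (s * t)) / (2 * \<i>)"
    unfolding sin_qexp qexp_minus
    by (simp only: s_def t_def add_divide_distrib qexp_add mult.commute)
  also have "\<dots> = - (inverse s * inverse t * (1 - q * x)) / (2 * \<i>)"
    using nz by (simp add: st field_simps)
  finally have s1: "sin (of_real pi * (z + \<tau>)) = - (inverse s * inverse t * (1 - q * x)) / (2 * \<i>)" .
  have s2: "sin (of_real pi * z) = (t - inverse t) / (2 * \<i>)"
    unfolding sin_qexp by (simp add: t_def qexp_minus)
  have "theta \<tau> (z + \<tau>) = - (inverse s * inverse t * (1 - q * x)) / (2 * \<i>) * qpoch (q * x) q * qpoch (inverse (q * x)) q"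
    unfolding theta_def s1 by (simp only: qexp_minus qexp_add q_def x_def mult.commute)
  also have "\<dots> = - (inverse s * inverse t) / (2 * \<i>) * qpoch x q * ((1 - inverse x) * qpoch (inverse x) q)"
    unfolding A1 A2 by simp
  also have "\<dots> = - inverse s * inverse x * ((t - inverse t) / (2 * \<i>) * qpoch x q * qpoch (inverse x) q)"
    using nz by (simp add: st field_simps)
  finally show ?thesis
    unfolding theta_def s2[symmetric] by (simp add: s_def x_def q_def qexp_minus)
qed

lemma theta_eq_0_iff:
  assumes "Im \<tau> > 0"
  shows "theta \<tau> z = 0 \<longleftrightarrow> (\<exists>m n::int. z = of_int m + of_int n * \<tau>)"
proof
  define q where "q = qexp \<tau>"
  have q: "norm q < 1" using norm_qexp_less_1[OF assms] by (simp add: q_def)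
  assume "theta \<tau> z = 0"
  then consider "sin (of_real pi * z) = 0" | "qpoch (qexp z) q = 0" | "qpoch (qexp (-z)) q = 0"
    by (auto simp: theta_def q_def)
  then show "\<exists>m n::int. z = of_int m + of_int n * \<tau>"
  proof cases
    case 1
    then have "qexp z = 1"
      unfolding sin_qexp by (simp add: qexp_minus field_simps qexp_add[symmetric])
    then obtain m :: int where "z = of_int m" using qexp_eq_1_iff by blast
    then show ?thesis by (intro exI[of _ m] exI[of _ 0]) simp
  next
    case 2
    then obtain n where "q ^ Suc n * qexp z = 1" using qpoch_eq_0_iff[OF q] by blast
    then have "qexp (of_nat (Suc n) * \<tau> + z) = 1" by (simp only: q_def qexp_of_nat_mult qexp_add)
    then obtain m :: int where "of_nat (Suc n) * \<tau> + z = of_int m" using qexp_eq_1_iff by blast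
    then have "z = of_int m + of_int (- int (Suc n)) * \<tau>" by (simp add: algebra_simps eq_diff_eq)
    then show ?thesis by blast
  next
    case 3
    then obtain n where "q ^ Suc n * qexp (- z) = 1" using qpoch_eq_0_iff[OF q] by blast
    then have "qexp (of_nat (Suc n) * \<tau> + (- z)) = 1" by (simp only: q_def qexp_of_nat_mult qexp_add)
    then obtain m :: int where "of_nat (Suc n) * \<tau> + (- z) = of_int m" using qexp_eq_1_iff by blast
    then have "z = of_int (- m) + of_int (int (Suc n)) * \<tau>" by (simp add: algebra_simps eq_diff_eq)
    then show ?thesis by blast
  qed
next
  \<comment> \<open>Quasi-periodicity carries the zeros of the sine upwards along the lattice;
    oddness then supplies the negative multiples of \<tau>.\<close>
  have step: "theta \<tau> (of_int m + of_nat n * \<tau>) = 0" for m :: int and n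
  proof (induction n)
    case 0
    have "qexp (of_int m / 2) = qexp (- (of_int m / 2) + of_int m)" by (simp add: field_simps)
    also have "\<dots> = qexp (- (of_int m / 2))" by (simp only: qexp_add qexp_of_int mult_1_right)
    finally have "sin (of_real pi * of_int m :: complex) = 0" unfolding sin_qexp by simp
    then show ?case by (simp add: theta_def)
  next
    case (Suc n)
    then show ?case using theta_plus_tau[OF assms, of "of_int m + of_nat n * \<tau>"]
      by (simp add: algebra_simps)
  qed
  assume "\<exists>m n::int. z = of_int m + of_int n * \<tau>"
  then obtain m n :: int where z: "z = of_int m + of_int n * \<tau>" by blast
  have odd: "theta \<tau> (- w) = - theta \<tau> w" for w by (simp add: theta_def mult_ac)
  show "theta \<tau> z = 0"
  proof (cases "n \<ge> 0")
    case True
    then show ?thesis using step[of m "nat n"] by (simp add: z)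
  next
    case False
    then show ?thesis using step[of "-m" "nat (-n)"] odd[of z] by (simp add: z)
  qed
qed

lemma holomorphic_theta:
  assumes "Im \<tau> > 0" "g holomorphic_on A"
  shows "(\<lambda>z. theta \<tau> (g z)) holomorphic_on A"
proof -
  have q: "norm (qexp \<tau>) < 1" using norm_qexp_less_1[OF assms(1)] .
  have *: "(\<lambda>z. qpoch (h z) (qexp \<tau>)) holomorphic_on A" if "h holomorphic_on A" for h
    using holomorphic_on_compose_gen[OF that holomorphic_qpoch_left[OF q]] by (simp add: o_def)
  show ?thesis unfolding theta_def
    by (intro holomorphic_intros * assms)
qed

lemma periodic_int:
  fixes f :: "complex \<Rightarrow> 'a"
  assumes "\<And>z. f (z + p) = f z"
  shows "f (z + of_int n * p) = f z"
proof (induction n arbitrary: z rule: int_induct[of _ 0])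
  case (step1 i)
  then show ?case using assms[of "z + of_int i * p"] by (simp add: algebra_simps)
next
  case (step2 i)
  then show ?case using assms[of "z + of_int (i - 1) * p"] by (simp add: algebra_simps)
qed auto

lemma doubly_periodic_entire_constant:
  assumes hol: "f holomorphic_on UNIV" and \<tau>: "Im \<tau> > 0"
    and p1: "\<And>z. f (z + 1) = f z" and p2: "\<And>z. f (z + \<tau>) = f z"
  shows "f z = f w"
proof -
  define K where "K = (\<lambda>(x, y). complex_of_real x + of_real y * \<tau>) ` (cbox (0, 0) (1, 1))"
  have "compact K" unfolding K_def case_prod_unfold
    by (intro compact_continuous_image compact_cbox continuous_intros)
  moreover have "continuous_on K f"
    using holomorphic_on_imp_continuous_on[OF hol] continuous_on_subset by blast
  ultimately have "bounded (f ` K)"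
    using compact_continuous_image compact_imp_bounded by blast
  moreover have "range f \<subseteq> f ` K"
  proof safe
    fix z :: complex
    define y where "y = Im z / Im \<tau>"
    define x where "x = Re z - y * Re \<tau>"
    have z: "z = of_real x + of_real y * \<tau>"
      using \<tau> by (simp add: complex_eq_iff x_def y_def)
    define z' where "z' = of_real (frac x) + of_real (frac y) * \<tau>"
    have "z = (z' + of_int \<lfloor>x\<rfloor> * 1) + of_int \<lfloor>y\<rfloor> * \<tau>"
      unfolding z z'_def frac_def by (simp add: algebra_simps)
    then have "f z = f z'"
      by (simp only: periodic_int[of f, OF p1] periodic_int[of f, OF p2])
    moreover have "z' \<in> K"
      unfolding K_def z'_def using frac_ge_0 frac_lt_1
      by (intro image_eqI[of _ _ "(frac x, frac y)"]) (auto simp: cbox_Pair_eq intro: less_imp_le)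
    ultimately show "f z \<in> f ` K" by auto
  qed
  ultimately have "bounded (range f)" using bounded_subset by blast
  then obtain c where "\<And>z. f z = c"
    using Liouville_theorem[OF hol] by (auto simp: constant_on_def)
  then show ?thesis by simp
qed

lemma Im_minus_inverse_pos:
  assumes "Im \<tau> > 0"
  shows "Im (- 1 / \<tau>) > 0"
  using assms by (auto simp: Im_divide intro!: divide_pos_pos add_nonneg_pos)

lemma theta_minus: "theta \<tau> (- z) = - theta \<tau> z"
  by (simp add: theta_def mult_ac)

text \<open>The scaling by \<open>a\<close> is there because numerator and denominator of the
  quotient in \<open>theta_inversion\<close> need the cases \<open>a = \<tau>\<close> and
  \<open>a = 1\<close>, with different parameters.\<close>

lemma theta_deriv_0:
  assumes "Im \<tau> > 0" and a: "a \<noteq> 0"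
  shows "((\<lambda>z. theta \<tau> (z / a) / z) \<longlongrightarrow> of_real pi / a * qpoch 1 (qexp \<tau>) ^ 2) (at 0)"
proof -
  have q: "norm (qexp \<tau>) < 1" using norm_qexp_less_1[OF assms(1)] .
  have 1: "((\<lambda>z. sin (of_real pi * (z / a)) / z) \<longlongrightarrow> of_real pi / a) (at 0)"
  proof -
    have "((\<lambda>z. sin (of_real pi * (z / a))) has_field_derivative of_real pi / a) (at 0)"
      using a by (auto intro!: derivative_eq_intros)
    then show ?thesis by (simp add: has_field_derivative_iff)
  qed
  have c: "continuous_on UNIV (\<lambda>u. qpoch u (qexp \<tau>))"
    using holomorphic_qpoch_left[OF q] holomorphic_on_imp_continuous_on by blast
  have q0: "((\<lambda>z. qpoch (g z) (qexp \<tau>)) \<longlongrightarrow> qpoch 1 (qexp \<tau>)) (at 0)"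
    if "(g \<longlongrightarrow> 1) (at 0)" for g :: "complex \<Rightarrow> complex"
  proof -
    have "isCont (\<lambda>u. qpoch u (qexp \<tau>)) 1"
      using c by (simp add: continuous_on_eq_continuous_at)
    then show ?thesis using isCont_tendsto_compose[OF _ that] by blast
  qed
  have g: "((\<lambda>z. qexp (c * z)) \<longlongrightarrow> 1) (at 0)" for c
    unfolding qexp_def by (auto intro!: tendsto_eq_intros)
  have "((\<lambda>z. sin (of_real pi * (z / a)) / z * qpoch (qexp (1 / a * z)) (qexp \<tau>) *
      qpoch (qexp (- (1 / a) * z)) (qexp \<tau>)) \<longlongrightarrow>
      of_real pi / a * qpoch 1 (qexp \<tau>) * qpoch 1 (qexp \<tau>)) (at 0)"
    by (intro tendsto_mult 1 q0 g)
  then show ?thesis by (simp add: theta_def power2_eq_square mult_ac)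
qed

text \<open>The Gaussian factor is chosen so that the left side acquires the same multipliers under
  z + 1 and z + \<tau> as \<open>theta \<tau> z\<close>. Both sides vanish on the same lattice, so
  their quotient is elliptic without poles, hence constant. The constant is the ratio of the
  derivatives at 0.\<close>

lemma theta_inversion:
  assumes \<tau>: "Im \<tau> > 0"
  shows "theta (- 1 / \<tau>) (z / \<tau>) * qexp (- (z\<^sup>2 / (2 * \<tau>))) =
    (qpoch 1 (qexp (- 1 / \<tau>)))\<^sup>2 / (\<tau> * (qpoch 1 (qexp \<tau>))\<^sup>2) * theta \<tau> z"
proof -
  define \<tau>' where "\<tau>' = - 1 / \<tau>"
  have \<tau>0: "\<tau> \<noteq> 0" using \<tau> by auto
  have \<tau>': "Im \<tau>' > 0" unfolding \<tau>'_def by (rule Im_minus_inverse_pos[OF \<tau>])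
  define C where "C = (qpoch 1 (qexp \<tau>'))\<^sup>2 / (\<tau> * (qpoch 1 (qexp \<tau>))\<^sup>2)"
  define num where "num = (\<lambda>z. theta \<tau>' (z / \<tau>) * qexp (- (z\<^sup>2 / (2 * \<tau>))))"
  define Z where "Z = {z. theta \<tau> z = 0}"
  have num1: "num (z + 1) = - num z" for z
  proof -
    define w where "w = z / \<tau> - \<tau>'"
    have w: "(z + 1) / \<tau> = w" "z / \<tau> = w + \<tau>'" by (simp_all add: w_def \<tau>'_def add_divide_distrib)
    have "theta \<tau>' w = - (qexp (\<tau>' / 2) * qexp w) * theta \<tau>' (w + \<tau>')"
      unfolding theta_plus_tau[OF \<tau>'] by (simp add: field_simps)
    moreover have "- ((z + 1)\<^sup>2 / (2 * \<tau>)) = - (z\<^sup>2 / (2 * \<tau>)) + - (\<tau>' / 2) + - w"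
      using \<tau>0 by (simp add: w_def \<tau>'_def field_simps power2_eq_square)
    ultimately show ?thesis
      unfolding num_def w by (simp only: qexp_add qexp_minus) (simp add: field_simps)
  qed
  have num2: "num (z + \<tau>) = - inverse (qexp (\<tau> / 2)) * inverse (qexp z) * num z" for z
  proof -
    have w: "(z + \<tau>) / \<tau> = z / \<tau> + 1" using \<tau>0 by (simp add: field_simps)
    have "- ((z + \<tau>)\<^sup>2 / (2 * \<tau>)) = - (z\<^sup>2 / (2 * \<tau>)) + - (\<tau> / 2) + - z"
      using \<tau>0 by (simp add: field_simps power2_eq_square)
    then show ?thesis unfolding num_def w theta_plus_1
      by (simp only: qexp_add qexp_minus) (simp add: field_simps)
  qed
  \<comment> \<open>The value at every lattice point is the expected limit \<open>C\<close>. This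
    keeps \<open>G\<close> periodic by definition and leaves only continuity at 0 to be
    shown.\<close>
  define G where "G = (\<lambda>z. if z \<in> Z then C else num z / theta \<tau> z)"
  have G1: "G (z + 1) = G z" for z
    by (simp add: G_def Z_def num1 theta_plus_1)
  have G2: "G (z + \<tau>) = G z" for z
    unfolding G_def Z_def num2 mem_Collect_eq theta_plus_tau[OF \<tau>] by simp
  have holtheta: "theta \<tau> holomorphic_on A" for A
    using holomorphic_theta[OF \<tau>, of "\<lambda>z. z" A] by simp
  have holnum: "num holomorphic_on A" for A
    unfolding num_def using \<tau>0 by (intro holomorphic_intros holomorphic_theta[OF \<tau>']) auto
  define U where "U = - Z"
  have "closed Z"
    unfolding Z_def using holomorphic_on_imp_continuous_on[OF holtheta]
    by (intro continuous_closed_preimage_constant[of UNIV, simplified]) auto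
  then have opU: "open U" by (simp add: U_def open_Compl)
  have holU: "G holomorphic_on U"
  proof -
    have "(\<lambda>z. num z / theta \<tau> z) holomorphic_on U"
      by (intro holomorphic_intros holnum holtheta) (auto simp: U_def Z_def)
    then show ?thesis
      by (rule holomorphic_transform) (auto simp: G_def U_def)
  qed
  \<comment> \<open>Small enough that 0 is the only lattice point in the ball: first the imaginary
    part excludes \<open>n\<close>, then the real part excludes \<open>m\<close>.\<close>
  define r where "r = min 1 (Im \<tau>)"
  have r: "r > 0" using \<tau> by (simp add: r_def)
  have ballZ: "z = 0" if zr: "z \<in> ball 0 r" and zZ: "z \<in> Z" for z
  proof -
    obtain m n :: int where z: "z = of_int m + of_int n * \<tau>"
      using zZ theta_eq_0_iff[OF \<tau>] by (auto simp: Z_def)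
    have "\<bar>Im z\<bar> < Im \<tau>" using zr abs_Im_le_cmod[of z] by (auto simp: r_def)
    then have "\<bar>of_int n\<bar> * Im \<tau> < 1 * Im \<tau>" using \<tau> by (simp add: z abs_mult)
    then have "\<bar>of_int n :: real\<bar> < 1" using \<tau> by (simp only: mult_less_cancel_right_pos)
    then have n: "n = 0" by linarith
    have "\<bar>Re z\<bar> < 1" using zr abs_Re_le_cmod[of z] by (auto simp: r_def)
    then have "m = 0" by (simp add: z n)
    then show ?thesis by (simp add: z n)
  qed
  have Z0: "0 \<in> Z" by (simp add: Z_def theta_def)
  have lim0: "(G \<longlongrightarrow> C) (at 0)"
  proof -
    have "((\<lambda>z. (theta \<tau>' (z / \<tau>) / z) * qexp (- (z\<^sup>2 / (2 * \<tau>))) / (theta \<tau> (z / 1) / z)) \<longlongrightarrow>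
        of_real pi / \<tau> * qpoch 1 (qexp \<tau>') ^ 2 * 1 / (of_real pi / 1 * qpoch 1 (qexp \<tau>) ^ 2)) (at 0)"
    proof (intro tendsto_divide tendsto_mult theta_deriv_0 \<tau> \<tau>' \<tau>0 one_neq_zero)
      show "((\<lambda>z. qexp (- (z\<^sup>2 / (2 * \<tau>)))) \<longlongrightarrow> 1) (at 0)"
        unfolding qexp_def using \<tau>0 by (auto intro!: tendsto_eq_intros)
      show "of_real pi / 1 * qpoch 1 (qexp \<tau>) ^ 2 \<noteq> 0"
        using qpoch_1_nonzero[OF norm_qexp_less_1[OF \<tau>]] by simp
    qed
    then have "((\<lambda>z. (theta \<tau>' (z / \<tau>) / z) * qexp (- (z\<^sup>2 / (2 * \<tau>))) / (theta \<tau> (z / 1) / z)) \<longlongrightarrow> C) (at 0)"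
      by (simp add: C_def)
    moreover have "\<forall>\<^sub>F z in at 0. (theta \<tau>' (z / \<tau>) / z) * qexp (- (z\<^sup>2 / (2 * \<tau>))) / (theta \<tau> (z / 1) / z) = G z"
    proof -
      have "\<forall>\<^sub>F z in at 0. z \<in> ball 0 r - {0}"
        using r by (intro eventually_at_in_open) auto
      then show ?thesis
      proof eventually_elim
        case (elim z)
        then show ?case using ballZ[of z] by (auto simp: G_def num_def)
      qed
    qed
    ultimately show ?thesis using Lim_transform_eventually by blast
  qed
  have hol0: "G holomorphic_on ball 0 r"
  proof (rule no_isolated_singularity'[where K = "{0}"])
    show "(G \<longlongrightarrow> G z) (at z within ball 0 r)" if "z \<in> {0}" for z
      using that lim0 Z0 by (auto simp: G_def intro: Lim_at_imp_Lim_at_within)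
    show "G holomorphic_on ball 0 r - {0}"
      by (rule holomorphic_on_subset[OF holU]) (use ballZ in \<open>auto simp: U_def\<close>)
  qed auto
  have "G field_differentiable at z" for z
  proof (cases "z \<in> Z")
    case False
    then show ?thesis using holU opU by (auto simp: U_def holomorphic_on_open field_differentiable_def)
  next
    case True
    then obtain m n :: int where z: "z = of_int m + of_int n * \<tau>"
      using theta_eq_0_iff[OF \<tau>] by (auto simp: Z_def)
    have "G (w + of_int m * 1 + of_int n * \<tau>) = G w" for w
      by (simp only: periodic_int[of G, OF G1] periodic_int[of G, OF G2])
    \<comment> \<open>Periodicity carries the removed singularity at 0 to every other lattice
      point.\<close>
    from this[of "w - z" for w] have G: "G = (\<lambda>w. G (w - z))" by (auto simp: z fun_eq_iff)
    have "G field_differentiable at 0"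
      using hol0 r by (auto simp: holomorphic_on_open field_differentiable_def)
    then obtain D where "(G has_field_derivative D) (at (z - z))" by (auto simp: field_differentiable_def)
    then have "((\<lambda>w. G (w - z)) has_field_derivative D * 1) (at z)"
      by (intro DERIV_chain2) (auto intro!: derivative_eq_intros)
    then show ?thesis using G by (auto simp: field_differentiable_def)
  qed
  then have "G holomorphic_on UNIV" by (simp add: holomorphic_on_def field_differentiable_at_within)
  then have "G z = G 0" by (rule doubly_periodic_entire_constant[OF _ \<tau> G1 G2])
  also have "G 0 = C" using Z0 by (simp add: G_def)
  finally have Gz: "G z = C" .
  have "num z = C * theta \<tau> z"
  proof (cases "z \<in> Z")
    case False
    then show ?thesis using Gz by (auto simp: G_def Z_def field_simps)
  next
    case True
    then obtain m n :: int where z: "z = of_int m + of_int n * \<tau>"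
      using theta_eq_0_iff[OF \<tau>] by (auto simp: Z_def)
    have "z / \<tau> = of_int n + of_int (- m) * \<tau>'" using \<tau>0 by (simp add: z \<tau>'_def field_simps)
    then have "theta \<tau>' (z / \<tau>) = 0" using theta_eq_0_iff[OF \<tau>'] by blast
    then show ?thesis using True by (simp add: num_def Z_def)
  qed
  then show ?thesis by (simp add: num_def C_def \<tau>'_def)
qed

text \<open>Each value is an elementary factor times the square of one of the three products in
  \<open>qpoch_half_periods\<close>: at a half-period \<open>qexp z\<close> and
  \<open>qexp (- z)\<close> agree up to a power of \<open>qexp \<tau>\<close>, and where they differ
  the sine supplies the missing factor.\<close>

lemma theta_half_periods:
  assumes \<tau>: "Im \<tau> > 0"
  shows "theta \<tau> (1 / 2) * theta \<tau> (\<tau> / 2) * theta \<tau> (1 / 2 + \<tau> / 2) = \<i> / (4 * qexp (\<tau> / 2))"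
proof -
  define q p s where "q = qexp \<tau>" and "p = qexp (\<tau> / 2)" and "s = qexp (\<tau> / 4)"
  have nz: "q \<noteq> 0" "p \<noteq> 0" "s \<noteq> 0" by (auto simp: q_def p_def s_def)
  have q: "norm q < 1" and p: "norm p < 1"
    using norm_qexp_less_1[OF \<tau>] norm_qexp_less_1[of "\<tau> / 2"] \<tau> by (simp_all add: q_def p_def)
  have rel: "q = p\<^sup>2" "p = s\<^sup>2"
    by (simp_all add: q_def p_def s_def power2_eq_square qexp_add[symmetric])
  have "qexp (- 1 / 2) = -1"
    using qexp_minus[of "1/2"] by simp
  then have t1: "theta \<tau> (1 / 2) = (qpoch (-1) q)\<^sup>2"
    using sin_of_real[of "pi/2", where 'a = complex]
    by (simp add: theta_def q_def power2_eq_square)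
  have t2: "theta \<tau> (\<tau> / 2) = \<i> / (2 * s) * (qpoch (1 / p) q)\<^sup>2"
  proof -
    have "sin (of_real pi * (\<tau> / 2)) = (s - inverse s) / (2 * \<i>)"
      unfolding sin_qexp by (simp add: s_def qexp_minus)
    also have "\<dots> = \<i> / (2 * s) * (1 - p)" using nz
      by (simp add: rel field_simps power2_eq_square)
    finally have sn: "sin (of_real pi * (\<tau> / 2)) = \<i> / (2 * s) * (1 - p)" .
    have "qpoch (1 / p) q = (1 - p) * qpoch p q"
      using qpoch_shift[OF q, of "1 / p"] nz by (simp add: rel power2_eq_square)
    then show ?thesis unfolding theta_def sn
      by (simp add: qexp_minus p_def[symmetric] q_def[symmetric] power2_eq_square inverse_eq_divide)
  qed
  have t3: "theta \<tau> (1 / 2 + \<tau> / 2) = 1 / (2 * s) * (qpoch (- (1 / p)) q)\<^sup>2"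
  proof -
    have i: "qexp (1 / 4) = \<i>"
      by (simp add: qexp_def exp_eq_polar cis.ctr complex_eq_iff)
    have "sin (of_real pi * (1 / 2 + \<tau> / 2)) = (\<i> * s - inverse (\<i> * s)) / (2 * \<i>)"
      unfolding sin_qexp qexp_minus by (simp add: s_def add_divide_distrib qexp_add i)
    also have "\<dots> = 1 / (2 * s) * (1 + p)" using nz
      by (simp add: rel field_simps power2_eq_square)
    finally have sn: "sin (of_real pi * (1 / 2 + \<tau> / 2)) = 1 / (2 * s) * (1 + p)" .
    have *: "qpoch (- (1 / p)) q = (1 + p) * qpoch (- p) q"
      using qpoch_shift[OF q, of "- (1 / p)"] nz by (simp add: rel power2_eq_square)
    have "qexp (1 / 2 + \<tau> / 2) = - p" "qexp (- (1 / 2 + \<tau> / 2)) = - (1 / p)"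
      by (simp_all only: qexp_minus qexp_add qexp_half p_def[symmetric]) (simp_all add: field_simps nz)
    then show ?thesis unfolding theta_def sn
      by (simp add: * q_def[symmetric] power2_eq_square)
  qed
  have "qpoch (-1) q * qpoch (1 / p) q * qpoch (- (1 / p)) q = 1"
    using qpoch_half_periods[OF p nz(2)] by (simp add: rel(1))
  then have "(qpoch (-1) q * qpoch (1 / p) q * qpoch (- (1 / p)) q)\<^sup>2 = 1" by simp
  then have "(qpoch (-1) q)\<^sup>2 * (qpoch (1 / p) q)\<^sup>2 * (qpoch (- (1 / p)) q)\<^sup>2 = 1"
    by (simp add: power_mult_distrib)
  moreover have "(qpoch (-1) q)\<^sup>2 * (\<i> / (2 * s) * (qpoch (1 / p) q)\<^sup>2) * (1 / (2 * s) * (qpoch (- (1 / p)) q)\<^sup>2) =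
     (qpoch (-1) q)\<^sup>2 * (qpoch (1 / p) q)\<^sup>2 * (qpoch (- (1 / p)) q)\<^sup>2 * (\<i> / (4 * s\<^sup>2))"
    by (simp add: power2_eq_square)
  ultimately show ?thesis unfolding t1 t2 t3 by (simp add: rel(2) p_def[symmetric])
qed

section \<open>The eta function: inversion\<close>

lemma eta_eq: "dedekind_eta \<tau> = qexp (\<tau> / 24) * qpoch 1 (qexp \<tau>)"
  by (simp add: dedekind_eta_def qpoch_def)

lemma eta_nonzero: "Im \<tau> > 0 \<Longrightarrow> dedekind_eta \<tau> \<noteq> 0"
  using qpoch_1_nonzero[OF norm_qexp_less_1] by (simp add: eta_eq)

text \<open>Division by \<tau> permutes the half-periods modulo the new lattice and signs: 1/2 and
  \<tau>/2 are exchanged, their sum is fixed. Multiplying \<open>theta_inversion\<close> over the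
  three points gives the cube of its constant, hence the sixth power of the Euler products; the
  elementary factors combine with them to \<eta>.\<close>

lemma eta_inversion_6:
  assumes \<tau>: "Im \<tau> > 0"
  shows "dedekind_eta (- 1 / \<tau>) ^ 6 = \<i> * \<tau> ^ 3 * dedekind_eta \<tau> ^ 6"
proof -
  define \<tau>' where "\<tau>' = - 1 / \<tau>"
  have \<tau>0: "\<tau> \<noteq> 0" using \<tau> by auto
  have \<tau>': "Im \<tau>' > 0" unfolding \<tau>'_def by (rule Im_minus_inverse_pos[OF \<tau>])
  define A B where "A = qpoch 1 (qexp \<tau>)" and "B = qpoch 1 (qexp \<tau>')"
  have A: "A \<noteq> 0" using qpoch_1_nonzero[OF norm_qexp_less_1[OF \<tau>]] by (simp add: A_def)
  define C where "C = B\<^sup>2 / (\<tau> * A\<^sup>2)"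
  define E where "E = (\<lambda>z::complex. qexp (- (z\<^sup>2 / (2 * \<tau>))))"
  have inv: "theta \<tau>' (z / \<tau>) * E z = C * theta \<tau> z" for z
    using theta_inversion[OF \<tau>, of z] by (simp add: \<tau>'_def C_def A_def B_def E_def)
  have z1: "theta \<tau>' ((1 / 2) / \<tau>) = - theta \<tau>' (\<tau>' / 2)"
    by (simp add: \<tau>'_def theta_minus[symmetric] mult.commute)
  have z2: "theta \<tau>' ((\<tau> / 2) / \<tau>) = theta \<tau>' (1 / 2)" using \<tau>0 by simp
  have z3: "theta \<tau>' ((1 / 2 + \<tau> / 2) / \<tau>) = theta \<tau>' (1 / 2 + \<tau>' / 2)"
  proof -
    have "(1 / 2 + \<tau> / 2) / \<tau> = - (1 / 2 + \<tau>' / 2) + 1" using \<tau>0 by (simp add: \<tau>'_def field_simps)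
    then have "theta \<tau>' ((1 / 2 + \<tau> / 2) / \<tau>) = - theta \<tau>' (- (1 / 2 + \<tau>' / 2))" by (simp only: theta_plus_1)
    then show ?thesis by (simp only: theta_minus) simp
  qed
  have E: "E (1/2) * E (\<tau>/2) * E (1/2 + \<tau>/2) = qexp (\<tau>' / 4) * qexp (- (\<tau> / 4)) * qexp (- (1 / 4))"
    unfolding E_def qexp_add[symmetric] using \<tau>0
    by (intro arg_cong[where f = qexp]) (simp add: \<tau>'_def field_simps power2_eq_square)
  have i: "qexp (1 / 4) = \<i>"
    by (simp add: qexp_def exp_eq_polar cis.ctr complex_eq_iff)
  have "C ^ 3 * (\<i> / (4 * qexp (\<tau> / 2))) = (C * theta \<tau> (1/2)) * (C * theta \<tau> (\<tau>/2)) * (C * theta \<tau> (1/2 + \<tau>/2))"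
    using theta_half_periods[OF \<tau>] by (simp add: power3_eq_cube mult_ac)
  also have "\<dots> = - (theta \<tau>' (1 / 2) * theta \<tau>' (\<tau>' / 2) * theta \<tau>' (1 / 2 + \<tau>' / 2)) * (E (1/2) * E (\<tau>/2) * E (1/2 + \<tau>/2))"
    unfolding inv[symmetric] z1 z2 z3 by (simp add: mult_ac)
  also have "\<dots> = - (\<i> / (4 * qexp (\<tau>' / 2))) * (qexp (\<tau>' / 4) * qexp (- (\<tau> / 4)) * (- \<i>))"
    unfolding theta_half_periods[OF \<tau>'] E by (simp add: qexp_minus i)
  finally have "\<i> * (C ^ 3 * qexp (\<tau>' / 2)) = - (qexp (\<tau>' / 4) * qexp (- (\<tau> / 4)) * qexp (\<tau> / 2))"
    by (simp add: field_simps)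
  then have "- \<i> * (\<i> * (C ^ 3 * qexp (\<tau>' / 2))) = - \<i> * - (qexp (\<tau>' / 4) * qexp (- (\<tau> / 4)) * qexp (\<tau> / 2))"
    by (simp only:)
  then have C3: "C ^ 3 * qexp (\<tau>' / 2) = \<i> * (qexp (\<tau>' / 4) * qexp (- (\<tau> / 4))) * qexp (\<tau> / 2)"
    by simp
  have half: "qexp (\<tau> / 2) = qexp (\<tau> / 4) ^ 2" "qexp (\<tau>' / 2) = qexp (\<tau>' / 4) ^ 2"
    by (simp_all add: power2_eq_square qexp_add[symmetric])
  have "C ^ 3 * qexp (\<tau>' / 4) = \<i> * qexp (\<tau> / 4)"
    using C3 unfolding half qexp_minus by (simp add: power2_eq_square field_simps)
  then have "B ^ 6 * qexp (\<tau>' / 4) = \<i> * \<tau> ^ 3 * (A ^ 6 * qexp (\<tau> / 4))"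
    using A \<tau>0 by (simp add: C_def power_divide power_mult_distrib power_mult[symmetric] field_simps)
  moreover have "qexp (x / 24) ^ 6 = qexp (x / 4)" for x
    by (simp add: qexp_of_nat_mult[of 6, symmetric])
  ultimately show ?thesis
    unfolding \<tau>'_def[symmetric] eta_eq power_mult_distrib A_def[symmetric] B_def[symmetric]
    by (simp add: mult_ac)
qed

lemma open_upper_half_plane: "open {\<tau>. Im \<tau> > 0}"
  by (simp add: open_halfspace_Im_gt)

lemma convex_upper_half_plane: "convex {\<tau>. Im \<tau> > 0}"
  by (simp add: convex_halfspace_Im_gt)

lemma holomorphic_eta:
  assumes "g holomorphic_on A" "\<And>z. z \<in> A \<Longrightarrow> Im (g z) > 0"
  shows "(\<lambda>z. dedekind_eta (g z)) holomorphic_on A"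
proof -
  have "(\<lambda>z. qpoch 1 (qexp (g z))) holomorphic_on A"
    using holomorphic_on_compose_gen[OF holomorphic_qexp[OF assms(1)] holomorphic_qpoch_right[of 1]]
      norm_qexp_less_1[OF assms(2)] by (auto simp: o_def image_subset_iff)
  then show ?thesis unfolding eta_eq by (intro holomorphic_intros assms) auto
qed

lemma csqrt_power_6: "csqrt z ^ 6 = z ^ 3"
  using power_mult[of "csqrt z" 2 3] by simp

text \<open>By the sixth-power formula the quotient of both sides takes values in the sixth roots of
  unity. It is continuous on a connected set, hence constant.\<close>

lemma eta_inversion:
  assumes \<tau>: "Im \<tau> > 0"
  shows "dedekind_eta (- 1 / \<tau>) = csqrt (- \<i> * \<tau>) * dedekind_eta \<tau>"
proof -
  define H where "H = {\<tau>. Im \<tau> > 0}"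
  define \<rho> where "\<rho> = (\<lambda>\<tau>. dedekind_eta (- 1 / \<tau>) / (csqrt (- \<i> * \<tau>) * dedekind_eta \<tau>))"
  have nr: "- \<i> * z \<notin> \<real>\<^sub>\<le>\<^sub>0" if "z \<in> H" for z
    using that by (auto simp: H_def complex_nonpos_Reals_iff)
  have nz: "csqrt (- \<i> * z) * dedekind_eta z \<noteq> 0" if "z \<in> H" for z
    using that eta_nonzero by (auto simp: H_def)
  have "\<rho> holomorphic_on H"
    unfolding \<rho>_def using nr nz Im_minus_inverse_pos
    by (intro holomorphic_intros holomorphic_eta) (auto simp: H_def)
  then have "continuous_on H \<rho>" by (rule holomorphic_on_imp_continuous_on)
  moreover have "connected H"
    unfolding H_def by (intro convex_connected convex_upper_half_plane)
  moreover have "finite (\<rho> ` H)"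
  proof (rule finite_subset)
    show "\<rho> ` H \<subseteq> {z. z ^ 6 = 1}"
    proof safe
      fix z assume z: "z \<in> H"
      have "\<i> ^ 3 = - \<i>" by (simp add: power3_eq_cube)
      then have "(csqrt (- \<i> * z) * dedekind_eta z) ^ 6 = \<i> * z ^ 3 * dedekind_eta z ^ 6"
        by (simp only: power_mult_distrib csqrt_power_6 power_minus_odd odd_numeral) simp
      then have "\<rho> z ^ 6 = (csqrt (- \<i> * z) * dedekind_eta z) ^ 6 / (csqrt (- \<i> * z) * dedekind_eta z) ^ 6"
        using eta_inversion_6[of z] z by (simp add: \<rho>_def power_divide H_def)
      then show "\<rho> z ^ 6 = 1" using nz[OF z] by (simp del: mult_eq_0_iff)
    qed
    show "finite {z :: complex. z ^ 6 = 1}"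
      by (rule finite_roots_unity) auto
  qed
  ultimately obtain c where c: "\<And>z. z \<in> H \<Longrightarrow> \<rho> z = c"
    using continuous_finite_range_constant unfolding constant_on_def by blast
  \<comment> \<open>The point i is fixed by -1/\<tau>, and the principal root of -i * i = 1 is
    1.\<close>
  have "\<rho> \<i> = 1" using nz[of \<i>] by (simp add: \<rho>_def H_def)
  then have "\<rho> \<tau> = 1" using c[of \<tau>] c[of \<i>] \<tau> by (auto simp: H_def)
  then show ?thesis using nz[of \<tau>] \<tau> by (simp add: \<rho>_def H_def)
qed

section \<open>The multiplier of eta on SL2(Z)\<close>

definition zeta24 :: complex where "zeta24 = qexp (1 / 24)"

lemma zeta24_nonzero [simp]: "zeta24 \<noteq> 0"
  by (simp add: zeta24_def)

lemma zeta24_powi: "zeta24 powi k = qexp (of_int k / 24)"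
  unfolding zeta24_def qexp_of_int_mult[symmetric] by simp

lemma zeta24_powi_eq_1: "24 dvd k \<Longrightarrow> zeta24 powi k = 1"
  by (auto simp: zeta24_powi dvd_def)

lemma norm_zeta24_powi [simp]: "norm (zeta24 powi k) = 1"
  by (simp add: zeta24_powi norm_qexp)

lemma eta_plus_of_int: "dedekind_eta (\<tau> + of_int n) = zeta24 powi n * dedekind_eta \<tau>"
  by (simp add: eta_eq zeta24_powi qexp_add add_divide_distrib)

text \<open>The exponent of the multiplier of \<open>\<eta>\<close> (Rademacher's function), by the Euclidean
  algorithm on the first column.\<close>

function eta_mult :: "int \<Rightarrow> int \<Rightarrow> int \<Rightarrow> int \<Rightarrow> int" where
  "eta_mult a b c d =
     (if c \<le> 0 then 0
      else a div c + (if a mod c = 0 then d else 3 + eta_mult (- c) (- d) (a mod c) (b - a div c * d)))"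
  by auto
termination
  by (relation "Wellfounded.measure (\<lambda>(a, b, c, d). nat c)") auto

declare eta_mult.simps [simp del]

lemma coprime_of_det:
  fixes a b c d :: int
  assumes "a * d - b * c = 1"
  shows "coprime a c" "coprime c d"
proof -
  show "coprime a c" by (rule coprimeI) (metis assms dvd_diff dvd_mult dvd_mult2)
  show "coprime c d" by (rule coprimeI) (metis assms dvd_diff dvd_mult)
qed

definition mob :: "int \<Rightarrow> int \<Rightarrow> int \<Rightarrow> int \<Rightarrow> complex \<Rightarrow> complex" where
  "mob a b c d \<tau> = (of_int a * \<tau> + of_int b) / (of_int c * \<tau> + of_int d)"

lemma mob_denominator_nonzero:
  assumes "Im \<tau> > 0" "c \<noteq> 0 \<or> d \<noteq> 0"
  shows "of_int c * \<tau> + of_int d \<noteq> 0"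
proof
  assume *: "of_int c * \<tau> + of_int d = 0"
  then have "Im (of_int c * \<tau> + of_int d) = 0" by simp
  then have "c = 0" using assms by simp
  then show False using * assms by simp
qed

lemma Im_mob:
  assumes "Im \<tau> > 0" "c \<noteq> 0 \<or> d \<noteq> 0"
  shows "Im (mob a b c d \<tau>) = of_int (a * d - b * c) * Im \<tau> / (norm (of_int c * \<tau> + of_int d))\<^sup>2"
  unfolding mob_def Im_divide cmod_power2 by (simp add: algebra_simps)

lemma Im_mob_pos:
  assumes "Im \<tau> > 0" "a * d - b * c > 0"
  shows "Im (mob a b c d \<tau>) > 0"
proof -
  have cd: "c \<noteq> 0 \<or> d \<noteq> 0" using assms by auto
  have "0 < real_of_int (a * d - b * c)" using assms(2) by linarith
  then show ?thesis
    using mob_denominator_nonzero[OF assms(1) cd] assms unfolding Im_mob[OF assms(1) cd]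
    by (intro divide_pos_pos mult_pos_pos) auto
qed

lemma mob_mob:
  assumes "of_int c' * \<tau> + of_int d' \<noteq> (0 :: complex)"
  shows "mob a b c d (mob a' b' c' d' \<tau>) =
    mob (a * a' + b * c') (a * b' + b * d') (c * a' + d * c') (c * b' + d * d') \<tau>"
  using assms unfolding mob_def
  by (simp add: add_divide_distrib[symmetric] divide_simps) (simp add: algebra_simps)

lemma mob_uminus: "mob (- a) (- b) (- c) (- d) \<tau> = mob a b c d \<tau>"
proof -
  have "of_int (- a) * \<tau> + of_int (- b) = - (of_int a * \<tau> + of_int b)" for a b by simp
  then show ?thesis unfolding mob_def by (simp only: minus_divide_divide)
qed

lemma Arg_Re_pos: "Re z > 0 \<Longrightarrow> \<bar>Arg z\<bar> < pi / 2"
  using Re_Ln_pos_lt_imp[of z] by (cases "z = 0") (auto simp: Arg_eq_Im_Ln)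

lemma csqrt_mult_Re_pos:
  assumes "Re z > 0" "Re w > 0"
  shows "csqrt (z * w) = csqrt z * csqrt w"
  using Arg_Re_pos[OF assms(1)] Arg_Re_pos[OF assms(2)] by (intro csqrt_mult) (auto simp: abs_if split: if_splits)

lemma csqrt_ii: "csqrt \<i> = zeta24 powi 3"
proof (rule csqrt_unique)
  have 8: "zeta24 powi 3 = cis (pi / 4)"
    unfolding zeta24_powi qexp_def cis_conv_exp by (simp add: mult_ac)
  show "(zeta24 powi 3)\<^sup>2 = \<i>"
    unfolding 8 power2_eq_square cis_mult by (simp add: cis.ctr complex_eq_iff)
  show "0 < Re (zeta24 powi 3) \<or> Re (zeta24 powi 3) = 0 \<and> 0 \<le> Im (zeta24 powi 3)"
    unfolding 8 by (simp add: cos_45)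
qed

text \<open>This is the origin of the summand 3 in \<open>eta_mult\<close>: each inversion of the
  Euclidean algorithm contributes the principal root of i, the third power of \<open>zeta24\<close>.
  No branch is crossed, since -i times a point of the upper half-plane has argument strictly between
  -pi/2 and pi/2.\<close>

lemma csqrt_quotient:
  assumes "Im z > 0" "Im w > 0" "Im (- w / z) > 0"
  shows "csqrt (- \<i> * (- w / z)) * csqrt (- \<i> * z) = zeta24 powi 3 * csqrt (- \<i> * w)"
proof -
  have Re: "Re (- \<i> * u) = Im u" for u by simp
  have "csqrt (- \<i> * (- w / z)) * csqrt (- \<i> * z) = csqrt (- \<i> * (- w / z) * (- \<i> * z))"
    by (rule csqrt_mult_Re_pos[symmetric]) (simp_all only: Re assms)
  also have "- \<i> * (- w / z) * (- \<i> * z) = \<i> * (- \<i> * w)"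
    using assms(1) by (auto simp: field_simps)
  also have "csqrt (\<i> * (- \<i> * w)) = csqrt \<i> * csqrt (- \<i> * w)"
  proof (rule csqrt_mult)
    have "\<bar>Arg (- \<i> * w)\<bar> < pi / 2" using assms(2) by (intro Arg_Re_pos) auto
    then show "Arg \<i> + Arg (- \<i> * w) \<in> {- pi<..pi}" by (auto simp: abs_if split: if_splits)
  qed
  finally show ?thesis by (simp only: csqrt_ii)
qed

text \<open>Follow the recursion of \<open>eta_mult\<close>. The translation by a div c contributes
  that power of \<open>zeta24\<close>. If the remainder is 0, the determinant forces c = 1 and one
  inversion finishes; otherwise one inversion leads to a matrix whose lower left entry is the
  remainder, which lies strictly between 0 and c.\<close>

theorem eta_transformation:
  assumes "Im \<tau> > 0" "c > 0" "a * d - b * c = 1"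
  shows "dedekind_eta (mob a b c d \<tau>) =
    zeta24 powi (eta_mult a b c d) * csqrt (- \<i> * (of_int c * \<tau> + of_int d)) * dedekind_eta \<tau>"
  using assms(2,3)
proof (induction a b c d rule: eta_mult.induct)
  case (1 a b c d)
  define q a' b' where "q = a div c" and "a' = a mod c" and "b' = b - q * d"
  have a: "a = q * c + a'" by (simp add: q_def a'_def)
  have det: "a' * d - b' * c = 1" using 1(3) by (simp add: a b'_def algebra_simps)
  have cd0: "of_int c * \<tau> + of_int d \<noteq> (0::complex)"
    using mob_denominator_nonzero[OF assms(1)] 1(2) by auto
  have "mob a b c d \<tau> = mob a' b' c d \<tau> + of_int q"
    using cd0 unfolding mob_def by (simp add: a b'_def divide_simps) (simp add: algebra_simps)
  then have shift: "dedekind_eta (mob a b c d \<tau>) = zeta24 powi q * dedekind_eta (mob a' b' c d \<tau>)"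
    by (simp add: eta_plus_of_int)
  have Im_cd: "Im (of_int c * \<tau> + of_int d) > 0" using 1(2) assms(1) by simp
  show ?case
  proof (cases "a' = 0")
    case True
    then have "(- b') * c = 1" using det by simp
    then have c: "c = 1" "b' = -1" using 1(2) pos_zmult_eq_1_iff[of c "-b'"] by (auto simp: mult.commute)
    have "mob a' b' c d \<tau> = - 1 / (\<tau> + of_int d)" by (simp add: mob_def True c)
    then have "dedekind_eta (mob a' b' c d \<tau>) = csqrt (- \<i> * (\<tau> + of_int d)) * (zeta24 powi d * dedekind_eta \<tau>)"
      using eta_inversion[of "\<tau> + of_int d"] assms(1) eta_plus_of_int[of \<tau> d] by simp
    moreover have "eta_mult a b c d = q + d"
      using True 1(2) by (subst eta_mult.simps) (simp add: q_def a'_def)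
    ultimately show ?thesis unfolding shift by (simp add: c(1) power_int_add)
  next
    case False
    then have a': "a' > 0" using 1(2) by (simp add: a'_def order_less_le)
    define k where "k = eta_mult (- c) (- d) a' b'"
    define w where "w = mob (- c) (- d) a' b' \<tau>"
    have IH: "dedekind_eta w = zeta24 powi k * csqrt (- \<i> * (of_int a' * \<tau> + of_int b')) * dedekind_eta \<tau>"
      unfolding w_def k_def a'_def b'_def q_def
      by (rule 1(1)) (use 1(2) False a' det in \<open>auto simp: a'_def b'_def q_def algebra_simps\<close>)
    have ab0: "of_int a' * \<tau> + of_int b' \<noteq> (0::complex)"
      using mob_denominator_nonzero[OF assms(1)] a' by auto
    have w: "Im w > 0" unfolding w_def using det by (intro Im_mob_pos assms) (simp add: algebra_simps)
    have w': "w = - (of_int c * \<tau> + of_int d) / (of_int a' * \<tau> + of_int b')"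
      by (simp add: w_def mob_def minus_divide_left[symmetric])
    have "- 1 / (- Y / X) = X / Y" for X Y :: complex by simp
    then have "mob a' b' c d \<tau> = - 1 / w" by (simp only: w' mob_def)
    then have "dedekind_eta (mob a' b' c d \<tau>) = csqrt (- \<i> * w) * dedekind_eta w"
      using eta_inversion[OF w] by simp
    also have "\<dots> = zeta24 powi k * (csqrt (- \<i> * w) * csqrt (- \<i> * (of_int a' * \<tau> + of_int b'))) * dedekind_eta \<tau>"
      by (simp add: IH)
    also have "csqrt (- \<i> * w) * csqrt (- \<i> * (of_int a' * \<tau> + of_int b')) =
        zeta24 powi 3 * csqrt (- \<i> * (of_int c * \<tau> + of_int d))"
      unfolding w' by (rule csqrt_quotient) (use w w' Im_cd a' assms(1) in auto)
    finally have "dedekind_eta (mob a b c d \<tau>) =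
        zeta24 powi (q + (3 + k)) * csqrt (- \<i> * (of_int c * \<tau> + of_int d)) * dedekind_eta \<tau>"
      unfolding shift
      by (simp only: power_int_add zeta24_nonzero simp_thms not_False_eq_True) (simp only: mult_ac)
    moreover have "eta_mult a b c d = q + (3 + k)"
      using False 1(2) by (subst eta_mult.simps) (simp add: q_def a'_def k_def b'_def)
    ultimately show ?thesis by simp
  qed
qed

text \<open>Absolute values remove the root of unity and the choice of the square root, so all signs
  of \<open>c\<close> can be treated; this is all that the asymptotics at the cusps require.\<close>

lemma norm_eta_mob:
  assumes "Im \<tau> > 0" "a * d - b * c = 1"
  shows "norm (dedekind_eta (mob a b c d \<tau>)) =
    sqrt (norm (of_int c * \<tau> + of_int d)) * norm (dedekind_eta \<tau>)"
proof -
  have pos: "norm (dedekind_eta (mob a b c d \<tau>)) =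
      sqrt (norm (of_int c * \<tau> + of_int d)) * norm (dedekind_eta \<tau>)"
    if "c > 0" "a * d - b * c = 1" for a b c d
    using that by (simp add: eta_transformation[OF assms(1)] norm_mult norm_csqrt)
  consider "c > 0" | "c < 0" | "c = 0" by linarith
  then show ?thesis
  proof cases
    case 1
    then show ?thesis using pos assms by blast
  next
    case 2
    have "norm (of_int (- c) * \<tau> + of_int (- d)) = norm (of_int c * \<tau> + of_int d)"
      using norm_minus_cancel[of "of_int c * \<tau> + of_int d"] by simp
    then show ?thesis using pos[of "-c" "-a" "-d" "-b"] 2 assms mob_uminus[of a b c d] by simp
  next
    case 3
    then have "a = 1 \<and> d = 1 \<or> a = -1 \<and> d = -1" using assms(2) zmult_eq_1_iff[of a d] by auto
    then show ?thesis
      using eta_plus_of_int[of \<tau> b] eta_plus_of_int[of \<tau> "- b"] 3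
      by (auto simp: mob_def norm_mult)
  qed
qed

section \<open>Eta quotients\<close>

text \<open>A list with integer keys, in place of a finitely supported function, so that the
  conditions imposed on it can be evaluated. The exponents used later are those of the inverse of
  the eta product of the Frame shape.\<close>

definition eta_quot :: "(int \<times> int) list \<Rightarrow> complex \<Rightarrow> complex" where
  "eta_quot rs \<tau> = (\<Prod>(n, r)\<leftarrow>rs. dedekind_eta (of_int n * \<tau>) powi r)"

lemma eta_quot_Nil [simp]: "eta_quot [] \<tau> = 1"
  by (simp add: eta_quot_def)

lemma eta_quot_Cons [simp]:
  "eta_quot ((n, r) # rs) \<tau> = dedekind_eta (of_int n * \<tau>) powi r * eta_quot rs \<tau>"
  by (simp add: eta_quot_def)

lemma eta_quot_nonzero:
  assumes "Im \<tau> > 0" "\<forall>(n, r)\<in>set rs. n > 0"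
  shows "eta_quot rs \<tau> \<noteq> 0"
  using assms(2)
proof (induction rs)
  case (Cons p rs)
  obtain n r where p: "p = (n, r)" by fastforce
  have "Im (of_int n * \<tau>) > 0" using Cons.prems assms(1) by (simp add: p)
  then show ?case using Cons eta_nonzero by (auto simp: p)
qed auto

lemma holomorphic_eta_quot:
  assumes "g holomorphic_on A" "\<And>z. z \<in> A \<Longrightarrow> Im (g z) > 0" "\<forall>(n, r)\<in>set rs. n > 0"
  shows "(\<lambda>z. eta_quot rs (g z)) holomorphic_on A"
  using assms(3)
proof (induction rs)
  case (Cons p rs)
  obtain n r where p: "p = (n, r)" by fastforce
  have "Im (of_int n * g z) > 0" if "z \<in> A" for z using Cons.prems assms(2)[OF that] by (simp add: p)
  then show ?case using Cons eta_nonzero assms(1)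
    by (auto simp: p intro!: holomorphic_intros holomorphic_eta)
qed auto

lemma eta_quot_plus_of_int:
  assumes "24 dvd (\<Sum>(n, r)\<leftarrow>rs. n * r)"
  shows "eta_quot rs (\<tau> + of_int k) = eta_quot rs \<tau>"
proof -
  have "eta_quot rs (\<tau> + of_int k) = zeta24 powi ((\<Sum>(n, r)\<leftarrow>rs. n * r) * k) * eta_quot rs \<tau>"
  proof (induction rs)
    case (Cons p rs)
    obtain n r where p: "p = (n, r)" by fastforce
    have "dedekind_eta (of_int n * (\<tau> + of_int k)) = zeta24 powi (n * k) * dedekind_eta (of_int n * \<tau>)"
      using eta_plus_of_int[of "of_int n * \<tau>" "n * k"] by (simp add: algebra_simps)
    then show ?case using Cons.IH
      by (simp add: p power_int_mult_distrib power_int_mult[symmetric] ring_distribs power_int_add mult_ac)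
  qed auto
  then show ?thesis using assms zeta24_powi_eq_1[of "(\<Sum>(n, r)\<leftarrow>rs. n * r) * k"] by simp
qed

text \<open>\<open>al_ok e rs (A, B, C, D)\<close> makes \<open>eta_quot rs\<close> invariant under the matrix of determinant \<open>e\<close>:
  the matrix maps \<open>\<tau>\<close> to \<open>\<tau>'\<close> with \<open>n\<tau>' = W(m\<tau>)\<close>, where \<open>m = n * e\<close> in the group of exact
  divisors and \<open>W\<close> is an integral matrix of determinant \<open>1\<close>.\<close>

definition al_target :: "int \<Rightarrow> int \<Rightarrow> int" where
  "al_target e n = n * e div (gcd n e * gcd n e)"

text \<open>The four arguments are the entries of \<open>W\<close>: divide
  \<open>(nA, nB; C, D)\<close> by g = gcd(n, e), then divide the first column by \<open>m\<close>,
  because \<open>W\<close> acts on m\<tau> and not on \<tau>.\<close>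

definition al_mult :: "int \<Rightarrow> int \<times> int \<times> int \<times> int \<Rightarrow> int \<Rightarrow> int" where
  "al_mult e M n = (case M of (A, B, C, D) \<Rightarrow> let g = gcd n e; m = al_target e n in
     eta_mult (n * A div (g * m)) (n * B div g) (C div (g * m)) (D div g))"

definition al_ok :: "int \<Rightarrow> (int \<times> int) list \<Rightarrow> int \<times> int \<times> int \<times> int \<Rightarrow> bool" where
  "al_ok e rs M = (case M of (A, B, C, D) \<Rightarrow>
     e > 0 \<and> C > 0 \<and> A * D - B * C = e \<and> (\<Sum>(n, r)\<leftarrow>rs. r) = 0 \<and>
     (\<forall>(n, r)\<in>set rs. let g = gcd n e; m = al_target e n in
        n > 0 \<and> g * g * m = n * e \<and> (n * A) mod (g * m) = 0 \<and> (n * B) mod g = 0 \<and> C mod (g * m) = 0 \<and> D mod g = 0) \<and>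
     (\<Prod>(n, r)\<leftarrow>rs. gcd n e ^ nat r) = (\<Prod>(n, r)\<leftarrow>rs. gcd n e ^ nat (- r)) \<and>
     distinct rs \<and> distinct (map (\<lambda>(n, r). (al_target e n, r)) rs) \<and>
     set (map (\<lambda>(n, r). (al_target e n, r)) rs) = set rs \<and>
     (\<Sum>(n, r)\<leftarrow>rs. r * al_mult e M n) mod 24 = 0)"

lemma csqrt_divide_of_int:
  assumes "g > 0"
  shows "csqrt (z / of_int g) = csqrt z / of_real (sqrt (of_int g))"
proof -
  have "csqrt (z / of_int g) = csqrt (of_real (inverse (of_int g)) * z)"
    by (simp add: field_simps)
  also have "\<dots> = csqrt (of_real (inverse (of_int g))) * csqrt z"
  proof (rule csqrt_mult)
    have "Arg (of_real (inverse (of_int g))) = 0" using assms by (subst Arg_of_real) auto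
    then show "Arg (of_real (inverse (of_int g))) + Arg z \<in> {- pi<..pi}"
      using Arg_bounded[of z] by simp
  qed
  also have "csqrt (of_real (inverse (of_int g))) = of_real (inverse (sqrt (of_int g)))"
    using assms by (simp add: real_sqrt_inverse of_real_sqrt[symmetric] del: of_real_inverse)
  finally show ?thesis by (simp add: field_simps)
qed

text \<open>The automorphy factor of \<open>W\<close> at m\<tau> is (C\<tau> + D)/g. Writing it in
  this form isolates a square root that does not depend on \<open>n\<close>, so that it can cancel
  in a product of weight 0; the price is the factor sqrt(g).\<close>

lemma eta_al_transformation:
  fixes n e A B C D :: int
  defines "g \<equiv> gcd n e" and "m \<equiv> al_target e n"
  assumes \<tau>: "Im \<tau> > 0" and pos: "n > 0" "e > 0" "C > 0" and det: "A * D - B * C = e"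
    and m: "g * g * m = n * e"
    and dv: "(g * m) dvd (n * A)" "g dvd (n * B)" "(g * m) dvd C" "g dvd D"
  shows "dedekind_eta (of_int n * mob A B C D \<tau>) =
    zeta24 powi (al_mult e (A, B, C, D) n) *
      (csqrt (- \<i> * (of_int C * \<tau> + of_int D)) / of_real (sqrt (of_int g))) * dedekind_eta (of_int m * \<tau>)"
proof -
  have g: "g > 0" using pos by (simp add: g_def)
  have m0: "m > 0"
  proof -
    have "g * g * m > 0" unfolding m using pos by simp
    then show ?thesis using g by (simp add: zero_less_mult_iff)
  qed
  obtain a b c d where abcd: "n * A = g * m * a" "n * B = g * b" "C = g * m * c" "D = g * d"
    using dv by (auto simp: dvd_def)
  have "g * m > 0" using g m0 by simp
  then have c: "c > 0" using pos(3) zero_less_mult_pos[of "g * m" c] by (simp only: abcd)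
  have "(g * g * m) * (a * d - b * c) = n * A * D - n * B * C"
    unfolding abcd by (simp add: abcd(3,4) algebra_simps)
  also have "\<dots> = g * g * m" unfolding m det[symmetric] by (simp add: algebra_simps)
  finally have det1: "a * d - b * c = 1" using g m0 by simp
  have k: "al_mult e (A, B, C, D) n = eta_mult a b c d"
    using g m0 by (simp add: al_mult_def Let_def g_def[symmetric] m_def[symmetric] abcd)
  have CD: "of_int C * \<tau> + of_int D = of_int g * (of_int c * (of_int m * \<tau>) + of_int d)"
    by (simp add: abcd algebra_simps)
  have "of_int n * mob A B C D \<tau> = (of_int (n * A) * \<tau> + of_int (n * B)) / (of_int C * \<tau> + of_int D)"
    by (simp add: mob_def algebra_simps)
  also have "of_int (n * A) * \<tau> + of_int (n * B) = of_int g * (of_int a * (of_int m * \<tau>) + of_int b)"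
    unfolding abcd(1,2) of_int_mult by (simp only: algebra_simps)
  finally have "of_int n * mob A B C D \<tau> = mob a b c d (of_int m * \<tau>)"
    unfolding CD mob_def using g by simp
  moreover have "- \<i> * (of_int c * (of_int m * \<tau>) + of_int d) = (- \<i> * (of_int C * \<tau> + of_int D)) / of_int g"
    unfolding CD using g by simp
  ultimately show ?thesis
    using eta_transformation[of "of_int m * \<tau>" c a d b] \<tau> m0 c det1
    by (simp only: k csqrt_divide_of_int[OF g]) simp
qed

text \<open>Four things must disappear from the product of the single transformations: the root of
  unity (exponent divisible by 24), the common square root (exponents of sum 0), the factors
  sqrt(gcd(n, e)), and the change of n into m, which only permutes the factors together with their
  exponents.\<close>

lemma eta_quot_al_invariant:
  assumes ok: "al_ok e rs (A, B, C, D)" and \<tau>: "Im \<tau> > 0"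
  shows "eta_quot rs (mob A B C D \<tau>) = eta_quot rs \<tau>"
proof -
  define w where "w = csqrt (- \<i> * (of_int C * \<tau> + of_int D))"
  have C: "C > 0" using ok by (simp add: al_ok_def)
  have w0: "w \<noteq> 0" using mob_denominator_nonzero[OF \<tau>, of C D] C by (auto simp: w_def)
  define s where "s = (\<lambda>n. sqrt (of_int (gcd n e)) :: real)"
  define K where "K rs' = (\<Sum>(n, r)\<leftarrow>rs'. r * al_mult e (A, B, C, D) n)" for rs'
  define P where "P rs' = (\<Prod>(n, r)\<leftarrow>rs'. s n powi r)" for rs' :: "(int \<times> int) list"
  define R where "R rs' = (\<Sum>(n, r)\<leftarrow>rs'. r)" for rs' :: "(int \<times> int) list"
  have e: "e > 0" using ok by (simp add: al_ok_def)
  have s: "s n > 0" for n using e by (simp add: s_def)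
  have step: "eta_quot rs' (mob A B C D \<tau>) =
      zeta24 powi K rs' * w powi R rs' / of_real (P rs') * eta_quot (map (\<lambda>(n, r). (al_target e n, r)) rs') \<tau>"
    if "set rs' \<subseteq> set rs" for rs'
    using that
  proof (induction rs')
    case (Cons p rs')
    obtain n r where p: "p = (n, r)" by fastforce
    have "(n, r) \<in> set rs" using Cons.prems by (simp add: p)
    then have "dedekind_eta (of_int n * mob A B C D \<tau>) =
      zeta24 powi (al_mult e (A, B, C, D) n) * (w / of_real (s n)) * dedekind_eta (of_int (al_target e n) * \<tau>)"
      using ok unfolding al_ok_def w_def s_def
      by (intro eta_al_transformation[OF \<tau>]) (auto simp: Let_def mod_eq_0_iff_dvd)
    moreover have "eta_quot rs' (mob A B C D \<tau>) =
      zeta24 powi K rs' * w powi R rs' / of_real (P rs') * eta_quot (map (\<lambda>(n, r). (al_target e n, r)) rs') \<tau>"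
      using Cons by simp
    ultimately show ?case using w0
      by (simp add: p K_def R_def P_def power_int_mult_distrib power_int_divide_distrib power_int_add
          power_int_mult[symmetric] mult_ac)
  qed (auto simp: K_def P_def R_def)
  have R: "R rs = 0" and K: "24 dvd K rs"
    using ok by (simp_all add: al_ok_def R_def K_def mod_eq_0_iff_dvd)
  \<comment> \<open>The condition in \<open>al_ok\<close> is an identity of integers: negative
    powers stand on the other side and the square roots are gone. It yields that the square of
    \<open>P rs\<close> is 1, and positivity gives the rest.\<close>
  have "P rs = 1"
  proof -
    have pos: "P rs' > 0" for rs' using s by (induction rs') (auto simp: P_def)
    have "(P rs')\<^sup>2 * of_int (\<Prod>(n, r)\<leftarrow>rs'. gcd n e ^ nat (- r)) = of_int (\<Prod>(n, r)\<leftarrow>rs'. gcd n e ^ nat r)" for rs'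
    proof (induction rs')
      case (Cons p rs')
      obtain n r where p: "p = (n, r)" by fastforce
      have "(s n)\<^sup>2 = of_int (gcd n e)" by (simp add: s_def)
      then have "(s n powi r)\<^sup>2 = of_int (gcd n e) powi r"
        by (simp add: power2_eq_square flip: power_int_mult_distrib)
      moreover have "of_int (gcd n e) powi r * (of_int (gcd n e) ^ nat (- r) :: real) = of_int (gcd n e) ^ nat r"
        using e by (cases "r \<ge> 0") (auto simp: power_int_def field_simps)
      ultimately have "(s n powi r)\<^sup>2 * of_int (gcd n e) ^ nat (- r) = of_int (gcd n e) ^ nat r" by simp
      then have "((s n powi r)\<^sup>2 * of_int (gcd n e) ^ nat (- r)) * ((P rs')\<^sup>2 * of_int (\<Prod>(n, r)\<leftarrow>rs'. gcd n e ^ nat (- r)))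
        = of_int (gcd n e) ^ nat r * of_int (\<Prod>(n, r)\<leftarrow>rs'. gcd n e ^ nat r)"
        using Cons by simp
      then show ?case by (simp add: p P_def power_mult_distrib mult_ac)
    qed (auto simp: P_def)
    moreover define X where "X = (\<Prod>(n, r)\<leftarrow>rs. gcd n e ^ nat (- r))"
    moreover have "(\<Prod>(n, r)\<leftarrow>rs. gcd n e ^ nat r) = X"
      using ok by (simp add: al_ok_def X_def)
    ultimately have "(P rs)\<^sup>2 * of_int X = of_int X" by metis
    moreover have "(\<Prod>(n, r)\<leftarrow>rs'. gcd n e ^ nat (- r)) > 0" for rs' :: "(int \<times> int) list"
      using e by (induction rs') auto
    then have "X \<noteq> 0" unfolding X_def by (metis less_irrefl)
    ultimately have "(P rs)\<^sup>2 = 1" by simp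
    then show ?thesis using pos[of rs] by (simp add: power2_eq_1_iff)
  qed
  moreover have "eta_quot (map (\<lambda>(n, r). (al_target e n, r)) rs) \<tau> = eta_quot rs \<tau>"
  proof -
    have "mset (map (\<lambda>(n, r). (al_target e n, r)) rs) = mset rs"
      using ok by (intro set_eq_iff_mset_eq_distinct[THEN iffD1]) (auto simp: al_ok_def)
    then have "prod_mset (image_mset (\<lambda>(n, r). dedekind_eta (of_int n * \<tau>) powi r) (mset (map (\<lambda>(n, r). (al_target e n, r)) rs)))
       = prod_mset (image_mset (\<lambda>(n, r). dedekind_eta (of_int n * \<tau>) powi r) (mset rs))" by simp
    then show ?thesis unfolding eta_quot_def
      by (simp only: prod_mset_prod_list[symmetric] mset_map)
  qed
  ultimately show ?thesis using step[of rs] R K zeta24_powi_eq_1 by simp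
qed

section \<open>Generators of the groups\<close>

text \<open>\<open>ford_chain N p q gs\<close>: the open isometric intervals \<open>((- a - 1) / c, (- a + 1) / c)\<close> of the matrices
  \<open>(a, b; c, d)\<close> in \<open>gs\<close> cover \<open>[p / q, 1)\<close> up to touching points, which must not be equivalent to \<open>\<infinity>\<close>.\<close>

fun ford_chain :: "int \<Rightarrow> int \<Rightarrow> int \<Rightarrow> (int \<times> int \<times> int \<times> int) list \<Rightarrow> bool" where
  "ford_chain N p q [] \<longleftrightarrow> q \<le> p"
| "ford_chain N p q ((a, b, c, d) # gs) \<longleftrightarrow>
     c > 0 \<and> ((- a - 1) * q < p * c \<or> (- a - 1) * q = p * c \<and> (q div gcd p q) mod N \<noteq> 0) \<and>
     ford_chain N (1 - a) c gs"

text \<open>The inequality says that D/C lies in the open isometric interval of one of the matrices.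
  Walk along the chain: D/C is in the current interval or to the right of it. If it were the
  touching point p/q itself, C would divide the reduced denominator of p/q, hence N would, which the
  chain excludes.\<close>

lemma ford_chain_cover:
  assumes "ford_chain N p q gs" "q > 0" "p * C \<le> D * q" "C > 0" "D < C" "N dvd C" "coprime C D"
  shows "\<exists>(a, b, c, d)\<in>set gs. \<bar>C * a + D * c\<bar> < C"
  using assms(1-3)
proof (induction gs arbitrary: p q)
  case Nil
  then have "C * q \<le> p * C" using assms(4) by (simp add: mult.commute)
  also have "\<dots> \<le> D * q" using Nil by simp
  finally have "C \<le> D" using Nil by simp
  then show ?case using assms(5) by simp
next
  case (Cons g gs)
  obtain a b c d where g: "g = (a, b, c, d)" by (metis prod_cases4)
  have c: "c > 0" using Cons.prems by (simp add: g)
  show ?case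
  proof (cases "(1 - a) * C \<le> D * c")
    case True
    then show ?thesis using Cons.IH[of "1 - a" c] Cons.prems c by (auto simp: g)
  next
    case False
    have low: "(- a - 1) * q < p * c \<or> (- a - 1) * q = p * c \<and> (q div gcd p q) mod N \<noteq> 0"
      using Cons.prems by (simp add: g)
    have "(- a - 1) * C < D * c"
    proof (rule ccontr)
      assume *: "\<not> ?thesis"
      have "(p * c) * C = (p * C) * c" by simp
      also have "\<dots> \<le> (D * q) * c" using Cons.prems c by (intro mult_right_mono) auto
      also have "\<dots> = (D * c) * q" by simp
      also have "\<dots> \<le> ((- a - 1) * C) * q" using * Cons.prems by (intro mult_right_mono) auto
      also have "\<dots> = ((- a - 1) * q) * C" by simp
      finally have 1: "(p * c) * C \<le> ((- a - 1) * q) * C" .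
      then have "p * c \<le> (- a - 1) * q" using assms(4) by simp
      then have eq: "(- a - 1) * q = p * c" and nd: "\<not> N dvd (q div gcd p q)"
        using low by (auto simp: mod_eq_0_iff_dvd)
      have "(p * C) * c \<le> (D * q) * c" using Cons.prems c by (intro mult_right_mono) auto
      moreover have "(D * c) * q \<le> ((- a - 1) * C) * q"
        using * Cons.prems by (intro mult_right_mono) auto
      moreover have "(D * c) * q = (D * q) * c" by simp
      moreover have "((- a - 1) * C) * q = ((- a - 1) * q) * C" by simp
      moreover have "\<dots> = (p * C) * c" unfolding eq by simp
      ultimately have "(D * q) * c = (p * C) * c" by linarith
      then have "D * q = p * C" using c by simp
      define h where "h = gcd p q"
      have "gcd p q \<noteq> 0" using Cons.prems by simp
      then obtain p' q' where pq: "p = p' * h" "q = q' * h" "coprime p' q'"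
        unfolding h_def using gcd_coprime_exists by blast
      have h: "h > 0" using Cons.prems by (simp add: h_def)
      have "(D * q') * h = (p' * C) * h" using \<open>D * q = p * C\<close> unfolding pq(1,2) by (simp only: mult_ac)
      then have "D * q' = p' * C" using h by simp
      then have "C dvd D * q'" by simp
      then have "C dvd q'" using assms(7) coprime_dvd_mult_right_iff by blast
      then have "N dvd q'" using assms(6) dvd_trans by blast
      moreover have "q div gcd p q = q'"
        unfolding h_def[symmetric] using h pq(2) nonzero_mult_div_cancel_right[of h q'] by simp
      ultimately show False using nd by simp
    qed
    then have "\<bar>C * a + D * c\<bar> < C" using False by (auto simp: abs_if algebra_simps)
    then show ?thesis by (auto simp: g)
  qed
qed

text \<open>Descent on the lower left entry. Multiplying \<open>(a, b; c, d)\<close> on the right by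
  a generator \<open>(a1, b1; c1, d1)\<close> changes it into c * a1 + d * c1, which is smaller in
  absolute value as soon as d/c lies in the isometric interval of the generator.\<close>

lemma Gamma0_invariant:
  fixes T :: "complex \<Rightarrow> 'a"
  assumes N: "N > 1"
    and shift: "\<And>\<tau> k. Im \<tau> > 0 \<Longrightarrow> T (\<tau> + of_int k) = T \<tau>"
    and gens: "\<And>a b c d. (a, b, c, d) \<in> set gs \<Longrightarrow> N dvd c \<and> a * d - b * c = 1 \<and> (\<forall>\<tau>. Im \<tau> > 0 \<longrightarrow> T (mob a b c d \<tau>) = T \<tau>)"
    and chain: "ford_chain N 0 1 gs"
    and "a * d - b * c = 1" "N dvd c" "Im \<tau> > 0"
  shows "T (mob a b c d \<tau>) = T \<tau>"
  using assms(5-)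
proof (induction "nat \<bar>c\<bar>" arbitrary: a b c d \<tau> rule: less_induct)
  case less
  have pos: "T (mob a b c d \<tau>) = T \<tau>" if c: "c > 0" and det: "a * d - b * c = 1" and Nc: "N dvd c"
    and Im: "Im \<tau> > 0"
    and IH: "\<And>a' b' c' d' \<tau>. \<bar>c'\<bar> < \<bar>c\<bar> \<Longrightarrow> a' * d' - b' * c' = 1 \<Longrightarrow> N dvd c' \<Longrightarrow> Im \<tau> > 0 \<Longrightarrow> T (mob a' b' c' d' \<tau>) = T \<tau>"
    for a b c d \<tau>
  proof -
    \<comment> \<open>A translation brings d/c into [0, 1), the part of the line covered by the
      chain.\<close>
    define j D B where "j = d div c" and "D = d mod c" and "B = b - a * j"
    have D: "0 \<le> D" "D < c" "d = c * j + D" using c by (auto simp: D_def j_def)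
    have det': "a * D - B * c = 1" using det by (simp add: D(3) B_def algebra_simps)
    have "coprime c D" by (rule coprime_of_det[OF det'])
    then obtain a1 b1 c1 d1 where g: "(a1, b1, c1, d1) \<in> set gs" and lt: "\<bar>c * a1 + D * c1\<bar> < c"
      using ford_chain_cover[OF chain, of c D] c D Nc by fastforce
    have g': "N dvd c1" "a1 * d1 - b1 * c1 = 1" "\<And>\<tau>. Im \<tau> > 0 \<Longrightarrow> T (mob a1 b1 c1 d1 \<tau>) = T \<tau>"
      using gens[OF g] by auto
    define \<tau>1 where "\<tau>1 = \<tau> + of_int j"
    define \<tau>2 where "\<tau>2 = mob d1 (- b1) (- c1) a1 \<tau>1"
    have Im1: "Im \<tau>1 > 0" using Im by (simp add: \<tau>1_def)
    have Im2: "Im \<tau>2 > 0" unfolding \<tau>2_def using Im1 g'(2) by (intro Im_mob_pos) (auto simp: algebra_simps)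
    have "c1 \<noteq> 0 \<or> a1 \<noteq> 0" using g'(2) by auto
    then have nz1: "of_int (- c1) * \<tau>1 + of_int a1 \<noteq> (0::complex)"
      using mob_denominator_nonzero[OF Im1, of "-c1" a1] by auto
    have "mob a1 b1 c1 d1 \<tau>2 = mob 1 0 0 1 \<tau>1"
      unfolding \<tau>2_def mob_mob[OF nz1] using g'(2) by (simp add: algebra_simps)
    then have undo: "mob a1 b1 c1 d1 \<tau>2 = \<tau>1" by (simp add: mob_def)
    have nz2: "of_int c1 * \<tau>2 + of_int d1 \<noteq> (0::complex)"
      using mob_denominator_nonzero[OF Im2, of c1 d1] g'(2) by fastforce
    have "mob a b c d \<tau> = mob a B c D \<tau>1"
      by (simp add: mob_def \<tau>1_def B_def D(3) algebra_simps)
    also have "\<dots> = mob (a * a1 + B * c1) (a * b1 + B * d1) (c * a1 + D * c1) (c * b1 + D * d1) \<tau>2"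
      unfolding undo[symmetric] mob_mob[OF nz2] ..
    also have "T \<dots> = T \<tau>2"
    proof (rule IH)
      have "(a * a1 + B * c1) * (c * b1 + D * d1) - (a * b1 + B * d1) * (c * a1 + D * c1) =
          (a * D - B * c) * (a1 * d1 - b1 * c1)" by (simp add: algebra_simps)
      then show "(a * a1 + B * c1) * (c * b1 + D * d1) - (a * b1 + B * d1) * (c * a1 + D * c1) = 1"
        by (simp add: det' g'(2))
    qed (use lt c Nc g'(1) Im2 in auto)
    also have "T \<tau>2 = T \<tau>1" using g'(3)[OF Im2] by (simp add: undo)
    also have "\<dots> = T \<tau>" unfolding \<tau>1_def by (rule shift[OF Im])
    finally show ?thesis .
  qed
  have IH: "T (mob a' b' c' d' \<tau>') = T \<tau>'"
    if "\<bar>c'\<bar> < \<bar>c\<bar>" "a' * d' - b' * c' = 1" "N dvd c'" "Im \<tau>' > 0" for a' b' c' d' \<tau>'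
    using less.hyps[of c' a' d' b' \<tau>'] that by auto
  consider "c > 0" | "c < 0" | "c = 0" by linarith
  then show ?case
  proof cases
    case 1
    then show ?thesis using pos[of c a d b \<tau>] IH less.prems by blast
  next
    case 2
    then show ?thesis using pos[of "-c" "-a" "-d" "-b" \<tau>] IH less.prems mob_uminus[of a b c d] by simp
  next
    case 3
    then have "a = 1 \<and> d = 1 \<or> a = -1 \<and> d = -1" using less.prems(1) zmult_eq_1_iff[of a d] by auto
    then show ?thesis using shift[OF less.prems(3), of b] shift[OF less.prems(3), of "-b"] 3
      by (auto simp: mob_def)
  qed
qed

section \<open>Asymptotics at i-infinity and at the cusps\<close>

lemma eventually_at_i_infinity:
  "eventually P at_i_infinity \<longleftrightarrow> (\<exists>Y. \<forall>\<tau>. Im \<tau> > Y \<longrightarrow> P \<tau>)"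
proof -
  have "eventually P at_i_infinity \<longleftrightarrow> (\<exists>Y. \<forall>\<tau>. Im \<tau> \<ge> Y \<longrightarrow> P \<tau>)"
    by (simp add: at_i_infinity_def eventually_filtercomap_at_top_linorder)
  also have "\<dots> \<longleftrightarrow> (\<exists>Y. \<forall>\<tau>. Im \<tau> > Y \<longrightarrow> P \<tau>)"
  proof
    assume "\<exists>Y. \<forall>\<tau>. Im \<tau> > Y \<longrightarrow> P \<tau>"
    then obtain Y where "\<forall>\<tau>. Im \<tau> > Y \<longrightarrow> P \<tau>" by blast
    then have "\<forall>\<tau>. Im \<tau> \<ge> Y + 1 \<longrightarrow> P \<tau>" by auto
    then show "\<exists>Y. \<forall>\<tau>. Im \<tau> \<ge> Y \<longrightarrow> P \<tau>" by blast
  qed (meson less_imp_le)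
  finally show ?thesis .
qed

lemma eventually_Im_gt_at_i_infinity: "\<forall>\<^sub>F \<tau> in at_i_infinity. Im \<tau> > Y"
  by (auto simp: eventually_at_i_infinity)

lemma at_i_infinity_neq_bot [simp]: "at_i_infinity \<noteq> bot"
proof
  assume "at_i_infinity = bot"
  then have "eventually (\<lambda>_. False) at_i_infinity" by simp
  then obtain Y where "\<And>\<tau>. \<not> Im \<tau> > Y" by (auto simp: eventually_at_i_infinity)
  from this[of "\<i> * of_real (Y + 1)"] show False by simp
qed

lemma filterlim_Im_affine:
  assumes "\<alpha> > 0"
  shows "filterlim (\<lambda>\<tau>. of_real \<alpha> * \<tau> + of_real \<beta>) at_i_infinity at_i_infinity"
  unfolding filterlim_def le_filter_def eventually_filtermap
proof safe
  fix P assume "eventually P at_i_infinity"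
  then obtain Y where Y: "\<And>\<tau>. Im \<tau> > Y \<Longrightarrow> P \<tau>" by (auto simp: eventually_at_i_infinity)
  have "P (of_real \<alpha> * \<tau> + of_real \<beta>)" if "Im \<tau> > Y / \<alpha>" for \<tau>
    using that assms by (intro Y) (simp add: field_simps)
  then show "\<forall>\<^sub>F \<tau> in at_i_infinity. P (of_real \<alpha> * \<tau> + of_real \<beta>)"
    by (auto simp: eventually_at_i_infinity)
qed

lemma filterlim_Im_at_i_infinity: "filterlim Im at_top at_i_infinity"
  unfolding at_i_infinity_def by (rule filterlim_filtercomap)

lemma tendsto_qexp_0: "((\<lambda>\<tau>. qexp \<tau>) \<longlongrightarrow> 0) at_i_infinity"
proof (rule tendsto_norm_zero_cancel)
  have "filterlim (\<lambda>\<tau>. - (2 * pi * Im \<tau>)) at_bot at_i_infinity"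
    using filterlim_Im_at_i_infinity
    by (subst filterlim_uminus_at_bot) (simp add: filterlim_tendsto_pos_mult_at_top[OF tendsto_const])
  then have "((\<lambda>\<tau>. exp (- (2 * pi * Im \<tau>))) \<longlongrightarrow> 0) at_i_infinity"
    using filterlim_compose[OF exp_at_bot] by blast
  then show "((\<lambda>\<tau>. norm (qexp \<tau>)) \<longlongrightarrow> 0) at_i_infinity"
    by (simp add: norm_qexp)
qed

lemma filterlim_qexp_divide:
  assumes "m > 0"
  shows "filterlim (\<lambda>\<tau>. qexp (\<tau> / of_nat m)) (at 0) at_i_infinity"
proof -
  have "filterlim (\<lambda>\<tau>. of_real (1 / m) * \<tau> + of_real 0) at_i_infinity at_i_infinity"
    using assms by (intro filterlim_Im_affine) simp
  then have "filterlim (\<lambda>\<tau>. \<tau> / of_nat m) at_i_infinity at_i_infinity" by simp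
  then have "((\<lambda>\<tau>. qexp (\<tau> / of_nat m)) \<longlongrightarrow> 0) at_i_infinity"
    using filterlim_compose[OF tendsto_qexp_0] by blast
  then show ?thesis unfolding filterlim_at by simp
qed

lemma tendsto_qpoch_at_i_infinity: "((\<lambda>\<tau>. qpoch 1 (qexp \<tau>)) \<longlongrightarrow> 1) at_i_infinity"
proof -
  have "continuous_on (ball 0 1) (qpoch 1)"
    using holomorphic_qpoch_right[of 1] by (rule holomorphic_on_imp_continuous_on)
  then have "isCont (qpoch 1) 0" by (simp add: continuous_on_eq_continuous_at)
  then show ?thesis using isCont_tendsto_compose[OF _ tendsto_qexp_0] by fastforce
qed

text \<open>\<open>n\<sigma>\<tau> = M((\<alpha>\<tau> + \<beta>)/\<delta>)\<close> with \<open>M\<close> integral of determinant \<open>1\<close> and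
  \<open>\<alpha> = gcd(n, c)\<close>, \<open>\<alpha>\<delta> = n\<close>.\<close>

lemma norm_eta_cusp:
  fixes n a b c d :: int
  assumes det: "a * d - b * c = 1" and n: "n > 0"
  shows "((\<lambda>\<tau>. norm (dedekind_eta (of_int n * mob a b c d \<tau>)) / sqrt (norm (of_int c * \<tau> + of_int d)) *
      exp (pi / 12 * ((gcd n c)\<^sup>2 / n) * Im \<tau>)) \<longlongrightarrow> 1 / sqrt (n / gcd n c)) at_i_infinity"
proof -
  define \<alpha> where "\<alpha> = gcd n c"
  have \<alpha>: "\<alpha> > 0" using n by (simp add: \<alpha>_def)
  obtain \<delta> where \<delta>: "n = \<alpha> * \<delta>" unfolding \<alpha>_def by (meson gcd_dvd1 dvdE)
  obtain c1 where c1: "c = \<alpha> * c1" unfolding \<alpha>_def by (meson gcd_dvd2 dvdE)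
  have \<delta>0: "\<delta> > 0" using n \<alpha> by (simp add: \<delta> zero_less_mult_iff)
  \<comment> \<open>The first column of \<open>M\<close> must be (\<delta>a, c1); coprimality lets
    Bezout complete it to determinant 1.\<close>
  have "coprime (\<delta> * a) c1"
  proof -
    have "gcd n c = \<alpha> * gcd \<delta> c1" using \<alpha> by (subst \<delta>, subst c1) (simp add: gcd_mult_distrib_int[symmetric])
    then have "coprime \<delta> c1" using \<alpha> by (simp add: \<alpha>_def[symmetric] coprime_iff_gcd_eq_1)
    moreover have "coprime a c1" using coprime_of_det(1)[OF det] by (simp add: c1)
    ultimately show ?thesis by simp
  qed
  then obtain b1 d1 where M: "(\<delta> * a) * d1 - b1 * c1 = 1"
    using bezout_int[of "\<delta> * a" c1] by (metis coprime_iff_gcd_eq_1 diff_minus_eq_add mult.commute mult_minus_left)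
  \<comment> \<open>First component of the inverse of \<open>M\<close> applied to (nb, d). The next
    two facts say that \<open>M\<close> maps (\<beta>, \<delta>) to (nb, d), that is, that the
    second columns match.\<close>
  define \<beta> where "\<beta> = d1 * (n * b) - b1 * d"
  have col: "of_int c1 * of_int \<beta> + of_int d1 * of_int \<delta> = (of_int d :: complex)"
  proof -
    have "c1 * \<beta> + d1 * \<delta> = d1 * \<delta> * (c * b + 1) - b1 * c1 * d"
      by (simp add: \<beta>_def \<delta> c1 algebra_simps)
    also have "c * b + 1 = a * d" using det by (simp add: algebra_simps)
    also have "d1 * \<delta> * (a * d) - b1 * c1 * d = ((\<delta> * a) * d1 - b1 * c1) * d" by (simp add: algebra_simps)
    finally show ?thesis using M by (metis mult_1 of_int_add of_int_mult)
  qed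
  have col1: "of_int (\<delta> * a) * of_int \<beta> + of_int b1 * of_int \<delta> = (of_int (n * b) :: complex)"
  proof -
    have "(\<delta> * a) * \<beta> + b1 * \<delta> = (\<delta> * a) * d1 * (n * b) - b1 * \<delta> * (a * d - 1)"
      by (simp add: \<beta>_def algebra_simps)
    also have "a * d - 1 = b * c" using det by simp
    also have "(\<delta> * a) * d1 * (n * b) - b1 * \<delta> * (b * c) = ((\<delta> * a) * d1 - b1 * c1) * (n * b)"
      by (simp add: \<delta> c1 algebra_simps)
    finally show ?thesis using M by (metis mult_1 of_int_add of_int_mult)
  qed
  define z where "z = (\<lambda>\<tau>. of_real (\<alpha> / \<delta>) * \<tau> + of_real (\<beta> / \<delta>) :: complex)"
  have z_lim: "filterlim z at_i_infinity at_i_infinity"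
    unfolding z_def using \<alpha> \<delta>0 by (intro filterlim_Im_affine) auto
  have eq: "norm (dedekind_eta (of_int n * mob a b c d \<tau>)) / sqrt (norm (of_int c * \<tau> + of_int d)) *
      exp (pi / 12 * ((gcd n c)\<^sup>2 / n) * Im \<tau>) = 1 / sqrt \<delta> * norm (qpoch 1 (qexp (z \<tau>)))"
    if \<tau>: "Im \<tau> > 0" for \<tau>
  proof -
    have zz: "z \<tau> = (of_int \<alpha> * \<tau> + of_int \<beta>) / of_int \<delta>"
      by (simp add: z_def add_divide_distrib)
    have Im_z: "Im (z \<tau>) = \<alpha> / \<delta> * Im \<tau>" by (simp add: z_def)
    then have z0: "Im (z \<tau>) > 0" using \<alpha> \<delta>0 \<tau> by simp
    have den: "of_int c * \<tau> + of_int d = of_int \<delta> * (of_int c1 * z \<tau> + of_int d1)"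
      using \<delta>0 by (simp add: zz c1 col[symmetric] field_simps)
    have num: "of_int n * (of_int a * \<tau> + of_int b) = of_int \<delta> * (of_int (\<delta> * a) * z \<tau> + of_int b1)"
    proof -
      have "of_int \<delta> * z \<tau> = of_int \<alpha> * \<tau> + of_int \<beta>" using \<delta>0 by (simp add: zz)
      moreover have "of_int \<delta> * (of_int (\<delta> * a) * z \<tau> + of_int b1) =
          of_int (\<delta> * a) * (of_int \<delta> * z \<tau>) + of_int b1 * of_int \<delta>"
        by (simp add: algebra_simps)
      ultimately have "of_int \<delta> * (of_int (\<delta> * a) * z \<tau> + of_int b1) =
          of_int (\<delta> * a) * (of_int \<alpha> * \<tau> + of_int \<beta>) + of_int b1 * of_int \<delta>"
        by (simp only:)
      also have "\<dots> = of_int (\<delta> * a) * of_int \<alpha> * \<tau> + of_int (n * b)"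
        unfolding col1[symmetric] by (simp only: algebra_simps)
      finally show ?thesis by (simp add: \<delta> algebra_simps)
    qed
    have "of_int n * mob a b c d \<tau> = mob (\<delta> * a) b1 c1 d1 (z \<tau>)"
      using \<delta>0 by (simp add: mob_def[of a] num den times_divide_eq_right) (simp add: mob_def)
    then have "norm (dedekind_eta (of_int n * mob a b c d \<tau>)) =
        sqrt (norm (of_int c1 * z \<tau> + of_int d1)) * norm (dedekind_eta (z \<tau>))"
      using norm_eta_mob[OF z0 M] by simp
    moreover have "sqrt (norm (of_int c * \<tau> + of_int d)) = sqrt \<delta> * sqrt (norm (of_int c1 * z \<tau> + of_int d1))"
      unfolding den using \<delta>0 by (simp add: norm_mult real_sqrt_mult)
    moreover have "of_int c1 * z \<tau> + of_int d1 \<noteq> 0"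
      using mob_denominator_nonzero[OF z0, of c1 d1] M by fastforce
    ultimately have "norm (dedekind_eta (of_int n * mob a b c d \<tau>)) / sqrt (norm (of_int c * \<tau> + of_int d)) =
        1 / sqrt \<delta> * norm (dedekind_eta (z \<tau>))"
      using \<delta>0 by (simp add: field_simps)
    also have "norm (dedekind_eta (z \<tau>)) = exp (- (pi / 12 * ((gcd n c)\<^sup>2 / n) * Im \<tau>)) * norm (qpoch 1 (qexp (z \<tau>)))"
    proof -
      have "real_of_int n = \<alpha> * \<delta>" by (simp add: \<delta>)
      then have "pi / 12 * ((gcd n c)\<^sup>2 / n) * Im \<tau> = 2 * pi * Im (z \<tau> / 24)"
        unfolding \<alpha>_def[symmetric] using \<alpha> \<delta>0 by (simp add: Im_z power2_eq_square)
      then show ?thesis by (simp add: eta_eq norm_mult norm_qexp)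
    qed
    finally show ?thesis by (simp add: exp_minus)
  qed
  have "((\<lambda>\<tau>. 1 / sqrt \<delta> * norm (qpoch 1 (qexp (z \<tau>)))) \<longlongrightarrow> 1 / sqrt \<delta> * norm (1::complex)) at_i_infinity"
    by (intro tendsto_intros filterlim_compose[OF tendsto_qpoch_at_i_infinity z_lim])
  moreover have "\<forall>\<^sub>F \<tau> in at_i_infinity. 1 / sqrt \<delta> * norm (qpoch 1 (qexp (z \<tau>))) =
      norm (dedekind_eta (of_int n * mob a b c d \<tau>)) / sqrt (norm (of_int c * \<tau> + of_int d)) *
      exp (pi / 12 * ((gcd n c)\<^sup>2 / n) * Im \<tau>)"
    using eventually_Im_gt_at_i_infinity[of 0] by eventually_elim (simp only: eq)
  moreover have "real_of_int \<delta> = n / gcd n c"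
    unfolding \<alpha>_def[symmetric] using \<alpha> by (simp add: \<delta>)
  ultimately show ?thesis using Lim_transform_eventually by fastforce
qed

text \<open>Ligozat's formula: 24 times the exponent of \<open>qexp \<tau>\<close> in the leading
  term of the eta quotient at a cusp a/c, not normalised by the width of the cusp.\<close>

definition cusp_order :: "(int \<times> int) list \<Rightarrow> int \<Rightarrow> real" where
  "cusp_order rs c = (\<Sum>(n, r)\<leftarrow>rs. r * ((gcd n c)\<^sup>2 / n))"

lemma norm_eta_quot_cusp:
  assumes det: "a * d - b * c = 1" and pos: "\<forall>(n, r)\<in>set rs. n > 0" and wt: "(\<Sum>(n, r)\<leftarrow>rs. r) = 0"
  obtains K where "K > 0" "((\<lambda>\<tau>. norm (eta_quot rs (mob a b c d \<tau>)) *
      exp (pi / 12 * cusp_order rs c * Im \<tau>)) \<longlongrightarrow> K) at_i_infinity"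
proof -
  define s where "s = (\<lambda>\<tau>::complex. sqrt (norm (of_int c * \<tau> + of_int d)))"
  \<comment> \<open>A partial list need not have weight 0, so the induction carries the power of
    |c\<tau> + d|^(1/2) along; it is trivial for the whole list.\<close>
  have "\<exists>K>0. ((\<lambda>\<tau>. norm (eta_quot rs' (mob a b c d \<tau>)) / s \<tau> powi (\<Sum>(n, r)\<leftarrow>rs'. r) *
      exp (pi / 12 * cusp_order rs' c * Im \<tau>)) \<longlongrightarrow> K) at_i_infinity"
    if "set rs' \<subseteq> set rs" for rs'
    using that
  proof (induction rs')
    case Nil
    show ?case by (intro exI[of _ 1]) (auto simp: cusp_order_def)
  next
    case (Cons p rs')
    obtain n r where p: "p = (n, r)" by fastforce
    have n: "n > 0" using Cons.prems pos by (auto simp: p)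
    obtain K where K: "K > 0" "((\<lambda>\<tau>. norm (eta_quot rs' (mob a b c d \<tau>)) / s \<tau> powi (\<Sum>(n, r)\<leftarrow>rs'. r) *
      exp (pi / 12 * cusp_order rs' c * Im \<tau>)) \<longlongrightarrow> K) at_i_infinity"
      using Cons by auto
    define L where "L = 1 / sqrt (n / gcd n c)"
    have L: "L > 0" using n by (simp add: L_def)
    have "((\<lambda>\<tau>. (norm (dedekind_eta (of_int n * mob a b c d \<tau>)) / s \<tau> *
      exp (pi / 12 * ((gcd n c)\<^sup>2 / n) * Im \<tau>)) powi r * (norm (eta_quot rs' (mob a b c d \<tau>)) / s \<tau> powi (\<Sum>(n, r)\<leftarrow>rs'. r) *
      exp (pi / 12 * cusp_order rs' c * Im \<tau>))) \<longlongrightarrow> L powi r * K) at_i_infinity"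
      using L K(2) norm_eta_cusp[OF det n] unfolding L_def s_def
      by (intro tendsto_mult tendsto_power_int) auto
    moreover have "\<forall>\<^sub>F \<tau> in at_i_infinity.
      (norm (dedekind_eta (of_int n * mob a b c d \<tau>)) / s \<tau> *
      exp (pi / 12 * ((gcd n c)\<^sup>2 / n) * Im \<tau>)) powi r * (norm (eta_quot rs' (mob a b c d \<tau>)) / s \<tau> powi (\<Sum>(n, r)\<leftarrow>rs'. r) *
      exp (pi / 12 * cusp_order rs' c * Im \<tau>)) =
      norm (eta_quot (p # rs') (mob a b c d \<tau>)) / s \<tau> powi (\<Sum>(n, r)\<leftarrow>p # rs'. r) *
      exp (pi / 12 * cusp_order (p # rs') c * Im \<tau>)"
      using eventually_Im_gt_at_i_infinity[of 0]
    proof eventually_elim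
      case (elim \<tau>)
      have "s \<tau> > 0" using mob_denominator_nonzero[OF elim, of c d] det by (fastforce simp: s_def)
      moreover have "exp (pi / 12 * cusp_order (p # rs') c * Im \<tau>) =
          exp (pi / 12 * ((gcd n c)\<^sup>2 / n) * Im \<tau>) powi r * exp (pi / 12 * cusp_order rs' c * Im \<tau>)"
        unfolding exp_power_int exp_add[symmetric]
        by (intro arg_cong[where f = exp]) (simp add: p cusp_order_def algebra_simps)
      ultimately show ?case
        by (simp add: p power_int_mult_distrib power_int_divide_distrib power_int_add norm_mult norm_power_int)
    qed
    ultimately have "((\<lambda>\<tau>. norm (eta_quot (p # rs') (mob a b c d \<tau>)) / s \<tau> powi (\<Sum>(n, r)\<leftarrow>p # rs'. r) *
      exp (pi / 12 * cusp_order (p # rs') c * Im \<tau>)) \<longlongrightarrow> L powi r * K) at_i_infinity"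
      using Lim_transform_eventually by fast
    moreover have "L powi r * K > 0" using L K(1) by simp
    ultimately show ?case by blast
  qed
  from this[of rs] that wt show ?thesis by auto
qed

lemma bounded_of_exp_asymptotics:
  fixes f :: "complex \<Rightarrow> complex"
  assumes "A \<ge> 0" "((\<lambda>\<tau>. norm (f \<tau>) * exp (A * Im \<tau>)) \<longlongrightarrow> K) at_i_infinity"
  shows "\<exists>B Y. \<forall>\<tau>. Im \<tau> > Y \<longrightarrow> norm (f \<tau>) \<le> B"
proof -
  have "\<forall>\<^sub>F \<tau> in at_i_infinity. norm (f \<tau>) * exp (A * Im \<tau>) < K + 1"
    using assms(2) by (rule order_tendstoD) simp
  then have "\<forall>\<^sub>F \<tau> in at_i_infinity. norm (f \<tau>) \<le> K + 1"
    using eventually_Im_gt_at_i_infinity[of 0]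
  proof eventually_elim
    case (elim \<tau>)
    have "norm (f \<tau>) * 1 \<le> norm (f \<tau>) * exp (A * Im \<tau>)"
      using assms(1) elim(2) by (intro mult_left_mono) auto
    then show ?case using elim(1) by simp
  qed
  then show ?thesis by (auto simp: eventually_at_i_infinity)
qed

section \<open>The q-expansion at i-infinity\<close>

lemma norm_qpoch_minus_1:
  assumes "norm q \<le> 1 / 2"
  shows "norm (qpoch u q - 1) \<le> exp (2 * norm q * norm u) - 1"
proof (rule LIMSEQ_le_const2)
  have q1: "norm q < 1" using assms by simp
  show "(\<lambda>N. norm ((\<Prod>n<N. 1 + - (q ^ Suc n * u)) - 1)) \<longlonglongrightarrow> norm (qpoch u q - 1)"
    using qpoch_LIMSEQ[OF q1, of u] by (intro tendsto_intros) simp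
  have "norm ((\<Prod>n<N. 1 + - (q ^ Suc n * u)) - 1) \<le> exp (2 * norm q * norm u) - 1" for N
  proof -
    have "norm ((\<Prod>n<N. 1 + - (q ^ Suc n * u)) - 1) \<le> (\<Prod>n<N. 1 + norm (- (q ^ Suc n * u))) - 1"
      by (rule norm_prod_minus1_le_prod_minus1)
    also have "(\<Prod>n<N. 1 + norm (- (q ^ Suc n * u))) \<le> exp (\<Sum>n<N. norm (- (q ^ Suc n * u)))"
      by (rule prod_le_exp_sum) auto
    also have "(\<Sum>n<N. norm (- (q ^ Suc n * u))) = (\<Sum>n<N. norm q ^ n) * (norm q * norm u)"
      by (simp add: norm_mult norm_power sum_distrib_left mult_ac)
    also have "(\<Sum>n<N. norm q ^ n) \<le> 2"
    proof -
      have "(\<Sum>n<N. norm q ^ n) \<le> suminf (\<lambda>n. norm q ^ n)"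
        using q1 by (intro sum_le_suminf summable_geometric) auto
      also have "\<dots> = 1 / (1 - norm q)" using q1 by (simp add: suminf_geometric)
      also have "\<dots> \<le> 2" using assms by (simp add: field_simps)
      finally show ?thesis .
    qed
    finally show ?thesis by (simp add: mult_right_mono mult.assoc)
  qed
  then show "\<exists>N. \<forall>n\<ge>N. norm ((\<Prod>n<n. 1 + - (q ^ Suc n * u)) - 1) \<le> exp (2 * norm q * norm u) - 1"
    by blast
qed

text \<open>Split off the first factor 1 - q. The rest is \<open>qpoch q q\<close>, which differs
  from 1 by O(|q|^2), so the derivative is that of 1 - q.\<close>

lemma qpoch_deriv_0: "((\<lambda>q. qpoch 1 q) has_field_derivative - 1) (at 0)"
proof -
  have bound: "norm ((qpoch q q - 1) / q) \<le> 3 * norm q" if "q \<noteq> 0" "norm q < 1 / 2" for q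
  proof -
    define x where "x = 2 * norm q * norm q"
    have x: "0 \<le> x" "x \<le> norm q"
      using that mult_right_mono[of "2 * norm q" 1 "norm q"] by (auto simp: x_def)
    then have "x \<le> 1" using that by linarith
    have "norm (qpoch q q - 1) \<le> exp x - 1"
      using norm_qpoch_minus_1[of q q] that by (simp add: x_def)
    also have "\<dots> \<le> x + x\<^sup>2" using exp_bound[of x] x \<open>x \<le> 1\<close> by simp
    also have "x\<^sup>2 \<le> norm q * norm q" unfolding power2_eq_square using x by (intro mult_mono) auto
    finally have "norm (qpoch q q - 1) \<le> 3 * norm q * norm q" by (simp add: x_def)
    then show ?thesis using that by (simp add: norm_divide field_simps)
  qed
  have small: "\<forall>\<^sub>F q in at (0::complex). q \<noteq> 0 \<and> norm q < 1 / 2"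
    by (auto simp: eventually_at intro!: exI[of _ "1/2"])
  have lim: "((\<lambda>q. (qpoch q q - 1) / q) \<longlongrightarrow> 0) (at 0)"
  proof (rule Lim_null_comparison)
    show "\<forall>\<^sub>F q in at 0. norm ((qpoch q q - 1) / q) \<le> 3 * norm q"
      using small by eventually_elim (use bound in auto)
    show "((\<lambda>q::complex. 3 * norm q) \<longlongrightarrow> 0) (at 0)" by (auto intro!: tendsto_eq_intros)
  qed
  have "((\<lambda>q. (1 - q) * ((qpoch q q - 1) / q) - 1) \<longlongrightarrow> (1 - 0) * 0 - 1) (at 0)"
    by (intro tendsto_intros lim)
  moreover have "\<forall>\<^sub>F q in at 0. (1 - q) * ((qpoch q q - 1) / q) - 1 = (qpoch 1 q - qpoch 1 0) / (q - 0)"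
    using small
  proof eventually_elim
    case (elim q)
    then show ?case using qpoch_shift[of q 1] by (simp add: field_simps)
  qed
  ultimately show ?thesis
    unfolding has_field_derivative_iff using Lim_transform_eventually by fastforce
qed

definition eta_series :: "(int \<times> int) list \<Rightarrow> complex \<Rightarrow> complex" where
  "eta_series rs q = (\<Prod>(n, r)\<leftarrow>rs. qpoch 1 (q ^ nat n) powi r)"

lemma eta_series_eq:
  assumes "Im \<tau> > 0" "\<forall>(n, r)\<in>set rs. n > 0" "(\<Sum>(n, r)\<leftarrow>rs. n * r) = - 24"
  shows "eta_quot rs \<tau> = inverse (qexp \<tau>) * eta_series rs (qexp \<tau>)"
proof -
  have "eta_quot rs \<tau> = qexp (of_int (\<Sum>(n, r)\<leftarrow>rs. n * r) * (\<tau> / 24)) * eta_series rs (qexp \<tau>)"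
    using assms(2)
  proof (induction rs)
    case Nil
    then show ?case by (simp add: eta_series_def qexp_def)
  next
    case (Cons p rs)
    obtain n r where p: "p = (n, r)" by fastforce
    have n: "n > 0" using Cons.prems by (simp add: p)
    have "qexp (of_int n * \<tau>) = qexp \<tau> ^ nat n"
      using n by (simp add: qexp_of_nat_mult[symmetric])
    then have "dedekind_eta (of_int n * \<tau>) powi r = qexp (of_int (n * r) * (\<tau> / 24)) * qpoch 1 (qexp \<tau> ^ nat n) powi r"
      by (simp add: eta_eq power_int_mult_distrib qexp_of_int_mult[symmetric] mult_ac)
    then show ?case using Cons by (simp add: p eta_series_def qexp_add ring_distribs mult_ac)
  qed
  then show ?thesis using assms(3) by (simp add: qexp_minus)
qed

text \<open>To first order only the factors with n = 1 are visible, since q^n is flat at 0 for n >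
  1. This is where the number of components enters: every Coxeter Frame shape contains 1 with
  exponent -1.\<close>

lemma holomorphic_eta_series:
  assumes "\<forall>(n, r)\<in>set rs. n > 0"
  shows "eta_series rs holomorphic_on ball 0 1" "eta_series rs 0 = 1"
    "(eta_series rs has_field_derivative - of_int (\<Sum>(n, r)\<leftarrow>rs. if n = 1 then r else 0)) (at 0)"
proof -
  have "eta_series rs holomorphic_on ball 0 1 \<and> eta_series rs 0 = 1 \<and>
    (eta_series rs has_field_derivative - of_int (\<Sum>(n, r)\<leftarrow>rs. if n = 1 then r else 0)) (at 0)"
    using assms
  proof (induction rs)
    case Nil
    then show ?case by (simp add: eta_series_def[abs_def])
  next
    case (Cons p rs)
    obtain n r where p: "p = (n, r)" by fastforce
    have n: "n > 0" using Cons.prems by (simp add: p)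
    define g where "g = (\<lambda>q. qpoch 1 (q ^ nat n) powi r)"
    have eq: "eta_series (p # rs) = (\<lambda>q. g q * eta_series rs q)"
      by (simp add: eta_series_def p g_def fun_eq_iff)
    have norm: "norm (q ^ nat n) < 1" if "norm q < 1" for q :: complex
      using that n by (simp add: norm_power power_less_one_iff)
    have "(\<lambda>q. qpoch 1 (q ^ nat n)) holomorphic_on ball 0 1"
      using holomorphic_on_compose_gen[of "\<lambda>q. q ^ nat n" "ball 0 1" "qpoch 1" "ball 0 1"]
        holomorphic_qpoch_right[of 1] norm holomorphic_on_power[OF holomorphic_on_ident]
      by (auto simp: o_def image_subset_iff)
    then have hol: "g holomorphic_on ball 0 1"
      unfolding g_def using qpoch_1_nonzero norm by (auto intro!: holomorphic_intros)
    have g0: "g 0 = 1" using n by (simp add: g_def zero_power)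
    have "(qpoch 1 has_field_derivative - 1) (at (0 ^ nat n))" using qpoch_deriv_0 n by (simp add: zero_power)
    then have "((\<lambda>q. qpoch 1 (q ^ nat n)) has_field_derivative - 1 * (of_nat (nat n) * 0 ^ (nat n - 1))) (at 0)"
      by (rule DERIV_chain2) (auto intro!: derivative_eq_intros)
    then have "((\<lambda>q. qpoch 1 (q ^ nat n)) has_field_derivative (if n = 1 then - 1 else 0)) (at 0)"
      using n by (cases "n = 1") (auto simp: zero_power)
    then have dg: "(g has_field_derivative - of_int (if n = 1 then r else 0)) (at 0)"
      unfolding g_def using n by (auto intro!: derivative_eq_intros simp: zero_power)
    have "((\<lambda>q. g q * eta_series rs q) has_field_derivative
        - of_int (if n = 1 then r else 0) * eta_series rs 0 +
        (- of_int (\<Sum>(n, r)\<leftarrow>rs. if n = 1 then r else 0)) * g 0) (at 0)"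
      using Cons by (intro DERIV_mult dg) auto
    moreover have "(\<lambda>q. g q * eta_series rs q) holomorphic_on ball 0 1"
      using Cons by (intro holomorphic_intros hol) auto
    ultimately show ?case using Cons g0 unfolding p[symmetric] eq by (simp add: p algebra_simps split: if_splits)
  qed
  then show "eta_series rs holomorphic_on ball 0 1" "eta_series rs 0 = 1"
    "(eta_series rs has_field_derivative - of_int (\<Sum>(n, r)\<leftarrow>rs. if n = 1 then r else 0)) (at 0)"
    by blast+
qed

lemma eta_quot_principal_expansion:
  assumes pos: "\<forall>(n, r)\<in>set rs. n > 0" and "(\<Sum>(n, r)\<leftarrow>rs. n * r) = - 24"
    and d: "(\<Sum>(n, r)\<leftarrow>rs. if n = 1 then r else 0) = d"
  shows "has_principal_expansion (eta_quot rs) (- of_int d)"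
proof -
  define H where "H = eta_series rs"
  have H: "H holomorphic_on ball 0 1" "H 0 = 1" "(H has_field_derivative - of_int d) (at 0)"
    using holomorphic_eta_series[OF pos] by (simp_all add: H_def d)
  \<comment> \<open>The difference quotient of \<open>H\<close> at 0. Since H(0) = 1, dividing by q
    turns \<open>H\<close> into 1/q + K(q), so K(0) is the constant term and K(q) - K(0) the O(q)
    remainder.\<close>
  define K where "K = (\<lambda>q. if q = 0 then deriv H 0 else (H q - H 0) / (q - 0))"
  have "K holomorphic_on ball 0 1"
    unfolding K_def by (rule pole_lemma[OF H(1)]) auto
  then obtain D where "(K has_field_derivative D) (at 0)"
    by (metis holomorphic_on_open open_ball centre_in_ball zero_less_one)
  then have "((\<lambda>q. (K q - K 0) / (q - 0)) \<longlongrightarrow> D) (at 0)"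
    by (simp add: has_field_derivative_iff)
  then have "((\<lambda>q. norm ((K q - K 0) / (q - 0))) \<longlongrightarrow> norm D) (at 0)" by (rule tendsto_norm)
  then have "\<forall>\<^sub>F q in at 0. norm ((K q - K 0) / (q - 0)) < norm D + 1"
    by (rule order_tendstoD) simp
  moreover have "filterlim qexp (at 0) at_i_infinity"
    unfolding filterlim_at using tendsto_qexp_0 by simp
  ultimately have ev: "\<forall>\<^sub>F \<tau> in at_i_infinity. norm ((K (qexp \<tau>) - K 0) / (qexp \<tau> - 0)) < norm D + 1"
    by (rule eventually_compose_filterlim)
  have K0: "K 0 = - of_int d" using H(3) by (simp add: K_def DERIV_imp_deriv)
  have "\<forall>\<^sub>F \<tau> in at_i_infinity. norm (eta_quot rs \<tau> - (inverse (qexp \<tau>) + - of_int d)) \<le> (norm D + 1) * norm (qexp \<tau>)"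
    using ev eventually_Im_gt_at_i_infinity[of 0]
  proof eventually_elim
    case (elim \<tau>)
    have *: "eta_quot rs \<tau> - (inverse (qexp \<tau>) + - of_int d) = K (qexp \<tau>) - K 0"
      unfolding K0 using eta_series_eq[OF elim(2) pos assms(2)]
      by (simp add: K_def H(2)) (simp add: H_def field_simps)
    have "norm (K (qexp \<tau>) - K 0) / norm (qexp \<tau>) \<le> norm D + 1"
      using elim(1) by (simp add: norm_divide)
    then show ?case unfolding * by (subst (asm) pos_divide_le_eq) auto
  qed
  then show ?thesis unfolding has_principal_expansion_def by (rule bigoI)
qed

section \<open>Reduction theory and expansions at the cusps\<close>

lemma mob_translate: "mob a b c d (\<tau> + of_int k) = mob a (a * k + b) c (c * k + d) \<tau>"
  by (simp add: mob_def algebra_simps)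

lemma mob_inverse:
  assumes "a * d - b * c = 1" "Im \<tau> > 0"
  shows "mob a b c d (mob d (- b) (- c) a \<tau>) = \<tau>" "mob d (- b) (- c) a (mob a b c d \<tau>) = \<tau>"
proof -
  have nz: "of_int (- c) * \<tau> + of_int a \<noteq> (0 :: complex)" "of_int c * \<tau> + of_int d \<noteq> (0 :: complex)"
    by (rule mob_denominator_nonzero[OF assms(2)]; use assms(1) in auto)+
  have "mob a b c d (mob d (- b) (- c) a \<tau>) = mob 1 0 0 1 \<tau>"
    "mob d (- b) (- c) a (mob a b c d \<tau>) = mob 1 0 0 1 \<tau>"
    unfolding mob_mob[OF nz(1)] mob_mob[OF nz(2)] using assms(1) by (simp_all add: algebra_simps)
  then show "mob a b c d (mob d (- b) (- c) a \<tau>) = \<tau>" "mob d (- b) (- c) a (mob a b c d \<tau>) = \<tau>"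
    by (simp_all add: mob_def)
qed

text \<open>If |Re z| <= 1/2 and Im z < 1/2, then |z|^2 <= 1/2, so -1/z has at least twice the
  imaginary part of z. Doubling makes the number of steps explicit, and this half-strip, though
  larger than a fundamental domain, has the same use.\<close>

lemma reduction:
  assumes "Im \<tau> > 0"
  shows "\<exists>a b c d z. a * d - b * c = 1 \<and> Im z \<ge> 1 / 2 \<and> \<bar>Re z\<bar> \<le> 1 / 2 \<and> \<tau> = mob a b c d z"
proof -
  have round: "\<exists>k z. \<tau> = z + of_int k \<and> \<bar>Re z\<bar> \<le> 1 / 2" for \<tau>
  proof -
    have "\<bar>Re \<tau> - of_int (round (Re \<tau>))\<bar> \<le> 1 / 2"
      using of_int_round_abs_le[of "Re \<tau>"] by (simp add: abs_minus_commute)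
    then show ?thesis
      by (intro exI[of _ "round (Re \<tau>)"] exI[of _ "\<tau> - of_int (round (Re \<tau>))"]) simp
  qed
  have "\<exists>a b c d z. a * d - b * c = 1 \<and> Im z \<ge> 1 / 2 \<and> \<bar>Re z\<bar> \<le> 1 / 2 \<and> \<tau> = mob a b c d z"
    if "2 ^ n * Im \<tau> \<ge> 1 / 2" "Im \<tau> > 0" for n
    using that
  proof (induction n arbitrary: \<tau>)
    case 0
    obtain k z where z: "\<tau> = z + of_int k" "\<bar>Re z\<bar> \<le> 1 / 2" using round by blast
    then have "\<tau> = mob 1 k 0 1 z" "Im z \<ge> 1 / 2" "1 * 1 - k * 0 = 1" using 0 by (auto simp: mob_def)
    then show ?case using z(2) by blast
  next
    case (Suc n)
    obtain k z where z: "\<tau> = z + of_int k" "\<bar>Re z\<bar> \<le> 1 / 2" using round by blast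
    show ?case
    proof (cases "Im z \<ge> 1 / 2")
      case True
      have "\<tau> = mob 1 k 0 1 z" "1 * 1 - k * 0 = 1" by (simp_all add: mob_def z)
      then show ?thesis using z(2) True by blast
    next
      case False
      have Imz: "Im z > 0" using Suc.prems z by simp
      then have z0: "z \<noteq> 0" by auto
      define w where "w = - 1 / z"
      have "(norm z)\<^sup>2 \<le> 1 / 2"
      proof -
        have "(Re z)\<^sup>2 \<le> (1 / 2)\<^sup>2" using z(2) by (intro power2_le_iff_abs_le[THEN iffD2]) auto
        moreover have "(Im z)\<^sup>2 \<le> (1 / 2)\<^sup>2" using False Imz by (intro power_mono) auto
        ultimately show ?thesis by (simp add: cmod_power2 power_divide)
      qed
      moreover have "(norm z)\<^sup>2 > 0" using z0 by simp
      ultimately have "Im z / (1 / 2) \<le> Im z / (norm z)\<^sup>2"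
        using Imz by (intro divide_left_mono) auto
      also have "\<dots> = Im w" by (simp add: w_def Im_divide cmod_power2)
      finally have Imw: "2 * Im z \<le> Im w" by simp
      have "1 / 2 \<le> 2 ^ n * (2 * Im z)" using Suc.prems z by simp
      also have "\<dots> \<le> 2 ^ n * Im w" using Imw by (intro mult_left_mono) auto
      finally have "1 / 2 \<le> 2 ^ n * Im w" .
      then obtain a b c d z' where IH: "a * d - b * c = 1" "Im z' \<ge> 1 / 2" "\<bar>Re z'\<bar> \<le> 1 / 2" "w = mob a b c d z'"
        using Suc.IH[of w] Imw Imz by (auto simp: not_le)
      have "\<tau> = mob k (- 1) 1 0 w" using z0 by (simp add: z mob_def w_def field_simps)
      also have "\<dots> = mob (k * a - c) (k * b - d) a b z'"
      proof -
        have "Im z' > 0" using IH by simp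
        then have "of_int c * z' + of_int d \<noteq> 0"
          using mob_denominator_nonzero[of z' c d] IH(1) by fastforce
        then show ?thesis by (simp add: IH(4) mob_mob)
      qed
      finally have *: "\<tau> = mob (k * a - c) (k * b - d) a b z'" .
      have "(k * a - c) * b - (k * b - d) * a = 1" using IH(1) by (simp add: algebra_simps)
      then show ?thesis using * IH(2,3) by blast
    qed
  qed
  moreover obtain n where "(1 / 2) / Im \<tau> < 2 ^ n"
    using real_arch_pow[of 2 "(1 / 2) / Im \<tau>"] by auto
  then have "2 ^ n * Im \<tau> \<ge> 1 / 2" using assms by (simp add: field_simps)
  ultimately show ?thesis using assms by blast
qed

section \<open>Expansions in the local parameter at a cusp\<close>

lemma qexp_eq_iff: "qexp z = qexp w \<longleftrightarrow> (\<exists>n::int. z = w + of_int n)"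
proof -
  have "qexp z = qexp w \<longleftrightarrow> qexp (z - w) = 1"
    using qexp_add[of "z - w" w] by auto
  also have "\<dots> \<longleftrightarrow> (\<exists>n::int. z = w + of_int n)"
    unfolding qexp_eq_1_iff by (auto simp: algebra_simps)
  finally show ?thesis .
qed

lemma norm_qexp_divide: "norm (qexp (\<tau> / of_nat m)) = exp (- (2 * pi * Im \<tau> / m))"
  by (simp add: norm_qexp)

lemma qexp_Ln:
  assumes "m > 0" "w \<noteq> 0"
  defines "\<tau> \<equiv> of_nat m * (Ln w / (2 * of_real pi * \<i>))"
  shows "qexp (\<tau> / of_nat m) = w" "Im \<tau> = - (m * ln (norm w) / (2 * pi))" "norm w < 1 \<Longrightarrow> Im \<tau> > 0"
proof -
  show "qexp (\<tau> / of_nat m) = w" using assms(1,2) by (simp add: \<tau>_def qexp_def)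
  show Im: "Im \<tau> = - (m * ln (norm w) / (2 * pi))"
    using assms(2) by (simp add: \<tau>_def Im_divide power2_eq_square field_simps)
  assume "norm w < 1"
  then have "m * ln (norm w) < 0" using assms(1,2) by (simp add: mult_pos_neg)
  then show "Im \<tau> > 0" unfolding Im by (simp add: divide_neg_pos)
qed

text \<open>Periodicity makes \<open>F\<close> a function on the punctured disc, independent of the
  branch of the logarithm; boundedness high up makes the puncture removable.\<close>

lemma fourier_expansion:
  fixes F :: "complex \<Rightarrow> complex" and m :: nat
  assumes m: "m > 0" and hol: "F holomorphic_on {\<tau>. Im \<tau> > 0}"
    and per: "\<And>\<tau>. Im \<tau> > 0 \<Longrightarrow> F (\<tau> + of_nat m) = F \<tau>"
    and bounded: "\<And>\<tau>. Im \<tau> > 0 \<Longrightarrow> Im \<tau> > Y \<Longrightarrow> norm (F \<tau>) \<le> B"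
  obtains h where "h holomorphic_on ball 0 1" "\<And>\<tau>. Im \<tau> > 0 \<Longrightarrow> F \<tau> = h (qexp (\<tau> / of_nat m))"
proof -
  define H where "H = {\<tau>. Im \<tau> > 0}"
  have per_int: "F (\<tau> + of_int k * of_nat m) = F \<tau>" if "Im \<tau> > 0" for \<tau> k
  proof (induction k rule: int_induct[of _ 0])
    case (step1 i)
    then show ?case using per[of "\<tau> + of_int i * of_nat m"] that by (simp add: algebra_simps)
  next
    case (step2 i)
    then show ?case using per[of "\<tau> + of_int (i - 1) * of_nat m"] that by (simp add: algebra_simps)
  qed auto
  have same: "F \<tau> = F \<tau>'" if "Im \<tau> > 0" "Im \<tau>' > 0" and eq: "qexp (\<tau> / of_nat m) = qexp (\<tau>' / of_nat m)" for \<tau> \<tau>'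
  proof -
    obtain n :: int where "\<tau> / of_nat m = \<tau>' / of_nat m + of_int n" using eq qexp_eq_iff by blast
    then have "\<tau> = \<tau>' + of_int n * of_nat m" using m by (simp add: field_simps)
    then show ?thesis using per_int[OF that(2)] by simp
  qed
  define L where "L = (\<lambda>w. of_nat m * (Ln w / (2 * of_real pi * \<i>)))"
  have qL: "qexp (L w / of_nat m) = w" if "w \<noteq> 0" for w
    unfolding L_def by (rule qexp_Ln[OF m that])
  have ImL: "Im (L w) = - (m * ln (norm w) / (2 * pi))" if "w \<noteq> 0" for w
    unfolding L_def by (rule qexp_Ln[OF m that])
  define h0 where "h0 = (\<lambda>w. F (L w))"
  have pos: "Im (L w) > 0" if "w \<in> ball 0 1 - {0}" for w
    unfolding L_def using that by (intro qexp_Ln[OF m]) auto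
  have h0: "F \<tau> = h0 (qexp (\<tau> / of_nat m))" if "Im \<tau> > 0" for \<tau>
  proof -
    have "norm (qexp (\<tau> / of_nat m)) < 1" using that m by (intro norm_qexp_less_1) simp
    then show ?thesis unfolding h0_def using that by (intro same pos) (auto simp: qL)
  qed
  have "h0 holomorphic_on ball 0 1 - {0}"
  proof -
    have 1: "h0 holomorphic_on (ball 0 1 - {0}) - \<real>\<^sub>\<le>\<^sub>0"
    proof -
      have "L holomorphic_on (ball 0 1 - {0}) - \<real>\<^sub>\<le>\<^sub>0"
        unfolding L_def by (intro holomorphic_intros) auto
      moreover have "L ` ((ball 0 1 - {0}) - \<real>\<^sub>\<le>\<^sub>0) \<subseteq> {\<tau>. Im \<tau> > 0}" using pos by auto
      ultimately show ?thesis
        unfolding h0_def using holomorphic_on_compose_gen[OF _ hol] by (auto simp: o_def)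
    qed
    \<comment> \<open>A second branch, holomorphic off the positive real axis. The shift by m/2
      compensates the sign, because \<open>qexp (1 / 2) = - 1\<close>; the two slit discs together
      cover the punctured disc.\<close>
    define L' where "L' = (\<lambda>w. L (- w) + of_nat m / 2)"
    have 2: "h0 holomorphic_on (ball 0 1 - {0}) \<inter> uminus -` (- \<real>\<^sub>\<le>\<^sub>0)"
    proof -
      have pos': "Im (L' w) > 0" if "w \<in> ball 0 1 - {0}" for w :: complex
        using pos[of "- w"] that by (simp add: L'_def)
      have "L' holomorphic_on (ball 0 1 - {0}) \<inter> uminus -` (- \<real>\<^sub>\<le>\<^sub>0)"
        unfolding L'_def L_def by (intro holomorphic_intros) auto
      moreover have "L' ` ((ball 0 1 - {0}) \<inter> uminus -` (- \<real>\<^sub>\<le>\<^sub>0)) \<subseteq> {\<tau>. Im \<tau> > 0}" using pos' by auto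
      ultimately have "(\<lambda>w. F (L' w)) holomorphic_on (ball 0 1 - {0}) \<inter> uminus -` (- \<real>\<^sub>\<le>\<^sub>0)"
        using holomorphic_on_compose_gen[OF _ hol] by (auto simp: o_def)
      then show ?thesis
      proof (rule holomorphic_transform)
        fix w :: complex assume "w \<in> (ball 0 1 - {0}) \<inter> uminus -` (- \<real>\<^sub>\<le>\<^sub>0)"
        then have w: "w \<in> ball 0 1 - {0}" by auto
        have "L' w / of_nat m = L (- w) / of_nat m + 1 / 2"
          using m by (simp add: L'_def field_simps)
        then have "qexp (L' w / of_nat m) = w" using w by (simp only: qexp_add qexp_half) (simp add: qL)
        then show "F (L' w) = h0 w"
          unfolding h0_def using w by (intro same pos pos') (auto simp: qL)
      qed
    qed
    have op: "open ((ball 0 1 - {0}) - \<real>\<^sub>\<le>\<^sub>0 :: complex set)"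
      by (intro open_Diff) auto
    have op': "open ((ball 0 1 - {0}) \<inter> uminus -` (- \<real>\<^sub>\<le>\<^sub>0) :: complex set)"
      by (intro open_Int open_Diff open_vimage continuous_intros) auto
    have "ball 0 1 - {0} \<subseteq> ((ball 0 1 - {0}) - \<real>\<^sub>\<le>\<^sub>0) \<union> ((ball 0 1 - {0}) \<inter> uminus -` (- \<real>\<^sub>\<le>\<^sub>0) :: complex set)"
      by (auto simp: complex_nonpos_Reals_iff complex_eq_iff)
    then show ?thesis
      using holomorphic_on_Un[OF 1 2 op op'] holomorphic_on_subset by blast
  qed
  moreover have "\<exists>B. \<forall>\<^sub>F w in at 0. norm (h0 w) \<le> B"
  proof -
    define e where "e = min 1 (exp (- (2 * pi * Y / m)))"
    have "\<forall>\<^sub>F w in at 0. w \<in> ball 0 e - {0 :: complex}"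
      by (intro eventually_at_in_open) (auto simp: e_def)
    then have "\<forall>\<^sub>F w in at 0. norm (h0 w) \<le> B"
    proof eventually_elim
      case (elim w)
      then have w: "w \<in> ball 0 1 - {0}" "norm w < exp (- (2 * pi * Y / m))" by (auto simp: e_def)
      then have "ln (norm w) < - (2 * pi * Y / m)"
        using ln_less_cancel_iff[of "norm w" "exp (- (2 * pi * Y / m))"] by simp
      then have "m * ln (norm w) < - (2 * pi * Y)" using m by (simp add: field_simps)
      then have "Im (L w) > Y" using w m by (simp add: ImL field_simps)
      then show ?case unfolding h0_def using pos[OF w(1)] by (intro bounded) auto
    qed
    then show ?thesis by blast
  qed
  ultimately obtain h where h: "h holomorphic_on ball 0 1" "\<And>w. w \<in> ball 0 1 - {0} \<Longrightarrow> h w = h0 w"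
    using holomorphic_on_extend_bounded[of h0 "ball 0 1" 0] by auto
  show ?thesis
  proof (rule that[OF h(1)])
    fix \<tau> assume \<tau>: "Im \<tau> > 0"
    have "norm (qexp (\<tau> / of_nat m)) < 1" using \<tau> m by (intro norm_qexp_less_1) simp
    then show "F \<tau> = h (qexp (\<tau> / of_nat m))" using h0[OF \<tau>] h(2) by simp
  qed
qed

lemma holomorphic_Lipschitz_at:
  assumes "h holomorphic_on ball z r" "r > 0"
  obtains C e where "C > 0" "e > 0" "e < r" "\<And>w. norm (w - z) < e \<Longrightarrow> norm (h w - h z) \<le> C * norm (w - z)"
proof -
  obtain D where "(h has_field_derivative D) (at z)"
    using assms by (metis holomorphic_on_open open_ball centre_in_ball)
  then have "((\<lambda>w. norm ((h w - h z) / (w - z))) \<longlongrightarrow> norm D) (at z)"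
    by (intro tendsto_norm) (simp add: has_field_derivative_iff)
  then have "\<forall>\<^sub>F w in at z. norm ((h w - h z) / (w - z)) < norm D + 1"
    by (rule order_tendstoD) simp
  then obtain e where e: "e > 0" "\<And>w. w \<noteq> z \<Longrightarrow> norm (w - z) < e \<Longrightarrow> norm ((h w - h z) / (w - z)) < norm D + 1"
    by (auto simp: eventually_at dist_norm)
  show ?thesis
  proof (rule that[of "norm D + 1" "min e (r / 2)"])
    fix w assume w: "norm (w - z) < min e (r / 2)"
    show "norm (h w - h z) \<le> (norm D + 1) * norm (w - z)"
    proof (cases "w = z")
      case False
      then have "norm (h w - h z) / norm (w - z) \<le> norm D + 1"
        using e(2)[of w] w by (simp add: norm_divide)
      then show ?thesis using False by (subst (asm) pos_divide_le_eq) auto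
    qed auto
  qed (use e assms in \<open>auto simp: add_nonneg_pos\<close>)
qed

lemma meromorphic_pole_growth:
  assumes "f meromorphic_on {z}"
  obtains k B where "\<forall>\<^sub>F w in at z. norm ((w - z) ^ k * f w) \<le> B"
proof -
  have iso: "isolated_singularity_at f z" and "not_essential f z"
    using assms by (simp_all add: meromorphic_at_iff)
  then consider c where "f \<midarrow>z\<rightarrow> c" | "is_pole f z" by (auto simp: not_essential_def)
  then show ?thesis
  proof cases
    case 1
    then have "((\<lambda>w. norm (f w)) \<longlongrightarrow> norm c) (at z)" by (rule tendsto_norm)
    then have "\<forall>\<^sub>F w in at z. norm (f w) < norm c + 1" by (rule order_tendstoD) simp
    then have "\<forall>\<^sub>F w in at z. norm ((w - z) ^ 0 * f w) \<le> norm c + 1" by eventually_elim simp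
    then show ?thesis by (rule that)
  next
    case 2
    obtain A where A: "open A" "z \<in> A" "f holomorphic_on A - {z}"
      using iso analytic_imp_holomorphic isolated_singularity_at_iff_analytic_nhd by auto
    define n where "n = zorder f z"
    define g where "g = zor_poly f z"
    obtain r where r: "r > 0" "g holomorphic_on cball z r"
        "\<forall>w\<in>cball z r - {z}. f w = g w / (w - z) ^ nat (- n) \<and> g w \<noteq> 0"
      using zorder_exist_pole[OF A(3,1,2) 2, folded n_def g_def] by auto
    have "isCont g z"
      using r(1,2) holomorphic_on_imp_continuous_on[of g "ball z r"] holomorphic_on_subset[of g "cball z r" "ball z r"]
      by (auto simp: continuous_on_eq_continuous_at)
    then have "((\<lambda>w. norm (g w)) \<longlongrightarrow> norm (g z)) (at z)" by (intro tendsto_norm) (simp add: isCont_def)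
    then have "\<forall>\<^sub>F w in at z. norm (g w) < norm (g z) + 1" by (rule order_tendstoD) simp
    moreover have "\<forall>\<^sub>F w in at z. w \<in> ball z r - {z}"
      using r(1) by (intro eventually_at_in_open) auto
    ultimately have "\<forall>\<^sub>F w in at z. norm ((w - z) ^ nat (- n) * f w) \<le> norm (g z) + 1"
    proof eventually_elim
      case (elim w)
      then have "f w = g w / (w - z) ^ nat (- n)" using r(3) by auto
      then show ?case using elim by simp
    qed
    then show ?thesis by (rule that)
  qed
qed

text \<open>Induction on the order of the pole at infinity. Since T q tends to 1, a multiple of a
  power of \<open>T\<close> cancels the leading term and lowers the order by one.\<close>

lemma subtract_polynomial:
  fixes F T :: "complex \<Rightarrow> complex"
  assumes F: "F holomorphic_on {\<tau>. Im \<tau> > 0}" "\<And>\<tau>. Im \<tau> > 0 \<Longrightarrow> F (\<tau> + 1) = F \<tau>"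
    and T: "T holomorphic_on {\<tau>. Im \<tau> > 0}" "\<And>\<tau>. Im \<tau> > 0 \<Longrightarrow> T (\<tau> + 1) = T \<tau>"
    and T_lim: "((\<lambda>\<tau>. T \<tau> * qexp \<tau>) \<longlongrightarrow> 1) at_i_infinity"
    and growth: "\<And>\<tau>. Im \<tau> > 0 \<Longrightarrow> Im \<tau> > Y \<Longrightarrow> norm (F \<tau> * qexp \<tau> ^ \<kappa>) \<le> B"
  shows "\<exists>P B Y. \<forall>\<tau>. Im \<tau> > 0 \<longrightarrow> Im \<tau> > Y \<longrightarrow> norm (F \<tau> - poly P (T \<tau>)) \<le> B"
  using F growth
proof (induction \<kappa> arbitrary: F B Y)
  case 0
  then show ?case by (intro exI[of _ 0] exI[of _ B] exI[of _ Y]) auto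
next
  case (Suc \<kappa>)
  have per: "qexp (\<tau> + 1) = qexp \<tau>" for \<tau> by (simp add: qexp_add)
  obtain h where h: "h holomorphic_on ball 0 1" "\<And>\<tau>. Im \<tau> > 0 \<Longrightarrow> F \<tau> * qexp \<tau> ^ Suc \<kappa> = h (qexp (\<tau> / of_nat 1))"
    by (rule fourier_expansion[of 1 "\<lambda>\<tau>. F \<tau> * qexp \<tau> ^ Suc \<kappa>" Y B])
       (use Suc.prems per in \<open>auto intro!: holomorphic_intros\<close>)
  have "\<forall>\<^sub>F \<tau> in at_i_infinity. norm (T \<tau> * qexp \<tau>) < 2"
    using tendsto_norm[OF T_lim] by (rule order_tendstoD) simp
  then obtain Y1 where Y1: "\<And>\<tau>. Im \<tau> > Y1 \<Longrightarrow> norm (T \<tau> * qexp \<tau>) < 2"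
    by (auto simp: eventually_at_i_infinity)
  obtain u where u: "u holomorphic_on ball 0 1" "\<And>\<tau>. Im \<tau> > 0 \<Longrightarrow> T \<tau> * qexp \<tau> = u (qexp (\<tau> / of_nat 1))"
    by (rule fourier_expansion[of 1 "\<lambda>\<tau>. T \<tau> * qexp \<tau>" Y1 2])
       (use T per Y1 in \<open>auto intro!: holomorphic_intros less_imp_le\<close>)
  have "u 0 = 1"
  proof (rule tendsto_unique[OF at_i_infinity_neq_bot])
    have "isCont u 0" using holomorphic_on_imp_continuous_on[OF u(1)] by (simp add: continuous_on_eq_continuous_at)
    then have "((\<lambda>\<tau>. u (qexp \<tau>)) \<longlongrightarrow> u 0) at_i_infinity"
      using isCont_tendsto_compose tendsto_qexp_0 by blast
    moreover have "\<forall>\<^sub>F \<tau> in at_i_infinity. u (qexp \<tau>) = T \<tau> * qexp \<tau>"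
      using eventually_Im_gt_at_i_infinity[of 0] by eventually_elim (use u(2) in simp)
    ultimately show "((\<lambda>\<tau>. T \<tau> * qexp \<tau>) \<longlongrightarrow> u 0) at_i_infinity"
      by (rule Lim_transform_eventually)
  qed (rule T_lim)
  define c where "c = h 0"
  \<comment> \<open>The numerator left after cancelling the leading term. It vanishes at 0 because
    u(0) = 1, and a Lipschitz bound there gains the power of \<open>qexp \<tau>\<close> that the
    induction needs.\<close>
  define v where "v = (\<lambda>w. h w - c * u w ^ Suc \<kappa>)"
  have v: "v holomorphic_on ball 0 1" unfolding v_def by (intro holomorphic_intros h u)
  have v0: "v 0 = 0" by (simp add: v_def c_def \<open>u 0 = 1\<close>)
  obtain C e where e: "C > 0" "e > 0" "\<And>w. norm (w - 0) < e \<Longrightarrow> norm (v w - v 0) \<le> C * norm (w - 0)"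
    using holomorphic_Lipschitz_at[OF v] by (metis zero_less_one)
  have "\<forall>\<^sub>F \<tau> in at_i_infinity. norm (qexp \<tau>) < e"
    using tendsto_norm[OF tendsto_qexp_0] e(2) by (intro order_tendstoD) auto
  then obtain Y2 where Y2: "\<And>\<tau>. Im \<tau> > Y2 \<Longrightarrow> norm (qexp \<tau>) < e" by (auto simp: eventually_at_i_infinity)
  have "\<exists>P B Y. \<forall>\<tau>. Im \<tau> > 0 \<longrightarrow> Im \<tau> > Y \<longrightarrow> norm ((F \<tau> - c * T \<tau> ^ Suc \<kappa>) - poly P (T \<tau>)) \<le> B"
  proof (rule Suc.IH)
    fix \<tau> assume \<tau>: "Im \<tau> > 0" "Im \<tau> > Y2"
    have "(F \<tau> - c * T \<tau> ^ Suc \<kappa>) * qexp \<tau> ^ Suc \<kappa> = F \<tau> * qexp \<tau> ^ Suc \<kappa> - c * (T \<tau> * qexp \<tau>) ^ Suc \<kappa>"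
      by (simp only: power_mult_distrib algebra_simps)
    also have "\<dots> = v (qexp \<tau>)" using h(2) u(2) \<tau> by (simp add: v_def)
    finally have "(F \<tau> - c * T \<tau> ^ Suc \<kappa>) * qexp \<tau> ^ \<kappa> * qexp \<tau> = v (qexp \<tau>)" by (simp add: mult_ac)
    then have "norm ((F \<tau> - c * T \<tau> ^ Suc \<kappa>) * qexp \<tau> ^ \<kappa>) * norm (qexp \<tau>) \<le> C * norm (qexp \<tau>)"
      using e(3)[of "qexp \<tau>"] Y2[OF \<tau>(2)] v0 by (simp add: norm_mult[symmetric])
    then show "norm ((F \<tau> - c * T \<tau> ^ Suc \<kappa>) * qexp \<tau> ^ \<kappa>) \<le> C"
      by (rule mult_right_le_imp_le) simp
  qed (use Suc.prems T in \<open>auto intro!: holomorphic_intros\<close>)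
  then obtain P B Y where P: "\<And>\<tau>. Im \<tau> > 0 \<Longrightarrow> Im \<tau> > Y \<Longrightarrow> norm ((F \<tau> - c * T \<tau> ^ Suc \<kappa>) - poly P (T \<tau>)) \<le> B"
    by blast
  have "norm (F \<tau> - poly (monom c (Suc \<kappa>) + P) (T \<tau>)) \<le> B" if "Im \<tau> > 0" "Im \<tau> > Y" for \<tau>
    using P[OF that] by (simp add: poly_monom algebra_simps)
  then show ?case by blast
qed

section \<open>A Liouville theorem for congruence subgroups\<close>

text \<open>Invariance under Gamma(m). Because this group is normal in SL2(Z), f(\<sigma>\<tau>)
  inherits the period m for every \<sigma>, and depends on \<sigma> modulo m only.\<close>

definition level_invariant :: "nat \<Rightarrow> (complex \<Rightarrow> 'a) \<Rightarrow> bool" where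
  "level_invariant m f \<longleftrightarrow> (\<forall>a b c d \<tau>. a * d - b * c = 1 \<and> int m dvd a - 1 \<and> int m dvd b \<and>
     int m dvd c \<and> int m dvd d - 1 \<and> Im \<tau> > 0 \<longrightarrow> f (mob a b c d \<tau>) = f \<tau>)"

lemma level_invariant_cong:
  assumes inv: "level_invariant m f"
    and det: "a * d - b * c = 1" "a' * d' - b' * c' = 1"
    and cong: "int m dvd a - a'" "int m dvd b - b'" "int m dvd c - c'" "int m dvd d - d'"
    and \<tau>: "Im \<tau> > 0"
  shows "f (mob a b c d \<tau>) = f (mob a' b' c' d' \<tau>)"
proof -
  have nz: "of_int c' * \<tau> + of_int d' \<noteq> (0 :: complex)"
    using mob_denominator_nonzero[OF \<tau>, of c' d'] det(2) by fastforce
  \<comment> \<open>The first matrix times the inverse of the second one; it is congruent to the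
    identity modulo m.\<close>
  define A B C D where "A = a * d' - b * c'" and "B = b * a' - a * b'" and "C = c * d' - d * c'" and "D = d * a' - c * b'"
  have "A * a' + B * c' = a * (a' * d' - b' * c')" "A * b' + B * d' = b * (a' * d' - b' * c')"
    "C * a' + D * c' = c * (a' * d' - b' * c')" "C * b' + D * d' = d * (a' * d' - b' * c')"
    by (simp_all add: A_def B_def C_def D_def algebra_simps)
  then have "mob a b c d \<tau> = mob A B C D (mob a' b' c' d' \<tau>)"
    unfolding mob_mob[OF nz] by (simp add: det(2))
  moreover have "f (mob A B C D (mob a' b' c' d' \<tau>)) = f (mob a' b' c' d' \<tau>)"
  proof -
    have "A * D - B * C = (a * d - b * c) * (a' * d' - b' * c')"
      by (simp add: A_def B_def C_def D_def algebra_simps)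
    then have "A * D - B * C = 1" by (simp add: det)
    moreover have "A - 1 = (a - a') * d' - (b - b') * c'" "D - 1 = (d - d') * a' - (c - c') * b'"
        "B = (b - b') * a' - (a - a') * b'" "C = (c - c') * d' - (d - d') * c'"
      using det(2) by (simp_all add: A_def B_def C_def D_def algebra_simps)
    then have "int m dvd A - 1" "int m dvd D - 1" "int m dvd B" "int m dvd C"
      using cong by (simp_all add: dvd_diff)
    moreover have "Im (mob a' b' c' d' \<tau>) > 0" using det(2) \<tau> by (intro Im_mob_pos) auto
    ultimately show ?thesis using inv unfolding level_invariant_def by blast
  qed
  ultimately show ?thesis by simp
qed

lemma level_invariant_period:
  assumes inv: "level_invariant m f" and det: "a * d - b * c = 1" and \<tau>: "Im \<tau> > 0"
  shows "f (mob a b c d (\<tau> + of_nat m)) = f (mob a b c d \<tau>)"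
proof -
  have "f (mob a (a * int m + b) c (c * int m + d) \<tau>) = f (mob a b c d \<tau>)"
    by (rule level_invariant_cong[OF inv _ det _ _ _ _ \<tau>]) (use det in \<open>auto simp: algebra_simps\<close>)
  then show ?thesis using mob_translate[of a b c d \<tau> "int m"] by simp
qed

text \<open>One preimage is chosen in every nonempty fibre of the reduction modulo m restricted to
  SL2(Z), so the representatives have integral determinant 1.\<close>

lemma coset_representatives:
  assumes m: "m > 0"
  obtains R :: "(int \<times> int \<times> int \<times> int) set" where "finite R" "\<And>a b c d. (a, b, c, d) \<in> R \<Longrightarrow> a * d - b * c = 1"
    "\<And>a b c d. a * d - b * c = 1 \<Longrightarrow> \<exists>(a', b', c', d')\<in>R. int m dvd a - a' \<and> int m dvd b - b' \<and> int m dvd c - c' \<and> int m dvd d - d'"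
proof -
  define S where "S = {(a, b, c, d). a * d - b * c = (1 :: int)}"
  define red where "red = (\<lambda>(a, b, c, d). (a mod int m, b mod int m, c mod int m, d mod int m))"
  define R where "R = inv_into S red ` (red ` S)"
  show ?thesis
    proof (rule that)
      have "red ` S \<subseteq> {0..<int m} \<times> {0..<int m} \<times> {0..<int m} \<times> {0..<int m}"
        using m by (auto simp: red_def)
      then have "finite (red ` S)" by (rule finite_subset) (intro finite_cartesian_product; simp)
      then show "finite R" unfolding R_def by (rule finite_imageI)
      have RS: "R \<subseteq> S" unfolding R_def using inv_into_into[of _ red S] by blast
      then show "a * d - b * c = 1" if "(a, b, c, d) \<in> R" for a b c d using that by (auto simp: S_def)
      fix a b c d :: int assume "a * d - b * c = 1"
      then have x: "(a, b, c, d) \<in> S" by (simp add: S_def)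
      obtain a' b' c' d' where y: "inv_into S red (red (a, b, c, d)) = (a', b', c', d')" by (metis prod_cases4)
      have "(a', b', c', d') \<in> R" unfolding R_def y[symmetric] using x by blast
      moreover have "red (a', b', c', d') = red (a, b, c, d)"
        unfolding y[symmetric] using x by (intro f_inv_into_f) auto
      then have "int m dvd a - a' \<and> int m dvd b - b' \<and> int m dvd c - c' \<and> int m dvd d - d'"
        by (auto simp: red_def mod_eq_dvd_iff dvd_diff_commute)
      ultimately show "\<exists>(a', b', c', d')\<in>R. int m dvd a - a' \<and> int m dvd b - b' \<and> int m dvd c - c' \<and> int m dvd d - d'"
        by blast
    qed
qed

lemma holomorphic_on_mob:
  assumes "F holomorphic_on {\<tau>. Im \<tau> > 0}" "a * d - b * c = 1"
  shows "(\<lambda>\<tau>. F (mob a b c d \<tau>)) holomorphic_on {\<tau>. Im \<tau> > 0}"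
proof -
  have "c \<noteq> 0 \<or> d \<noteq> 0" using assms(2) by auto
  then have "(\<lambda>\<tau>. mob a b c d \<tau>) holomorphic_on {\<tau>. Im \<tau> > 0}"
    unfolding mob_def by (intro holomorphic_intros) (simp add: mob_denominator_nonzero)
  moreover have "(\<lambda>\<tau>. mob a b c d \<tau>) ` {\<tau>. Im \<tau> > 0} \<subseteq> {\<tau>. Im \<tau> > 0}"
    using Im_mob_pos assms(2) by auto
  ultimately show ?thesis using holomorphic_on_compose_gen[OF _ assms(1)] by (auto simp: o_def)
qed

text \<open>All values of \<open>F\<close> are already taken in the half-strips of
  \<open>reduction\<close>, which the local parameters send into closed discs of radius less than 1.
  Adding the centres, the cusps, makes the set of values compact, so that |F| has a maximum.\<close>

theorem modular_Liouville:
  fixes F :: "complex \<Rightarrow> complex"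
  assumes m: "m > 0" and hol: "F holomorphic_on {\<tau>. Im \<tau> > 0}" and inv: "level_invariant m F"
    and cusps: "\<And>a b c d. a * d - b * c = 1 \<Longrightarrow>
      \<exists>B Y. \<forall>\<tau>. Im \<tau> > 0 \<longrightarrow> Im \<tau> > Y \<longrightarrow> norm (F (mob a b c d \<tau>)) \<le> B"
  obtains c where "\<And>\<tau>. Im \<tau> > 0 \<Longrightarrow> F \<tau> = c"
proof -
  obtain R where R: "finite R" "\<And>a b c d. (a, b, c, d) \<in> R \<Longrightarrow> a * d - b * c = 1"
    "\<And>a b c d. a * d - b * c = 1 \<Longrightarrow> \<exists>(a', b', c', d')\<in>R. int m dvd a - a' \<and> int m dvd b - b' \<and> int m dvd c - c' \<and> int m dvd d - d'"
    by (rule coset_representatives[OF m]) auto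
  have "\<exists>h. h holomorphic_on ball 0 1 \<and> (\<forall>\<tau>. Im \<tau> > 0 \<longrightarrow> F (mob a b c d \<tau>) = h (qexp (\<tau> / of_nat m)))"
    if "(a, b, c, d) \<in> R" for a b c d
  proof -
    have det: "a * d - b * c = 1" using R(2) that by blast
    obtain B Y where BY: "\<And>\<tau>. Im \<tau> > 0 \<Longrightarrow> Im \<tau> > Y \<Longrightarrow> norm (F (mob a b c d \<tau>)) \<le> B"
      using cusps[OF det] by blast
    show ?thesis
      using fourier_expansion[OF m holomorphic_on_mob[OF hol det] level_invariant_period[OF inv det] BY]
      by (metis (no_types, lifting))
  qed
  then have "\<forall>\<sigma>\<in>R. \<exists>h. h holomorphic_on ball 0 1 \<and>
      (\<forall>\<tau>. Im \<tau> > 0 \<longrightarrow> F ((case \<sigma> of (a, b, c, d) \<Rightarrow> mob a b c d) \<tau>) = h (qexp (\<tau> / of_nat m)))"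
    by auto
  then obtain h where h: "\<And>\<sigma>. \<sigma> \<in> R \<Longrightarrow> h \<sigma> holomorphic_on ball 0 1"
      "\<And>a b c d \<tau>. (a, b, c, d) \<in> R \<Longrightarrow> Im \<tau> > 0 \<Longrightarrow> F (mob a b c d \<tau>) = h (a, b, c, d) (qexp (\<tau> / of_nat m))"
    by (subst (asm) bchoice_iff) fastforce
  \<comment> \<open>The absolute value of \<open>qexp (z / m)\<close> for Im z = 1/2, the lower edge
    of the half-strip.\<close>
  define r where "r = exp (- (pi / m))"
  have r: "r < 1" using m by (simp add: r_def)
  define V where "V = (\<Union>\<sigma>\<in>R. h \<sigma> ` cball 0 r)"
  have "compact V"
    unfolding V_def
  proof (intro compact_UN R(1) compact_continuous_image)
    fix \<sigma> assume "\<sigma> \<in> R"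
    then have "continuous_on (ball 0 1) (h \<sigma>)" using h(1) holomorphic_on_imp_continuous_on by blast
    then show "continuous_on (cball 0 r) (h \<sigma>)" by (rule continuous_on_subset) (use r in auto)
  qed auto
  have FV: "F \<tau> \<in> V" if \<tau>: "Im \<tau> > 0" for \<tau>
  proof -
    obtain a b c d z where z: "a * d - b * c = 1" "Im z \<ge> 1 / 2" "\<tau> = mob a b c d z"
      using reduction[OF \<tau>] by blast
    obtain a' b' c' d' where R': "(a', b', c', d') \<in> R"
        "int m dvd a - a'" "int m dvd b - b'" "int m dvd c - c'" "int m dvd d - d'"
      using R(3)[OF z(1)] by blast
    have z0: "Im z > 0" using z by simp
    have "F \<tau> = F (mob a' b' c' d' z)"
      unfolding z(3) using R' z0 by (intro level_invariant_cong[OF inv z(1) R(2)]) auto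
    also have "\<dots> = h (a', b', c', d') (qexp (z / of_nat m))" using h(2)[OF R'(1) z0] .
    also have "\<dots> \<in> V"
    proof -
      have "norm (qexp (z / of_nat m)) \<le> r"
        unfolding norm_qexp_divide r_def using z(2) m mult_left_mono[OF z(2), of "2 * pi"] by (simp add: divide_right_mono)
      then show ?thesis unfolding V_def by (intro UN_I[OF R'(1)] imageI) simp
    qed
    finally show ?thesis .
  qed
  have "F \<i> \<in> V" by (rule FV) simp
  then have "V \<noteq> {}" by blast
  then obtain v where v: "v \<in> V" "\<And>u. u \<in> V \<Longrightarrow> norm u \<le> norm v"
    using continuous_attains_sup[OF \<open>compact V\<close> _ continuous_on_norm[OF continuous_on_id]] by auto
  then obtain a b c d w where w: "(a, b, c, d) \<in> R" "norm w \<le> r" "v = h (a, b, c, d) w"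
    by (auto simp: V_def)
  define h0 where "h0 = h (a, b, c, d)"
  have det: "a * d - b * c = 1" using R(2) w(1) by blast
  \<comment> \<open>The maximum may be attained at a cusp, w = 0, so the principle is applied to the
    expansion \<open>h0\<close> on the disc and not to \<open>F\<close>.\<close>
  have "h0 constant_on ball 0 1"
  proof (rule maximum_modulus_principle[where U = "ball 0 1" and \<xi> = w])
    fix u :: complex assume u: "u \<in> ball 0 1"
    have "h0 u \<in> V"
    proof (cases "u = 0")
      case True
      then show ?thesis unfolding V_def h0_def using w(1) by (auto simp: r_def intro!: bexI[of _ "(a, b, c, d)"])
    next
      case False
      define \<tau> where "\<tau> = of_nat m * (Ln u / (2 * of_real pi * \<i>))"
      have "qexp (\<tau> / of_nat m) = u" unfolding \<tau>_def by (rule qexp_Ln[OF m False])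
      moreover have "Im \<tau> > 0" unfolding \<tau>_def using u by (intro qexp_Ln[OF m False]) simp
      ultimately have "h0 u = F (mob a b c d \<tau>)" using h(2)[OF w(1)] by (simp add: h0_def)
      then show ?thesis using FV Im_mob_pos[OF \<open>Im \<tau> > 0\<close>, of a d b c] det by simp
    qed
    then show "norm (h0 u) \<le> norm (h0 w)" using v(2) w(3) by (simp add: h0_def)
  qed (use h(1) w r in \<open>auto simp: h0_def\<close>)
  then obtain k where k: "\<And>u. u \<in> ball 0 1 \<Longrightarrow> h0 u = k" by (auto simp: constant_on_def)
  show ?thesis
  proof (rule that)
    fix \<tau> assume \<tau>: "Im \<tau> > 0"
    define z where "z = mob d (- b) (- c) a \<tau>"
    have z: "Im z > 0" unfolding z_def using det \<tau> by (intro Im_mob_pos) (auto simp: algebra_simps)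
    have "mob a b c d z = \<tau>" unfolding z_def by (rule mob_inverse[OF det \<tau>])
    then have "F \<tau> = h0 (qexp (z / of_nat m))" using h(2)[OF w(1) z] by (simp add: h0_def)
    moreover have "norm (qexp (z / of_nat m)) < 1" using z m by (intro norm_qexp_less_1) simp
    ultimately show "F \<tau> = k" using k by simp
  qed
qed

section \<open>A criterion for principal moduli\<close>

lemma mob_eq_moebius:
  "mob a b c d = moebius (mat2 (of_int a) (of_int b) (of_int c) (of_int d))"
  by (simp add: mob_def moebius_def mat2_def fun_eq_iff)

definition det2 :: "real^2^2 \<Rightarrow> real" where
  "det2 M = M$1$1 * M$2$2 - M$1$2 * M$2$1"

lemma det2_mat2: "det2 (mat2 a b c d) = a * d - b * c"
  by (simp add: det2_def mat2_def)

lemma moebius_denominator_nonzero: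
  fixes M :: "real^2^2"
  assumes "det2 M > 0" "Im \<tau> > 0"
  shows "of_real (M$2$1) * \<tau> + of_real (M$2$2) \<noteq> 0"
proof
  assume *: "of_real (M$2$1) * \<tau> + of_real (M$2$2) = 0"
  then have "Im (of_real (M$2$1) * \<tau> + of_real (M$2$2)) = 0" by simp
  then have "M$2$1 = 0" using assms by simp
  moreover from this have "M$2$2 = 0" using * by simp
  ultimately show False using assms by (simp add: det2_def)
qed

lemma Im_moebius_pos:
  assumes "det2 M > 0" "Im \<tau> > 0"
  shows "Im (moebius M \<tau>) > 0"
proof -
  have "Im (moebius M \<tau>) = det2 M * Im \<tau> / (norm (of_real (M$2$1) * \<tau> + of_real (M$2$2)))\<^sup>2"
    unfolding moebius_def Im_divide cmod_power2 det2_def by (simp add: algebra_simps)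
  then show ?thesis using moebius_denominator_nonzero[OF assms] assms by simp
qed

lemma holomorphic_moebius:
  assumes "det2 M > 0"
  shows "moebius M holomorphic_on {\<tau>. Im \<tau> > 0}"
  unfolding moebius_def[abs_def]
  by (intro holomorphic_intros) (simp add: moebius_denominator_nonzero[OF assms])

lemma inj_on_moebius:
  assumes "det2 M > 0"
  shows "inj_on (moebius M) {\<tau>. Im \<tau> > 0}"
proof (rule inj_onI)
  fix z w assume H: "z \<in> {\<tau>. Im \<tau> > 0}" "w \<in> {\<tau>. Im \<tau> > 0}" and eq: "moebius M z = moebius M w"
  define A B C D where "A = complex_of_real (M$1$1)" and "B = complex_of_real (M$1$2)"
    and "C = complex_of_real (M$2$1)" and "D = complex_of_real (M$2$2)"
  have nz: "C * z + D \<noteq> 0" "C * w + D \<noteq> 0"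
    using moebius_denominator_nonzero[OF assms] H by (simp_all add: C_def D_def)
  have "(A * z + B) / (C * z + D) = (A * w + B) / (C * w + D)"
    using eq unfolding moebius_def A_def B_def C_def D_def .
  then have "(A * z + B) * (C * w + D) = (A * w + B) * (C * z + D)"
    using frac_eq_eq[OF nz] by blast
  then have "(A * D - B * C) * (z - w) = 0"
    by (simp add: algebra_simps)
  moreover have "A * D - B * C = of_real (det2 M)"
    by (simp add: det2_def A_def B_def C_def D_def)
  ultimately have "of_real (det2 M) * (z - w) = 0" by simp
  then show "z = w" using assms by simp
qed

lemma eventually_at_upper_half_plane:
  "Im \<tau> > 0 \<Longrightarrow> \<forall>\<^sub>F z in at \<tau>. Im z > 0"
  using eventually_at_in_open'[OF open_upper_half_plane, of \<tau>] by simp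

lemma eventually_at_Im_gt: "Im \<tau> > Y \<Longrightarrow> \<forall>\<^sub>F z in at \<tau>. Im z > Y"
  using eventually_at_in_open'[of "{z. Im z > Y}" \<tau>] by (simp add: open_halfspace_Im_gt)

lemma filterlim_moebius_at:
  assumes "det2 M > 0" "Im \<tau> > 0"
  shows "filterlim (moebius M) (at (moebius M \<tau>)) (at \<tau>)"
  unfolding filterlim_at
proof
  show "\<forall>\<^sub>F z in at \<tau>. moebius M z \<in> UNIV \<and> moebius M z \<noteq> moebius M \<tau>"
    using eventually_at_upper_half_plane[OF assms(2)] eventually_neq_at_within[of \<tau>]
    by eventually_elim (use inj_on_moebius[OF assms(1)] assms(2) in \<open>auto simp: inj_on_def\<close>)
  show "moebius M \<midarrow>\<tau>\<rightarrow> moebius M \<tau>"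
    using holomorphic_on_imp_continuous_on[OF holomorphic_moebius[OF assms(1)]] assms(2)
      open_upper_half_plane by (simp add: continuous_on_eq_continuous_at isCont_def)
qed

lemma filterlim_mob_at:
  assumes "a * d - b * c = 1" "Im \<tau> > 0"
  shows "filterlim (mob a b c d) (at (mob a b c d \<tau>)) (at \<tau>)"
proof -
  have "real_of_int a * real_of_int d - real_of_int b * real_of_int c = 1"
    unfolding of_int_mult[symmetric] of_int_diff[symmetric] assms(1) by simp
  then show ?thesis unfolding mob_eq_moebius
    by (intro filterlim_moebius_at assms) (simp add: det2_mat2)
qed

text \<open>The value at the point itself is ignored: elements of the function field are 0 at their
  poles by convention, so that this value carries no information.\<close>

definition loc_bounded :: "(complex \<Rightarrow> complex) \<Rightarrow> complex \<Rightarrow> bool" where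
  "loc_bounded f z \<longleftrightarrow> (\<exists>B. \<forall>\<^sub>F w in at z. norm (f w) \<le> B)"

lemma loc_bounded_mult:
  assumes "loc_bounded f z" "loc_bounded g z"
  shows "loc_bounded (\<lambda>w. f w * g w) z"
proof -
  obtain A where "\<forall>\<^sub>F w in at z. norm (f w) \<le> A"
    using assms(1) unfolding loc_bounded_def by blast
  moreover obtain B where "\<forall>\<^sub>F w in at z. norm (g w) \<le> B"
    using assms(2) unfolding loc_bounded_def by blast
  ultimately have "\<forall>\<^sub>F w in at z. norm (f w * g w) \<le> \<bar>A\<bar> * \<bar>B\<bar>"
    by eventually_elim (auto simp: norm_mult intro!: mult_mono)
  then show ?thesis by (auto simp: loc_bounded_def)
qed

lemma loc_bounded_isCont:
  assumes "isCont f z"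
  shows "loc_bounded f z"
proof -
  have "((\<lambda>w. norm (f w)) \<longlongrightarrow> norm (f z)) (at z)" using assms by (intro tendsto_norm) (simp add: isCont_def)
  then have "\<forall>\<^sub>F w in at z. norm (f w) < norm (f z) + 1" by (rule order_tendstoD) simp
  then have "\<forall>\<^sub>F w in at z. norm (f w) \<le> norm (f z) + 1" by eventually_elim simp
  then show ?thesis by (auto simp: loc_bounded_def)
qed

lemma remove_sings_loc_bounded:
  assumes "g meromorphic_on {z}" "loc_bounded g z"
  shows "remove_sings g analytic_on {z}" "\<forall>\<^sub>F w in at z. remove_sings g w = g w"
proof -
  have iso: "isolated_singularity_at g z" and "not_essential g z"
    using assms(1) by (simp_all add: meromorphic_at_iff)
  then show "\<forall>\<^sub>F w in at z. remove_sings g w = g w" by (intro eventually_remove_sings_eq_at)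
  have "\<not> is_pole g z"
  proof
    assume "is_pole g z"
    then have "filterlim (\<lambda>w. norm (g w)) at_top (at z)"
      unfolding is_pole_def using filterlim_at_infinity_imp_norm_at_top by blast
    moreover obtain B where "\<forall>\<^sub>F w in at z. norm (g w) \<le> B" using assms(2) by (auto simp: loc_bounded_def)
    ultimately have "\<forall>\<^sub>F w in at z. norm (g w) \<le> B \<and> B + 1 \<le> norm (g w)"
      by (intro eventually_conj) (auto simp: filterlim_at_top)
    then have "\<forall>\<^sub>F w in at z. False" by eventually_elim auto
    then show False by simp
  qed
  then obtain c where "g \<midarrow>z\<rightarrow> c" using \<open>not_essential g z\<close> by (auto simp: not_essential_def)
  then show "remove_sings g analytic_on {z}" using iso remove_sings_analytic_at by blast
qed

lemma isCont_norm_bound: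
  fixes F :: "complex \<Rightarrow> complex"
  assumes "isCont F z" "\<forall>\<^sub>F w in at z. norm (F w) \<le> B"
  shows "norm (F z) \<le> B"
  using assms Lim_norm_ubound[of "at z" F "F z" B] by (simp add: isCont_def)

text \<open>The local parameter exp(2 pi i \<tau>/N) comes with an unknown N. Estimating 1/N by 1
  gives a bound in which N does not occur any more, only an exponent \<open>k\<close>.\<close>

lemma cusp_growth:
  assumes "meromorphic_at_cusp f (mat2 (of_int a) (of_int b) (of_int c) (of_int d))"
  obtains k :: nat and B Y where "Y > 0" "B > 0"
    "\<And>\<tau>. Im \<tau> > Y \<Longrightarrow> norm (f (mob a b c d \<tau>)) \<le> B * exp (2 * pi * k * Im \<tau>)"
proof -
  obtain N :: nat and g Y where N: "N > 0" "g meromorphic_on {0}"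
    "\<And>\<tau>. Im \<tau> > 0 \<Longrightarrow> Im \<tau> > Y \<Longrightarrow> f (mob a b c d \<tau>) = g (qexp (\<tau> / of_nat N))"
    using assms unfolding meromorphic_at_cusp_def mob_eq_moebius by blast
  obtain k B where kB: "\<forall>\<^sub>F w in at 0. norm ((w - 0) ^ k * g w) \<le> B"
    using meromorphic_pole_growth[OF N(2)] by blast
  have "\<forall>\<^sub>F \<tau> in at_i_infinity. norm ((qexp (\<tau> / of_nat N) - 0) ^ k * g (qexp (\<tau> / of_nat N))) \<le> B"
    by (rule eventually_compose_filterlim[OF kB filterlim_qexp_divide[OF N(1)]])
  then obtain Y' where Y': "\<And>\<tau>. Im \<tau> > Y' \<Longrightarrow> norm (qexp (\<tau> / of_nat N) ^ k * g (qexp (\<tau> / of_nat N))) \<le> B"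
    by (auto simp: eventually_at_i_infinity)
  show ?thesis
  proof (rule that)
    show "max 1 (max Y Y') > 0" "max 1 B > 0" by auto
    fix \<tau> assume "Im \<tau> > max 1 (max Y Y')"
    then have \<tau>: "Im \<tau> > 0" "Im \<tau> > Y" "Im \<tau> > Y'" by auto
    have "exp (- (2 * pi * Im \<tau> / N)) ^ k * norm (f (mob a b c d \<tau>)) \<le> max 1 B"
      using Y'[OF \<tau>(3)] N(3)[OF \<tau>(1,2)] by (simp add: norm_mult norm_power norm_qexp_divide)
    then have "exp (- (k * (2 * pi * Im \<tau> / N))) * norm (f (mob a b c d \<tau>)) \<le> max 1 B"
      by (simp add: exp_of_nat_mult[symmetric])
    then have "norm (f (mob a b c d \<tau>)) \<le> max 1 B * exp (k * (2 * pi * Im \<tau> / N))"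
      by (simp add: exp_minus field_simps)
    also have "\<dots> \<le> max 1 B * exp (2 * pi * k * Im \<tau>)"
    proof -
      have "2 * pi * Im \<tau> / N \<le> 2 * pi * Im \<tau> / 1"
        using N(1) \<tau>(1) by (intro divide_left_mono) auto
      then have "k * (2 * pi * Im \<tau> / N) \<le> k * (2 * pi * Im \<tau>)" by (intro mult_left_mono) auto
      then show ?thesis by (intro mult_left_mono) (auto simp: mult_ac)
    qed
    finally show "norm (f (mob a b c d \<tau>)) \<le> max 1 B * exp (2 * pi * k * Im \<tau>)" .
  qed
qed

lemma poly_q_growth:
  fixes p :: "complex poly"
  assumes "norm (x * q) \<le> 2" "norm q \<le> 1"
  shows "norm (poly p x * q ^ degree p) \<le> (\<Sum>i\<le>degree p. norm (coeff p i) * 2 ^ i)"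
proof -
  have "poly p x * q ^ degree p = (\<Sum>i\<le>degree p. coeff p i * (x * q) ^ i * q ^ (degree p - i))"
    unfolding poly_altdef sum_distrib_right
    by (intro sum.cong) (auto simp: power_mult_distrib power_add[symmetric] mult_ac)
  also have "norm \<dots> \<le> (\<Sum>i\<le>degree p. norm (coeff p i) * 2 ^ i * 1)"
  proof (intro sum_norm_le)
    fix i assume "i \<in> {..degree p}"
    show "norm (coeff p i * (x * q) ^ i * q ^ (degree p - i)) \<le> norm (coeff p i) * 2 ^ i * 1"
      unfolding norm_mult norm_power
      by (intro mult_mono mult_left_mono) (use assms in \<open>auto intro!: power_mono power_le_one simp: norm_mult\<close>)
  qed
  finally show ?thesis by simp
qed

text \<open>p(x) is x to the degree times the reversed polynomial at 1/x, and the latter tends to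
  the leading coefficient; so the quotient is eventually within a factor 2 of it.\<close>

lemma poly_growth:
  fixes p :: "complex poly"
  assumes "p \<noteq> 0"
  obtains X where "X \<ge> 1" "\<And>x. norm x \<ge> X \<Longrightarrow>
     norm (lead_coeff p) / 2 * norm x ^ degree p \<le> norm (poly p x) \<and> norm (poly p x) \<le> 2 * norm (lead_coeff p) * norm x ^ degree p"
proof -
  define L where "L = norm (lead_coeff p)"
  have L: "L > 0" using assms by (simp add: L_def)
  have "((\<lambda>x. poly (reflect_poly p) (inverse x)) \<longlongrightarrow> poly (reflect_poly p) 0) at_infinity"
    using isCont_tendsto_compose[OF _ tendsto_inverse_0] by (intro isCont_tendsto_compose[OF _ tendsto_inverse_0]) simp
  then have "((\<lambda>x. norm (poly (reflect_poly p) (inverse x))) \<longlongrightarrow> L) at_infinity"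
    using tendsto_norm by (fastforce simp: L_def)
  then have "\<forall>\<^sub>F x in at_infinity. norm (poly (reflect_poly p) (inverse x)) > L / 2 \<and> norm (poly (reflect_poly p) (inverse x)) < 2 * L"
    using L by (intro eventually_conj order_tendstoD) auto
  then obtain X where X: "\<And>x. norm x \<ge> X \<Longrightarrow> norm (poly (reflect_poly p) (inverse x)) > L / 2 \<and> norm (poly (reflect_poly p) (inverse x)) < 2 * L"
    by (auto simp: eventually_at_infinity)
  show ?thesis
  proof (rule that[of "max 1 X"])
    fix x :: complex assume x: "norm x \<ge> max 1 X"
    then have x0: "x \<noteq> 0" by auto
    have "poly p x = x ^ degree p * poly (reflect_poly p) (inverse x)"
      using poly_reflect_poly_nz[of "inverse x" p] x0 by (simp add: power_inverse field_simps)
    then have *: "norm (poly p x) = norm x ^ degree p * norm (poly (reflect_poly p) (inverse x))"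
      by (simp add: norm_mult norm_power)
    have b: "norm (poly (reflect_poly p) (inverse x)) > L / 2" "norm (poly (reflect_poly p) (inverse x)) < 2 * L"
      using X[of x] x by auto
    have "norm x ^ degree p * (L / 2) \<le> norm (poly p x)"
      unfolding * using b by (intro mult_left_mono) auto
    moreover have "norm (poly p x) \<le> norm x ^ degree p * (2 * L)"
      unfolding * using b by (intro mult_left_mono) auto
    ultimately show "norm (lead_coeff p) / 2 * norm x ^ degree p \<le> norm (poly p x) \<and>
        norm (poly p x) \<le> 2 * norm (lead_coeff p) * norm x ^ degree p"
      by (simp add: L_def mult_ac)
  qed auto
qed

text \<open>The assumption \<open>cusps\<close> says that \<open>T\<close> has poles only at cusps
  equivalent to infinity, \<open>T_exp\<close> that the pole is simple. The affine map occurs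
  because an element of SL2(Z) and one of \<open>G\<close> with the same value at infinity differ by
  an upper triangular matrix.\<close>

locale hauptmodul =
  fixes G :: "(real^2^2) set" and m :: nat and T :: "complex \<Rightarrow> complex" and \<kappa> :: complex
  assumes m: "m > 0"
    and G_pos: "\<And>M. M \<in> G \<Longrightarrow> det2 M > 0"
    and G_level: "\<And>a b c d. a * d - b * c = 1 \<Longrightarrow> int m dvd a - 1 \<Longrightarrow> int m dvd b \<Longrightarrow> int m dvd c \<Longrightarrow>
      int m dvd d - 1 \<Longrightarrow> mat2 (of_int a) (of_int b) (of_int c) (of_int d) \<in> G"
    and G_shift: "mat2 1 1 0 1 \<in> G"
    and T_hol: "T holomorphic_on {\<tau>. Im \<tau> > 0}"
    and T_nonzero: "\<And>\<tau>. Im \<tau> > 0 \<Longrightarrow> T \<tau> \<noteq> 0"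
    and T_inv: "\<And>M \<tau>. M \<in> G \<Longrightarrow> Im \<tau> > 0 \<Longrightarrow> T (moebius M \<tau>) = T \<tau>"
    and T_exp: "has_principal_expansion T \<kappa>"
    and cusps: "\<And>a b c d. a * d - b * c = 1 \<Longrightarrow>
      (\<exists>B Y. \<forall>\<tau>. Im \<tau> > 0 \<longrightarrow> Im \<tau> > Y \<longrightarrow> norm (T (mob a b c d \<tau>)) \<le> B) \<or>
      (\<exists>M \<alpha> \<beta>. M \<in> G \<and> \<alpha> > 0 \<and> (\<forall>\<tau>. Im \<tau> > 0 \<longrightarrow> mob a b c d \<tau> = moebius M (of_real \<alpha> * \<tau> + of_real \<beta>)))"
begin

definition cusp_bounded :: "(complex \<Rightarrow> complex) \<Rightarrow> int \<times> int \<times> int \<times> int \<Rightarrow> bool" where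
  "cusp_bounded f \<sigma> \<longleftrightarrow> (case \<sigma> of (a, b, c, d) \<Rightarrow>
     \<exists>B Y. \<forall>\<tau>. Im \<tau> > 0 \<longrightarrow> Im \<tau> > Y \<longrightarrow> norm (f (mob a b c d \<tau>)) \<le> B)"

lemma expansion_tendsto:
  assumes "has_principal_expansion f c"
  shows "((\<lambda>\<tau>. f \<tau> * qexp \<tau>) \<longlongrightarrow> 1) at_i_infinity"
    "((\<lambda>\<tau>. f \<tau> - (inverse (qexp \<tau>) + c)) \<longlongrightarrow> 0) at_i_infinity"
proof -
  define E where "E = (\<lambda>\<tau>. f \<tau> - (inverse (qexp \<tau>) + c))"
  obtain C where "\<forall>\<^sub>F \<tau> in at_i_infinity. norm (E \<tau>) \<le> C * norm (qexp \<tau>)"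
    using assms unfolding has_principal_expansion_def E_def by (auto elim: landau_o.bigE)
  moreover have "((\<lambda>\<tau>. C * norm (qexp \<tau>)) \<longlongrightarrow> C * norm (0 :: complex)) at_i_infinity"
    by (intro tendsto_intros tendsto_qexp_0)
  ultimately have E: "(E \<longlongrightarrow> 0) at_i_infinity"
    by (intro Lim_null_comparison[of E]) auto
  then show "((\<lambda>\<tau>. f \<tau> - (inverse (qexp \<tau>) + c)) \<longlongrightarrow> 0) at_i_infinity" by (simp add: E_def)
  have "((\<lambda>\<tau>. E \<tau> * qexp \<tau> + 1 + c * qexp \<tau>) \<longlongrightarrow> 0 * 0 + 1 + c * 0) at_i_infinity"
    by (intro tendsto_intros E tendsto_qexp_0)
  moreover have "(\<lambda>\<tau>. E \<tau> * qexp \<tau> + 1 + c * qexp \<tau>) = (\<lambda>\<tau>. f \<tau> * qexp \<tau>)"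
    by (simp add: E_def fun_eq_iff field_simps)
  ultimately show "((\<lambda>\<tau>. f \<tau> * qexp \<tau>) \<longlongrightarrow> 1) at_i_infinity" by simp
qed

lemma expansion_at_infinity:
  assumes "has_principal_expansion f c"
  shows "filterlim (\<lambda>\<tau>. norm (f \<tau>)) at_top at_i_infinity"
proof -
  have "((\<lambda>\<tau>. norm (f \<tau> * qexp \<tau>)) \<longlongrightarrow> norm (1::complex)) at_i_infinity"
    by (intro tendsto_norm expansion_tendsto[OF assms])
  moreover have "filterlim (\<lambda>\<tau>. norm (inverse (qexp \<tau>))) at_top at_i_infinity"
  proof -
    have "filterlim qexp (at 0) at_i_infinity"
      unfolding filterlim_at using tendsto_qexp_0 by simp
    then have "filterlim (\<lambda>\<tau>. inverse (qexp \<tau>)) at_infinity at_i_infinity"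
      using filterlim_compose[OF filterlim_inverse_at_infinity] by blast
    then show ?thesis by (rule filterlim_at_infinity_imp_norm_at_top)
  qed
  ultimately have "filterlim (\<lambda>\<tau>. norm (f \<tau> * qexp \<tau>) * norm (inverse (qexp \<tau>))) at_top at_i_infinity"
    by (intro filterlim_tendsto_pos_mult_at_top[where c = "norm (1::complex)"]) auto
  moreover have "norm (f \<tau> * qexp \<tau>) * norm (inverse (qexp \<tau>)) = norm (f \<tau>)" for \<tau>
    by (simp add: norm_mult[symmetric] mult.assoc)
  ultimately show ?thesis by simp
qed

lemma invariant_level:
  assumes "\<And>M \<tau>. M \<in> G \<Longrightarrow> Im \<tau> > 0 \<Longrightarrow> f (moebius M \<tau>) = f \<tau>"
  shows "level_invariant m f"
  unfolding level_invariant_def mob_eq_moebius using assms G_level by blast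

lemma invariant_shift:
  assumes "\<And>M \<tau>. M \<in> G \<Longrightarrow> Im \<tau> > 0 \<Longrightarrow> f (moebius M \<tau>) = f \<tau>" "Im \<tau> > 0"
  shows "f (\<tau> + 1) = f \<tau>"
  using assms(1)[OF G_shift assms(2)] by (simp add: moebius_def mat2_def)

lemma T_level: "level_invariant m T"
  using T_inv by (rule invariant_level)

lemma T_in_function_field: "T \<in> function_field G"
proof -
  have "meromorphic_at_cusp T (mat2 (of_int a) (of_int b) (of_int c) (of_int d))"
    if det: "a * d - b * c = 1" for a b c d
    using cusps[OF det]
  proof
    assume "\<exists>B Y. \<forall>\<tau>. Im \<tau> > 0 \<longrightarrow> Im \<tau> > Y \<longrightarrow> norm (T (mob a b c d \<tau>)) \<le> B"
    then obtain B Y where BY: "\<And>\<tau>. Im \<tau> > 0 \<Longrightarrow> Im \<tau> > Y \<Longrightarrow> norm (T (mob a b c d \<tau>)) \<le> B" by blast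
    obtain h where h: "h holomorphic_on ball 0 1" "\<And>\<tau>. Im \<tau> > 0 \<Longrightarrow> T (mob a b c d \<tau>) = h (qexp (\<tau> / of_nat m))"
      using fourier_expansion[OF m holomorphic_on_mob[OF T_hol det] level_invariant_period[OF T_level det] BY]
      by blast
    have "h meromorphic_on {0}"
      using h(1) by (intro analytic_on_imp_meromorphic_on holomorphic_on_imp_analytic_at[of _ "ball 0 1"]) auto
    then show ?thesis unfolding meromorphic_at_cusp_def mob_eq_moebius[symmetric] using m h(2) by blast
  next
    assume "\<exists>M \<alpha> \<beta>. M \<in> G \<and> \<alpha> > 0 \<and> (\<forall>\<tau>. Im \<tau> > 0 \<longrightarrow> mob a b c d \<tau> = moebius M (of_real \<alpha> * \<tau> + of_real \<beta>))"
    then obtain M \<alpha> \<beta> where M: "M \<in> G" "\<alpha> > 0"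
      "\<And>\<tau>. Im \<tau> > 0 \<Longrightarrow> mob a b c d \<tau> = moebius M (of_real \<alpha> * \<tau> + of_real \<beta>)" by blast
    have "\<forall>\<^sub>F \<tau> in at_i_infinity. norm (T \<tau>) \<ge> 1"
      using expansion_at_infinity[OF T_exp] by (auto simp: filterlim_at_top)
    then obtain Y where Y: "\<And>\<tau>. Im \<tau> > Y \<Longrightarrow> norm (T \<tau>) \<ge> 1" by (auto simp: eventually_at_i_infinity)
    \<comment> \<open>At a cusp equivalent to infinity 1/T is bounded, and it is holomorphic because
      \<open>T\<close> has no zeros; so 1/T is expanded and the expansion inverted.\<close>
    define S where "S = (\<lambda>\<tau>. inverse (T \<tau>))"
    have S: "S holomorphic_on {\<tau>. Im \<tau> > 0}" unfolding S_def using T_nonzero by (intro holomorphic_intros T_hol) auto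
    have S': "level_invariant m S" using T_level by (simp add: level_invariant_def S_def)
    have "norm (S (mob a b c d \<tau>)) \<le> 1" if "Im \<tau> > 0" "Im \<tau> > Y / \<alpha>" for \<tau>
    proof -
      have *: "Im (of_real \<alpha> * \<tau> + of_real \<beta>) > 0" "Im (of_real \<alpha> * \<tau> + of_real \<beta>) > Y"
        using that M(2) by (simp_all add: field_simps)
      then have "T (mob a b c d \<tau>) = T (of_real \<alpha> * \<tau> + of_real \<beta>)" using M(3)[OF that(1)] T_inv[OF M(1)] by simp
      then show ?thesis using Y[OF *(2)] by (simp add: S_def norm_inverse inverse_le_1_iff)
    qed
    then obtain h where h: "h holomorphic_on ball 0 1" "\<And>\<tau>. Im \<tau> > 0 \<Longrightarrow> S (mob a b c d \<tau>) = h (qexp (\<tau> / of_nat m))"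
      using fourier_expansion[OF m holomorphic_on_mob[OF S det] level_invariant_period[OF S' det]]
      by blast
    have "h meromorphic_on {0}"
      using h(1) by (intro analytic_on_imp_meromorphic_on holomorphic_on_imp_analytic_at[of _ "ball 0 1"]) auto
    then have "(\<lambda>w. inverse (h w)) meromorphic_on {0}" by (rule meromorphic_on_inverse)
    moreover have "T (mob a b c d \<tau>) = inverse (h (qexp (\<tau> / of_nat m)))" if "Im \<tau> > 0" for \<tau>
      using h(2)[OF that] by (simp add: S_def) (metis inverse_inverse_eq)
    ultimately show ?thesis unfolding meromorphic_at_cusp_def mob_eq_moebius[symmetric] using m by blast
  qed
  moreover have "T nicely_meromorphic_on upper_half_plane"
    unfolding upper_half_plane_def using T_hol open_upper_half_plane
    by (intro analytic_on_imp_nicely_meromorphic_on) (simp add: analytic_on_open)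
  ultimately show ?thesis
    using T_inv by (auto simp: function_field_def upper_half_plane_def SL2Z_def)
qed

end

text \<open>Multiplies local denominators into one; stability under further factors is what makes
  the product work at all places at once.\<close>

lemma finite_poly_common:
  fixes P :: "'i \<Rightarrow> complex poly \<Rightarrow> bool"
  assumes "finite I" "\<And>i. i \<in> I \<Longrightarrow> \<exists>Q. Q \<noteq> 0 \<and> P i Q" "\<And>i Q Q'. i \<in> I \<Longrightarrow> P i Q \<Longrightarrow> P i (Q * Q')"
  shows "\<exists>Q. Q \<noteq> 0 \<and> (\<forall>i\<in>I. P i Q)"
  using assms
proof (induction I rule: finite_induct)
  case empty
  show ?case by (intro exI[of _ 1]) auto
next
  case (insert i I)
  have "\<exists>Q. Q \<noteq> 0 \<and> (\<forall>i\<in>I. P i Q)" by (rule insert.IH) (simp_all add: insert.prems)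
  then obtain Q where Q: "Q \<noteq> 0" "\<forall>i\<in>I. P i Q" by blast
  obtain Q' where Q': "Q' \<noteq> 0" "P i Q'" using insert.prems(1)[of i] by blast
  have "P i (Q' * Q)" using insert.prems(2) Q'(2) by blast
  moreover have "P j (Q' * Q)" if "j \<in> I" for j
    using insert.prems(2)[of j Q Q'] Q(2) that by (simp add: mult.commute)
  ultimately show ?case using Q(1) Q'(1) by (intro exI[of _ "Q' * Q"]) auto
qed

lemma isCont_holomorphic_upper_half_plane:
  assumes "F holomorphic_on {\<tau>. Im \<tau> > 0}" "Im z > 0"
  shows "isCont F z"
  using holomorphic_on_imp_continuous_on[OF assms(1)] open_upper_half_plane assms(2)
  by (simp add: continuous_on_eq_continuous_at)

lemma meromorphic_on_mob:
  assumes "f meromorphic_on {\<tau>. Im \<tau> > 0}" "a * d - b * c = 1"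
  shows "(\<lambda>\<tau>. f (mob a b c d \<tau>)) meromorphic_on {\<tau>. Im \<tau> > 0}"
proof (rule meromorphic_on_compose[OF assms(1)])
  have "(\<lambda>\<tau>. mob a b c d \<tau>) holomorphic_on {\<tau>. Im \<tau> > 0}"
    using holomorphic_on_mob[OF holomorphic_on_ident assms(2)] .
  then show "mob a b c d analytic_on {\<tau>. Im \<tau> > 0}"
    using open_upper_half_plane by (simp add: analytic_on_open)
  show "mob a b c d ` {\<tau>. Im \<tau> > 0} \<subseteq> {\<tau>. Im \<tau> > 0}" using Im_mob_pos assms(2) by auto
qed

text \<open>t - t(z) is O(w - z), whether or not t is ramified at z, so its k-th power outweighs a
  pole of order k.\<close>

lemma kill_pole:
  assumes f: "f meromorphic_on {z}" and t: "t holomorphic_on ball z r" "r > 0"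
  shows "\<exists>Q. Q \<noteq> 0 \<and> loc_bounded (\<lambda>w. f w * poly Q (t w)) z"
proof -
  obtain k B where kB: "\<forall>\<^sub>F w in at z. norm ((w - z) ^ k * f w) \<le> B"
    using meromorphic_pole_growth[OF f] by blast
  obtain C e where C: "C > 0" "e > 0" "\<And>w. norm (w - z) < e \<Longrightarrow> norm (t w - t z) \<le> C * norm (w - z)"
    using holomorphic_Lipschitz_at[OF t] by metis
  have "\<forall>\<^sub>F w in at z. w \<in> ball z e"
    using C(2) by (intro eventually_at_in_open') auto
  with kB have "\<forall>\<^sub>F w in at z. norm (f w * poly ([:- t z, 1:] ^ k) (t w)) \<le> C ^ k * B"
  proof eventually_elim
    case (elim w)
    have "norm (t w - t z) ^ k \<le> (C * norm (w - z)) ^ k"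
      using C(3)[of w] elim(2) by (intro power_mono) (auto simp: dist_norm norm_minus_commute)
    then have "norm (f w) * norm (t w - t z) ^ k \<le> norm (f w) * (C * norm (w - z)) ^ k"
      by (intro mult_left_mono) auto
    also have "\<dots> = C ^ k * norm ((w - z) ^ k * f w)"
      by (simp add: norm_mult norm_power power_mult_distrib)
    also have "\<dots> \<le> C ^ k * B" using elim(1) C(1) by (intro mult_left_mono) auto
    finally show ?case by (simp add: norm_mult norm_power)
  qed
  then have "loc_bounded (\<lambda>w. f w * poly ([:- t z, 1:] ^ k) (t w)) z" by (auto simp: loc_bounded_def)
  then show ?thesis by (intro exI[of _ "[:- t z, 1:] ^ k"]) auto
qed

context hauptmodul
begin

lemma kill_cusp_pole:
  assumes det: "a * d - b * c = 1"
    and T_bd: "\<And>\<tau>. Im \<tau> > 0 \<Longrightarrow> Im \<tau> > Y \<Longrightarrow> norm (T (mob a b c d \<tau>)) \<le> B"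
    and f: "meromorphic_at_cusp f (mat2 (of_int a) (of_int b) (of_int c) (of_int d))"
  shows "\<exists>Q. Q \<noteq> 0 \<and> cusp_bounded (\<lambda>w. f w * poly Q (T w)) (a, b, c, d)"
proof -
  obtain h where h: "h holomorphic_on ball 0 1" "\<And>\<tau>. Im \<tau> > 0 \<Longrightarrow> T (mob a b c d \<tau>) = h (qexp (\<tau> / of_nat m))"
    using fourier_expansion[OF m holomorphic_on_mob[OF T_hol det] level_invariant_period[OF T_level det] T_bd]
    by blast
  obtain C e where C: "C > 0" "e > 0" "\<And>w. norm (w - 0) < e \<Longrightarrow> norm (h w - h 0) \<le> C * norm (w - 0)"
    using holomorphic_Lipschitz_at[OF h(1)] by (metis zero_less_one)
  obtain k :: nat and B' Y' where k: "Y' > 0" "B' > 0"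
      "\<And>\<tau>. Im \<tau> > Y' \<Longrightarrow> norm (f (mob a b c d \<tau>)) \<le> B' * exp (2 * pi * k * Im \<tau>)"
    by (rule cusp_growth[OF f]) (rule that; assumption)
  have "((\<lambda>\<tau>. norm (qexp (\<tau> / of_nat m))) \<longlongrightarrow> 0) at_i_infinity"
    using filterlim_qexp_divide[OF m] by (intro tendsto_norm_zero) (simp add: filterlim_at)
  then have "\<forall>\<^sub>F \<tau> in at_i_infinity. norm (qexp (\<tau> / of_nat m)) < e"
    using C(2) by (rule order_tendstoD)
  then obtain Y2 where Y2: "\<And>\<tau>. Im \<tau> > Y2 \<Longrightarrow> norm (qexp (\<tau> / of_nat m)) < e"
    by (auto simp: eventually_at_i_infinity)
  \<comment> \<open>\<open>T\<close> is here a function of \<open>qexp (\<tau> / m)\<close>, so m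
    factors T - h(0) are needed to gain one power of \<open>qexp \<tau>\<close>, and the growth of
    \<open>f\<close> requires k of these.\<close>
  define Q where "Q = [:- h 0, 1:] ^ (k * m)"
  have "norm (f (mob a b c d \<tau>) * poly Q (T (mob a b c d \<tau>))) \<le> B' * C ^ (k * m)"
    if \<tau>: "Im \<tau> > 0" "Im \<tau> > max Y' Y2" for \<tau>
  proof -
    have "norm (h (qexp (\<tau> / of_nat m)) - h 0) ^ (k * m) \<le> (C * exp (- (2 * pi * Im \<tau> / m))) ^ (k * m)"
      using C(3)[of "qexp (\<tau> / of_nat m)"] Y2[of \<tau>] \<tau> by (intro power_mono) (auto simp: norm_qexp_divide)
    also have "\<dots> = C ^ (k * m) * exp (- (2 * pi * k * Im \<tau>))"
      using m by (simp add: power_mult_distrib exp_of_nat_mult[symmetric] del: of_nat_mult) (simp add: field_simps)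
    finally have "norm (poly Q (T (mob a b c d \<tau>))) \<le> C ^ (k * m) * exp (- (2 * pi * k * Im \<tau>))"
      by (simp add: Q_def h(2)[OF \<tau>(1)] norm_power)
    then have "norm (f (mob a b c d \<tau>) * poly Q (T (mob a b c d \<tau>))) \<le>
        (B' * exp (2 * pi * k * Im \<tau>)) * (C ^ (k * m) * exp (- (2 * pi * k * Im \<tau>)))"
      unfolding norm_mult using k(3)[of \<tau>] k(2) \<tau> by (intro mult_mono) auto
    also have "\<dots> = B' * C ^ (k * m) * (exp (2 * pi * k * Im \<tau>) * exp (- (2 * pi * k * Im \<tau>)))" by simp
    also have "\<dots> = B' * C ^ (k * m)" by (simp add: exp_minus)
    finally show ?thesis .
  qed
  then have "cusp_bounded (\<lambda>w. f w * poly Q (T w)) (a, b, c, d)"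
    unfolding cusp_bounded_def prod.case by blast
  then show ?thesis by (intro exI[of _ Q]) (auto simp: Q_def)
qed

lemma cusp_bounded_poly_T:
  assumes "cusp_bounded T \<sigma>"
  shows "cusp_bounded (\<lambda>w. poly p (T w)) \<sigma>"
proof -
  obtain a b c d where \<sigma>: "\<sigma> = (a, b, c, d)" by (metis prod_cases4)
  obtain B Y where BY: "\<And>\<tau>. Im \<tau> > 0 \<Longrightarrow> Im \<tau> > Y \<Longrightarrow> norm (T (mob a b c d \<tau>)) \<le> B"
    using assms by (auto simp: cusp_bounded_def \<sigma>)
  obtain K where "\<And>z. norm z \<le> B \<Longrightarrow> norm (poly p z) \<le> K"
  proof -
    have "compact (poly p ` cball 0 B)" by (intro compact_continuous_image continuous_intros) auto
    then have "bounded (poly p ` cball 0 B)" by (rule compact_imp_bounded)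
    then obtain K where "\<forall>y\<in>poly p ` cball 0 B. norm y \<le> K" unfolding bounded_iff by blast
    then show ?thesis by (intro that[of K]) auto
  qed
  then show ?thesis using BY unfolding cusp_bounded_def \<sigma> by auto
qed

lemma cusp_bounded_mult:
  assumes "cusp_bounded f \<sigma>" "cusp_bounded g \<sigma>"
  shows "cusp_bounded (\<lambda>w. f w * g w) \<sigma>"
proof -
  obtain a b c d where \<sigma>: "\<sigma> = (a, b, c, d)" by (metis prod_cases4)
  obtain A Y where A: "\<And>\<tau>. Im \<tau> > 0 \<Longrightarrow> Im \<tau> > Y \<Longrightarrow> norm (f (mob a b c d \<tau>)) \<le> A"
    using assms(1) by (auto simp: cusp_bounded_def \<sigma>)
  obtain B Y' where B: "\<And>\<tau>. Im \<tau> > 0 \<Longrightarrow> Im \<tau> > Y' \<Longrightarrow> norm (g (mob a b c d \<tau>)) \<le> B"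
    using assms(2) by (auto simp: cusp_bounded_def \<sigma>)
  have "norm (f (mob a b c d \<tau>) * g (mob a b c d \<tau>)) \<le> \<bar>A\<bar> * \<bar>B\<bar>" if "Im \<tau> > 0" "Im \<tau> > max Y Y'" for \<tau>
    unfolding norm_mult using A[of \<tau>] B[of \<tau>] that by (intro mult_mono) auto
  then show ?thesis unfolding cusp_bounded_def \<sigma> prod.case by blast
qed

lemma cusp_bounded_diff:
  assumes "cusp_bounded f \<sigma>" "cusp_bounded g \<sigma>"
  shows "cusp_bounded (\<lambda>w. f w - g w) \<sigma>"
proof -
  obtain a b c d where \<sigma>: "\<sigma> = (a, b, c, d)" by (metis prod_cases4)
  obtain A Y where A: "\<And>\<tau>. Im \<tau> > 0 \<Longrightarrow> Im \<tau> > Y \<Longrightarrow> norm (f (mob a b c d \<tau>)) \<le> A"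
    using assms(1) by (auto simp: cusp_bounded_def \<sigma>)
  obtain B Y' where B: "\<And>\<tau>. Im \<tau> > 0 \<Longrightarrow> Im \<tau> > Y' \<Longrightarrow> norm (g (mob a b c d \<tau>)) \<le> B"
    using assms(2) by (auto simp: cusp_bounded_def \<sigma>)
  have "norm (f (mob a b c d \<tau>) - g (mob a b c d \<tau>)) \<le> A + B" if "Im \<tau> > 0" "Im \<tau> > max Y Y'" for \<tau>
    using norm_triangle_ineq4[of "f (mob a b c d \<tau>)" "g (mob a b c d \<tau>)"] A[of \<tau>] B[of \<tau>] that by simp
  then show ?thesis unfolding cusp_bounded_def \<sigma> prod.case by blast
qed

lemma cusp_bounded_cong:
  assumes "\<And>\<tau>. Im \<tau> > 0 \<Longrightarrow> f (mob a b c d \<tau>) = f (mob a' b' c' d' \<tau>)"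
  shows "cusp_bounded f (a, b, c, d) \<longleftrightarrow> cusp_bounded f (a', b', c', d')"
  using assms by (simp add: cusp_bounded_def)

text \<open>Boundedness has to be checked only at the cusps where \<open>T\<close> is finite and at
  infinity itself: the remaining cusps are equivalent to infinity, and invariance transports the
  bound to them.\<close>

lemma bounded_invariant_constant:
  assumes hol: "E holomorphic_on {\<tau>. Im \<tau> > 0}"
    and inv: "\<And>M \<tau>. M \<in> G \<Longrightarrow> Im \<tau> > 0 \<Longrightarrow> E (moebius M \<tau>) = E \<tau>"
    and finite_cusps: "\<And>a b c d. a * d - b * c = 1 \<Longrightarrow> cusp_bounded T (a, b, c, d) \<Longrightarrow> cusp_bounded E (a, b, c, d)"
    and infinity: "\<And>\<tau>. Im \<tau> > 0 \<Longrightarrow> Im \<tau> > Y \<Longrightarrow> norm (E \<tau>) \<le> B"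
  obtains e where "\<And>\<tau>. Im \<tau> > 0 \<Longrightarrow> E \<tau> = e"
proof -
  have "\<exists>B Y. \<forall>\<tau>. Im \<tau> > 0 \<longrightarrow> Im \<tau> > Y \<longrightarrow> norm (E (mob a b c d \<tau>)) \<le> B"
    if det: "a * d - b * c = 1" for a b c d
    using cusps[OF det]
  proof
    assume "\<exists>B Y. \<forall>\<tau>. Im \<tau> > 0 \<longrightarrow> Im \<tau> > Y \<longrightarrow> norm (T (mob a b c d \<tau>)) \<le> B"
    then have "cusp_bounded T (a, b, c, d)" by (simp add: cusp_bounded_def)
    then show ?thesis using finite_cusps[OF det] by (simp add: cusp_bounded_def)
  next
    assume "\<exists>M \<alpha> \<beta>. M \<in> G \<and> \<alpha> > 0 \<and> (\<forall>\<tau>. Im \<tau> > 0 \<longrightarrow> mob a b c d \<tau> = moebius M (of_real \<alpha> * \<tau> + of_real \<beta>))"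
    then obtain M \<alpha> \<beta> where M: "M \<in> G" "\<alpha> > 0"
      "\<And>\<tau>. Im \<tau> > 0 \<Longrightarrow> mob a b c d \<tau> = moebius M (of_real \<alpha> * \<tau> + of_real \<beta>)" by blast
    have "norm (E (mob a b c d \<tau>)) \<le> B" if "Im \<tau> > 0" "Im \<tau> > Y / \<alpha>" for \<tau>
    proof -
      have *: "Im (of_real \<alpha> * \<tau> + of_real \<beta>) > 0" "Im (of_real \<alpha> * \<tau> + of_real \<beta>) > Y"
        using that M(2) by (simp_all add: field_simps)
      then show ?thesis using M(3)[OF that(1)] inv[OF M(1)] infinity by simp
    qed
    then show ?thesis by blast
  qed
  then show ?thesis using modular_Liouville[OF m hol invariant_level[OF inv]] that by blast
qed

text \<open>An accumulation of zeros would make p(T) vanish identically, so that \<open>T\<close>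
  would take finitely many values, against |T| tending to infinity.\<close>

lemma T_equation_cosparse:
  assumes "p \<noteq> 0"
  shows "\<forall>\<^sub>F \<tau> in cosparse {\<tau>. Im \<tau> > 0}. poly p (T \<tau>) \<noteq> 0"
  unfolding eventually_cosparse_open_eq[OF open_upper_half_plane]
proof (rule ccontr)
  assume "\<not> (\<forall>z\<in>{\<tau>. Im \<tau> > 0}. \<forall>\<^sub>F \<tau> in at z. poly p (T \<tau>) \<noteq> 0)"
  then obtain z where z: "Im z > 0" "\<exists>\<^sub>F \<tau> in at z. poly p (T \<tau>) = 0"
    by (auto simp: frequently_def)
  then have "\<exists>\<^sub>F \<tau> in at z. \<tau> \<in> {\<tau>. Im \<tau> > 0 \<and> poly p (T \<tau>) = 0}"
    using eventually_at_upper_half_plane[OF z(1)] by (auto elim: frequently_rev_mp eventually_mono)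
  then have "z islimpt {\<tau>. Im \<tau> > 0 \<and> poly p (T \<tau>) = 0}" by (simp add: islimpt_conv_frequently_at)
  then have "poly p (T w) = 0" if "Im w > 0" for w
    using that z(1) convex_connected[OF convex_upper_half_plane]
    by (intro analytic_continuation[OF _ open_upper_half_plane, where \<xi> = z and w = w
          and U = "{\<tau>. Im \<tau> > 0 \<and> poly p (T \<tau>) = 0}" and f = "\<lambda>w. poly p (T w)"])
       (auto intro!: holomorphic_intros T_hol)
  then have sub: "T ` {\<tau>. Im \<tau> > 0} \<subseteq> {x. poly p x = 0}" by auto
  have "finite {x. poly p x = 0}" using assms by (rule poly_roots_finite)
  then have "bounded (T ` {\<tau>. Im \<tau> > 0})" using sub finite_imp_bounded bounded_subset by blast
  then obtain B where B: "\<And>\<tau>. Im \<tau> > 0 \<Longrightarrow> norm (T \<tau>) \<le> B" by (auto simp: bounded_iff)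
  have "\<forall>\<^sub>F \<tau> in at_i_infinity. norm (T \<tau>) \<ge> B + 1"
    using expansion_at_infinity[OF T_exp] unfolding filterlim_at_top by blast
  then have "\<forall>\<^sub>F \<tau> in at_i_infinity. False"
    using eventually_Im_gt_at_i_infinity[of 0] by eventually_elim (use B in force)
  then show False by simp
qed

text \<open>Multiplying by a polynomial in \<open>T\<close> removes the poles in the upper half-plane and at the cusps
  where \<open>T\<close> is finite; subtracting one removes the pole at \<open>i\<infinity>\<close>.\<close>

theorem function_field_rational:
  assumes f: "f \<in> function_field G"
  shows "\<exists>P Q. \<forall>\<^sub>F \<tau> in cosparse {\<tau>. Im \<tau> > 0}. poly Q (T \<tau>) \<noteq> 0 \<and> f \<tau> = poly P (T \<tau>) / poly Q (T \<tau>)"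
proof -
  have mer: "f meromorphic_on {\<tau>. Im \<tau> > 0}"
    using f by (auto simp: function_field_def nicely_meromorphic_on_def upper_half_plane_def)
  have inv: "\<And>M \<tau>. M \<in> G \<Longrightarrow> Im \<tau> > 0 \<Longrightarrow> f (moebius M \<tau>) = f \<tau>"
    using f by (auto simp: function_field_def upper_half_plane_def)
  have cusp: "meromorphic_at_cusp f (mat2 (of_int a) (of_int b) (of_int c) (of_int d))"
    if "a * d - b * c = 1" for a b c d
    using f that unfolding function_field_def SL2Z_def by blast
  obtain R where R: "finite R" "\<And>a b c d. (a, b, c, d) \<in> R \<Longrightarrow> a * d - b * c = 1"
    "\<And>a b c d. a * d - b * c = 1 \<Longrightarrow> \<exists>(a', b', c', d')\<in>R. int m dvd a - a' \<and> int m dvd b - b' \<and> int m dvd c - c' \<and> int m dvd d - d'"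
    by (rule coset_representatives[OF m]) auto
  have rep: "\<exists>a' b' c' d'. (a', b', c', d') \<in> R \<and> (\<forall>(g :: complex \<Rightarrow> complex) \<tau>. level_invariant m g \<longrightarrow> Im \<tau> > 0 \<longrightarrow> g (mob a b c d \<tau>) = g (mob a' b' c' d' \<tau>))"
    if det: "a * d - b * c = 1" for a b c d
  proof -
    obtain a' b' c' d' where R': "(a', b', c', d') \<in> R"
        "int m dvd a - a'" "int m dvd b - b'" "int m dvd c - c'" "int m dvd d - d'"
      using R(3)[OF det] by blast
    have "g (mob a b c d \<tau>) = g (mob a' b' c' d' \<tau>)" if "level_invariant m g" "Im \<tau> > 0" for g :: "complex \<Rightarrow> complex" and \<tau>
      using level_invariant_cong[OF that(1) det R(2)[OF R'(1)] R'(2-5) that(2)] .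
    then show ?thesis using R'(1) by blast
  qed
  define M where "M = (\<lambda>(a, b, c, d). mob a b c d)"
  \<comment> \<open>Every orbit has a point in the half-strip for one of the finitely many \<sigma>.
    Treating the bad points there therefore treats all poles of \<open>f\<close>, of which there may
    be infinitely many.\<close>
  define bad where "bad \<sigma> = {z. Im z \<ge> 1 / 2 \<and> \<bar>Re z\<bar> \<le> 1 / 2 \<and> \<not> loc_bounded (\<lambda>w. f (M \<sigma> w)) z}" for \<sigma>
  have fin: "finite (bad \<sigma>)" if \<sigma>R: "\<sigma> \<in> R" for \<sigma>
  proof -
    obtain a b c d where \<sigma>: "\<sigma> = (a, b, c, d)" by (metis prod_cases4)
    have det: "a * d - b * c = 1" using R(2) \<sigma>R by (simp add: \<sigma>)
    obtain k :: nat and B Y where k: "Y > 0" "B > 0"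
        "\<And>\<tau>. Im \<tau> > Y \<Longrightarrow> norm (f (mob a b c d \<tau>)) \<le> B * exp (2 * pi * k * Im \<tau>)"
      by (rule cusp_growth[OF cusp[OF det]]) (rule that; assumption)
    have high: "loc_bounded (\<lambda>w. f (M \<sigma> w)) z" if "Im z > Y" for z
    proof -
      have "\<forall>\<^sub>F w in at z. w \<in> ball z 1" by (intro eventually_at_in_open') auto
      then have "\<forall>\<^sub>F w in at z. norm (f (M \<sigma> w)) \<le> B * exp (2 * pi * k * (Im z + 1))"
        using eventually_at_Im_gt[OF that]
      proof eventually_elim
        case (elim w)
        have "Im w \<le> Im z + 1" using abs_Im_le_cmod[of "w - z"] elim(1) by (auto simp: dist_norm norm_minus_commute)
        then have "2 * pi * k * Im w \<le> 2 * pi * k * (Im z + 1)" by (intro mult_left_mono) auto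
        then have "B * exp (2 * pi * k * Im w) \<le> B * exp (2 * pi * k * (Im z + 1))"
          using k(2) by simp
        then show ?case using k(3)[OF elim(2)] by (simp add: M_def \<sigma>)
      qed
      then show ?thesis by (auto simp: loc_bounded_def)
    qed
    define S where "S = {w. \<not> (\<lambda>w. f (M \<sigma> w)) analytic_on {w}}"
    have "(\<lambda>w. f (M \<sigma> w)) meromorphic_on {\<tau>. Im \<tau> > 0}"
      using meromorphic_on_mob[OF mer det] by (simp add: M_def \<sigma>)
    then have sp: "S sparse_in {\<tau>. Im \<tau> > 0}"
      unfolding S_def by (rule meromorphic_on_imp_sparse_singularities)
    \<comment> \<open>Above height \<open>Y\<close> the growth bound at the cusp excludes poles, so
      all bad points lie in this compact rectangle, where singularities of a meromorphic function
      are finite in number.\<close>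
    define K where "K = cbox (Complex (- 1 / 2) (1 / 2)) (Complex (1 / 2) (max 1 Y))"
    have KH: "K \<subseteq> {\<tau>. Im \<tau> > 0}" by (auto simp: K_def in_cbox_complex_iff)
    have "S sparse_in K" using sparse_in_subset[OF sp KH] .
    then have "finite (K \<inter> S)" using sparse_in_compact_finite[of S K] by (simp add: K_def Int_commute)
    moreover have "bad \<sigma> \<subseteq> K \<inter> S"
    proof
      fix z assume z: "z \<in> bad \<sigma>"
      then have "Im z \<le> Y" using high[of z] by (auto simp: bad_def not_le[symmetric])
      then have "z \<in> K" using z by (auto simp: K_def bad_def in_cbox_complex_iff abs_le_iff)
      moreover have "z \<in> S"
      proof (rule ccontr)
        assume "z \<notin> S"
        then have "isCont (\<lambda>w. f (M \<sigma> w)) z" by (auto simp: S_def intro: analytic_at_imp_isCont)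
        then show False using z loc_bounded_isCont by (auto simp: bad_def)
      qed
      ultimately show "z \<in> K \<inter> S" by simp
    qed
    ultimately show ?thesis using finite_subset by blast
  qed
  have T_M: "(\<lambda>w. T (M \<sigma> w)) holomorphic_on {\<tau>. Im \<tau> > 0}" if \<sigma>R: "\<sigma> \<in> R" for \<sigma>
  proof -
    obtain a b c d where \<sigma>: "\<sigma> = (a, b, c, d)" by (metis prod_cases4)
    show ?thesis using holomorphic_on_mob[OF T_hol R(2)[of a b c d]] \<sigma>R by (simp add: M_def \<sigma>)
  qed
  have cont_poly: "loc_bounded (\<lambda>w. poly q (T (M \<sigma> w))) z" if "\<sigma> \<in> R" "Im z > 0" for q \<sigma> z
    using isCont_holomorphic_upper_half_plane[OF T_M[OF that(1)] that(2)]
    by (intro loc_bounded_isCont continuous_intros)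
  have "\<exists>Q. Q \<noteq> 0 \<and> (\<forall>i\<in>(SIGMA \<sigma>:R. bad \<sigma>). case i of (\<sigma>, z) \<Rightarrow> loc_bounded (\<lambda>w. f (M \<sigma> w) * poly Q (T (M \<sigma> w))) z)"
  proof (rule finite_poly_common)
    show "finite (SIGMA \<sigma>:R. bad \<sigma>)" using R(1) fin by (intro finite_SigmaI)
  next
    fix i assume i: "i \<in> (SIGMA \<sigma>:R. bad \<sigma>)"
    obtain a b c d z where i': "i = ((a, b, c, d), z)" by (metis prod_cases5 prod.collapse)
    have mem: "(a, b, c, d) \<in> R" and z: "Im z > 0" using i by (auto simp: i' bad_def)
    have "(\<lambda>w. f (M (a, b, c, d) w)) meromorphic_on {z}"
      using meromorphic_on_subset[OF meromorphic_on_mob[OF mer R(2)[OF mem]], of "{z}"] z by (simp add: M_def)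
    moreover have "(\<lambda>w. T (M (a, b, c, d) w)) holomorphic_on ball z (Im z)"
    proof (rule holomorphic_on_subset[OF T_M[OF mem]])
      show "ball z (Im z) \<subseteq> {\<tau>. Im \<tau> > 0}"
      proof
        fix w assume "w \<in> ball z (Im z)"
        then have "\<bar>Im (z - w)\<bar> < Im z" using abs_Im_le_cmod[of "z - w"] by (simp add: dist_norm)
        then show "w \<in> {\<tau>. Im \<tau> > 0}" by auto
      qed
    qed
    ultimately show "\<exists>Q. Q \<noteq> 0 \<and> (case i of (\<sigma>, z) \<Rightarrow> loc_bounded (\<lambda>w. f (M \<sigma> w) * poly Q (T (M \<sigma> w))) z)"
      unfolding i' prod.case using kill_pole z by blast
  next
    fix i Q Q' assume i: "i \<in> (SIGMA \<sigma>:R. bad \<sigma>)"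
      and Q: "case i of (\<sigma>, z) \<Rightarrow> loc_bounded (\<lambda>w. f (M \<sigma> w) * poly Q (T (M \<sigma> w))) z"
    obtain \<sigma> z where i': "i = (\<sigma>, z)" by fastforce
    have "loc_bounded (\<lambda>w. f (M \<sigma> w) * poly Q (T (M \<sigma> w))) z" "\<sigma> \<in> R" "Im z > 0"
      using i Q by (auto simp: i' bad_def)
    then have "loc_bounded (\<lambda>w. (f (M \<sigma> w) * poly Q (T (M \<sigma> w))) * poly Q' (T (M \<sigma> w))) z"
      using loc_bounded_mult cont_poly by blast
    then show "case i of (\<sigma>, z) \<Rightarrow> loc_bounded (\<lambda>w. f (M \<sigma> w) * poly (Q * Q') (T (M \<sigma> w))) z"
      by (simp add: i' mult.assoc)
  qed
  then obtain Q1 where Q1: "Q1 \<noteq> 0" "\<And>\<sigma> z. \<sigma> \<in> R \<Longrightarrow> z \<in> bad \<sigma> \<Longrightarrow> loc_bounded (\<lambda>w. f (M \<sigma> w) * poly Q1 (T (M \<sigma> w))) z"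
    by auto
  have "\<exists>Q. Q \<noteq> 0 \<and> (\<forall>\<sigma>\<in>{\<sigma>\<in>R. cusp_bounded T \<sigma>}. cusp_bounded (\<lambda>w. f w * poly Q (T w)) \<sigma>)"
  proof (rule finite_poly_common)
    fix \<sigma> assume i: "\<sigma> \<in> {\<sigma>\<in>R. cusp_bounded T \<sigma>}"
    obtain a b c d where \<sigma>: "\<sigma> = (a, b, c, d)" by (metis prod_cases4)
    have det: "a * d - b * c = 1" using i R(2) by (simp add: \<sigma>)
    obtain B Y where BY: "\<And>\<tau>. Im \<tau> > 0 \<Longrightarrow> Im \<tau> > Y \<Longrightarrow> norm (T (mob a b c d \<tau>)) \<le> B"
      using i by (auto simp: cusp_bounded_def \<sigma>)
    show "\<exists>Q. Q \<noteq> 0 \<and> cusp_bounded (\<lambda>w. f w * poly Q (T w)) \<sigma>"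
      unfolding \<sigma> by (rule kill_cusp_pole[OF det BY cusp[OF det]])
  next
    fix \<sigma> Q Q' assume "\<sigma> \<in> {\<sigma>\<in>R. cusp_bounded T \<sigma>}" "cusp_bounded (\<lambda>w. f w * poly Q (T w)) \<sigma>"
    then have "cusp_bounded (\<lambda>w. (f w * poly Q (T w)) * poly Q' (T w)) \<sigma>"
      using cusp_bounded_mult cusp_bounded_poly_T by blast
    then show "cusp_bounded (\<lambda>w. f w * poly (Q * Q') (T w)) \<sigma>" by (simp add: mult.assoc)
  qed (use R(1) in auto)
  then obtain Q2 where Q2: "Q2 \<noteq> 0" "\<And>\<sigma>. \<sigma> \<in> R \<Longrightarrow> cusp_bounded T \<sigma> \<Longrightarrow> cusp_bounded (\<lambda>w. f w * poly Q2 (T w)) \<sigma>"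
    by auto
  define Q where "Q = Q1 * Q2"
  have Q0: "Q \<noteq> 0" using Q1(1) Q2(1) by (simp add: Q_def)
  define g where "g = (\<lambda>w. f w * poly Q (T w))"
  have g_inv: "g (moebius M \<tau>) = g \<tau>" if "M \<in> G" "Im \<tau> > 0" for M \<tau>
    using inv[OF that] T_inv[OF that] by (simp add: g_def)
  then have g_level: "level_invariant m g" by (rule invariant_level)
  have g_mer: "g meromorphic_on {\<tau>. Im \<tau> > 0}"
  proof -
    have "(\<lambda>w. poly Q (T w)) holomorphic_on {\<tau>. Im \<tau> > 0}" by (intro holomorphic_intros T_hol)
    then have "(\<lambda>w. poly Q (T w)) analytic_on {\<tau>. Im \<tau> > 0}"
      using open_upper_half_plane by (simp add: analytic_on_open)
    then show ?thesis unfolding g_def by (intro meromorphic_intros mer analytic_on_imp_meromorphic_on)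
  qed
  have g_bd_R: "loc_bounded (\<lambda>w. g (M \<sigma> w)) z" if "\<sigma> \<in> R" "Im z \<ge> 1 / 2" "\<bar>Re z\<bar> \<le> 1 / 2" for \<sigma> z
  proof -
    have z: "Im z > 0" using that by simp
    have "loc_bounded (\<lambda>w. f (M \<sigma> w) * poly Q1 (T (M \<sigma> w))) z"
    proof (cases "z \<in> bad \<sigma>")
      case False
      then have "loc_bounded (\<lambda>w. f (M \<sigma> w)) z" using that by (simp add: bad_def)
      then show ?thesis by (intro loc_bounded_mult cont_poly that(1) z)
    qed (use Q1(2) that in auto)
    then have "loc_bounded (\<lambda>w. (f (M \<sigma> w) * poly Q1 (T (M \<sigma> w))) * poly Q2 (T (M \<sigma> w))) z"
      by (rule loc_bounded_mult[OF _ cont_poly[OF that(1) z]])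
    then show ?thesis by (simp add: g_def Q_def mult.assoc)
  qed
  have g_bd: "loc_bounded g p" if p: "Im p > 0" for p
  proof -
    obtain a b c d z where z: "a * d - b * c = 1" "Im z \<ge> 1 / 2" "\<bar>Re z\<bar> \<le> 1 / 2" "p = mob a b c d z"
      using reduction[OF p] by blast
    obtain a' b' c' d' where R': "(a', b', c', d') \<in> R"
        "\<And>\<tau>. Im \<tau> > 0 \<Longrightarrow> g (mob a b c d \<tau>) = g (mob a' b' c' d' \<tau>)"
      using rep[OF z(1)] g_level by blast
    have z0: "Im z > 0" using z by simp
    obtain B where "\<forall>\<^sub>F w in at z. norm (g (M (a', b', c', d') w)) \<le> B"
      using g_bd_R[OF R'(1) z(2,3)] by (auto simp: loc_bounded_def)
    then have "\<forall>\<^sub>F w in at z. norm (g (mob a b c d w)) \<le> B"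
      using eventually_at_upper_half_plane[OF z0]
      by eventually_elim (use R'(2) in \<open>auto simp: M_def\<close>)
    moreover have "mob d (- b) (- c) a p = z" unfolding z(4) by (rule mob_inverse[OF z(1) z0])
    then have "filterlim (mob d (- b) (- c) a) (at z) (at p)"
      using filterlim_mob_at[of d a "-b" "-c" p] z(1) p by (simp add: algebra_simps)
    ultimately have "\<forall>\<^sub>F w in at p. norm (g (mob a b c d (mob d (- b) (- c) a w))) \<le> B"
      by (rule eventually_compose_filterlim)
    then have "\<forall>\<^sub>F w in at p. norm (g w) \<le> B"
      using eventually_at_upper_half_plane[OF p]
      by eventually_elim (simp add: mob_inverse[OF z(1)])
    then show ?thesis by (auto simp: loc_bounded_def)
  qed
  \<comment> \<open>Bounded near every point is not yet holomorphic: at a former pole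
    \<open>f\<close> has the conventional value 0, so \<open>g\<close> may have the wrong value
    there.\<close>
  define F where "F = remove_sings g"
  have gz: "g meromorphic_on {z}" if "Im z > 0" for z
    using meromorphic_on_subset[OF g_mer] that by simp
  have F_ev: "\<forall>\<^sub>F w in at z. F w = g w" if "Im z > 0" for z
    unfolding F_def by (rule remove_sings_loc_bounded[OF gz[OF that] g_bd[OF that]])
  have F_hol: "F holomorphic_on {\<tau>. Im \<tau> > 0}"
  proof -
    have "F analytic_on {z}" if "Im z > 0" for z
      unfolding F_def by (rule remove_sings_loc_bounded[OF gz[OF that] g_bd[OF that]])
    then have "F analytic_on {\<tau>. Im \<tau> > 0}" by (subst analytic_on_analytic_at) auto
    then show ?thesis by (rule analytic_imp_holomorphic)
  qed
  note F_cont = isCont_holomorphic_upper_half_plane[OF F_hol]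
  \<comment> \<open>\<open>F\<close> and \<open>g\<close> agree only away from isolated points, so
    invariance passes from \<open>g\<close> to \<open>F\<close> through punctured neighbourhoods and
    continuity.\<close>
  have F_inv: "F (moebius M \<tau>) = F \<tau>" if M: "M \<in> G" and \<tau>: "Im \<tau> > 0" for M \<tau>
  proof -
    have pos: "Im (moebius M \<tau>) > 0" using Im_moebius_pos[OF G_pos[OF M] \<tau>] .
    note fl = filterlim_moebius_at[OF G_pos[OF M] \<tau>]
    have "((\<lambda>w. F (moebius M w)) \<longlongrightarrow> F (moebius M \<tau>)) (at \<tau>)"
      using filterlim_compose[OF _ fl] F_cont[OF pos] by (simp add: isCont_def)
    moreover have "\<forall>\<^sub>F w in at \<tau>. F (moebius M w) = F w"
      using eventually_compose_filterlim[OF F_ev[OF pos] fl] F_ev[OF \<tau>] eventually_at_upper_half_plane[OF \<tau>]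
      by eventually_elim (simp add: g_inv[OF M])
    ultimately have "(F \<longlongrightarrow> F (moebius M \<tau>)) (at \<tau>)" by (rule Lim_transform_eventually)
    then show ?thesis using F_cont[OF \<tau>] LIM_unique by (auto simp: isCont_def)
  qed
  have F_level: "level_invariant m F" using F_inv by (rule invariant_level)
  have F_cusp: "cusp_bounded F (a, b, c, d)" if det: "a * d - b * c = 1" and Tb: "cusp_bounded T (a, b, c, d)" for a b c d
  proof -
    obtain a' b' c' d' where R': "(a', b', c', d') \<in> R"
        "\<And>(u :: complex \<Rightarrow> complex) \<tau>. level_invariant m u \<Longrightarrow> Im \<tau> > 0 \<Longrightarrow> u (mob a b c d \<tau>) = u (mob a' b' c' d' \<tau>)"
      using rep[OF det] by blast
    have "cusp_bounded T (a', b', c', d')" using Tb cusp_bounded_cong R'(2)[OF T_level] by blast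
    then have "cusp_bounded (\<lambda>w. (f w * poly Q2 (T w)) * poly Q1 (T w)) (a', b', c', d')"
      by (intro cusp_bounded_mult[OF Q2(2) cusp_bounded_poly_T] R')
    then have "cusp_bounded g (a', b', c', d')" by (simp add: g_def Q_def mult_ac)
    then have "cusp_bounded g (a, b, c, d)" using cusp_bounded_cong R'(2)[OF g_level] by blast
    then obtain B Y where BY: "\<And>\<tau>. Im \<tau> > 0 \<Longrightarrow> Im \<tau> > Y \<Longrightarrow> norm (g (mob a b c d \<tau>)) \<le> B"
      by (auto simp: cusp_bounded_def)
    have "norm (F (mob a b c d \<tau>)) \<le> B" if \<tau>: "Im \<tau> > 0" "Im \<tau> > Y" for \<tau>
    proof (rule isCont_norm_bound[where F = "\<lambda>\<tau>. F (mob a b c d \<tau>)"])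
      show "isCont (\<lambda>\<tau>. F (mob a b c d \<tau>)) \<tau>"
        by (rule isCont_holomorphic_upper_half_plane[OF holomorphic_on_mob[OF F_hol det] \<tau>(1)])
      have pos: "Im (mob a b c d \<tau>) > 0" using det \<tau> by (intro Im_mob_pos) auto
      show "\<forall>\<^sub>F w in at \<tau>. norm (F (mob a b c d w)) \<le> B"
        using eventually_compose_filterlim[OF F_ev[OF pos] filterlim_mob_at[OF det \<tau>(1)]]
          eventually_at_upper_half_plane[OF \<tau>(1)] eventually_at_Im_gt[OF \<tau>(2)]
        by eventually_elim (simp add: BY)
    qed
    then show ?thesis unfolding cusp_bounded_def by auto
  qed
  have det1: "(1::int) * 1 - 0 * 0 = 1" by simp
  obtain k :: nat and B Y where k: "Y > 0" "B > 0"
      "\<And>\<tau>. Im \<tau> > Y \<Longrightarrow> norm (f (mob 1 0 0 1 \<tau>)) \<le> B * exp (2 * pi * k * Im \<tau>)"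
    by (rule cusp_growth[OF cusp[OF det1]]) (rule that; assumption)
  have "\<forall>\<^sub>F \<tau> in at_i_infinity. norm (T \<tau> * qexp \<tau>) < 2"
    using tendsto_norm[OF expansion_tendsto(1)[OF T_exp]] by (rule order_tendstoD) simp
  then obtain Y1 where Y1: "\<And>\<tau>. Im \<tau> > Y1 \<Longrightarrow> norm (T \<tau> * qexp \<tau>) < 2"
    by (auto simp: eventually_at_i_infinity)
  define S where "S = (\<Sum>i\<le>degree Q. norm (coeff Q i) * 2 ^ i)"
  \<comment> \<open>The pole order at infinity is at most the one of \<open>f\<close> plus the
    degree of \<open>Q\<close>, as \<open>T\<close> has a simple pole there.\<close>
  have g_growth: "norm (g \<tau> * qexp \<tau> ^ (k + degree Q)) \<le> B * S"
    if \<tau>: "Im \<tau> > 0" "Im \<tau> > max Y Y1" for \<tau>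
  proof -
    have f_bd: "norm (f \<tau> * qexp \<tau> ^ k) \<le> B"
    proof -
      have "norm (f \<tau> * qexp \<tau> ^ k) = norm (f \<tau>) * exp (- (2 * pi * k * Im \<tau>))"
        by (simp add: norm_mult norm_power norm_qexp exp_of_nat_mult[symmetric] mult_ac)
      also have "\<dots> \<le> (B * exp (2 * pi * k * Im \<tau>)) * exp (- (2 * pi * k * Im \<tau>))"
        using k(3)[of \<tau>] \<tau> by (intro mult_right_mono) (auto simp: mob_def)
      also have "\<dots> = B" by (simp add: exp_minus)
      finally show ?thesis .
    qed
    have p_bd: "norm (poly Q (T \<tau>) * qexp \<tau> ^ degree Q) \<le> S"
      unfolding S_def using Y1[of \<tau>] norm_qexp_less_1[OF \<tau>(1)] \<tau> by (intro poly_q_growth) auto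
    have "g \<tau> * qexp \<tau> ^ (k + degree Q) = (f \<tau> * qexp \<tau> ^ k) * (poly Q (T \<tau>) * qexp \<tau> ^ degree Q)"
      by (simp add: g_def power_add mult_ac)
    then show ?thesis using f_bd p_bd k(2) by (simp only: norm_mult[of "f \<tau> * qexp \<tau> ^ k"]) (intro mult_mono, auto)
  qed
  have F_growth: "norm (F \<tau> * qexp \<tau> ^ (k + degree Q)) \<le> B * S" if \<tau>: "Im \<tau> > 0" "Im \<tau> > max Y Y1" for \<tau>
  proof (rule isCont_norm_bound[where F = "\<lambda>\<tau>. F \<tau> * qexp \<tau> ^ (k + degree Q)"])
    show "isCont (\<lambda>\<tau>. F \<tau> * qexp \<tau> ^ (k + degree Q)) \<tau>"
      by (rule isCont_holomorphic_upper_half_plane[OF _ \<tau>(1)]) (intro holomorphic_intros F_hol)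
    show "\<forall>\<^sub>F w in at \<tau>. norm (F w * qexp w ^ (k + degree Q)) \<le> B * S"
      using F_ev[OF \<tau>(1)] eventually_at_upper_half_plane[OF \<tau>(1)] eventually_at_Im_gt[OF \<tau>(2)]
      by eventually_elim (simp only: g_growth)
  qed
  obtain P B' Y' where P: "\<And>\<tau>. Im \<tau> > 0 \<Longrightarrow> Im \<tau> > Y' \<Longrightarrow> norm (F \<tau> - poly P (T \<tau>)) \<le> B'"
    using subtract_polynomial[OF F_hol invariant_shift[OF F_inv] T_hol invariant_shift[OF T_inv]
        expansion_tendsto(1)[OF T_exp] F_growth] by blast
  define E where "E = (\<lambda>\<tau>. F \<tau> - poly P (T \<tau>))"
  have E_inv: "E (moebius M \<tau>) = E \<tau>" if "M \<in> G" "Im \<tau> > 0" for M \<tau>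
    using F_inv[OF that] T_inv[OF that] by (simp add: E_def)
  have E_hol: "E holomorphic_on {\<tau>. Im \<tau> > 0}"
    unfolding E_def by (intro holomorphic_intros F_hol T_hol)
  have E_cusp: "cusp_bounded E (a, b, c, d)" if "a * d - b * c = 1" "cusp_bounded T (a, b, c, d)" for a b c d
    unfolding E_def by (intro cusp_bounded_diff F_cusp that cusp_bounded_poly_T)
  have E_inf: "norm (E \<tau>) \<le> B'" if "Im \<tau> > 0" "Im \<tau> > Y'" for \<tau>
    using P[OF that] by (simp add: E_def)
  obtain e where e: "\<And>\<tau>. Im \<tau> > 0 \<Longrightarrow> E \<tau> = e"
    using bounded_invariant_constant[OF E_hol E_inv E_cusp E_inf] by blast
  have F_eq: "F \<tau> = poly (P + [:e:]) (T \<tau>)" if "Im \<tau> > 0" for \<tau>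
    using e[OF that] by (simp add: E_def algebra_simps)
  have "\<forall>\<^sub>F \<tau> in cosparse {\<tau>. Im \<tau> > 0}. F \<tau> = g \<tau>"
    unfolding eventually_cosparse_open_eq[OF open_upper_half_plane] using F_ev by auto
  moreover have "\<forall>\<^sub>F \<tau> in cosparse {\<tau>. Im \<tau> > 0}. \<tau> \<in> {\<tau>. Im \<tau> > 0}"
    by (intro eventually_in_cosparse open_upper_half_plane) auto
  ultimately have "\<forall>\<^sub>F \<tau> in cosparse {\<tau>. Im \<tau> > 0}. poly Q (T \<tau>) \<noteq> 0 \<and> f \<tau> = poly (P + [:e:]) (T \<tau>) / poly Q (T \<tau>)"
    using T_equation_cosparse[OF Q0]
    by eventually_elim (use F_eq in \<open>auto simp: g_def field_simps\<close>)
  then show ?thesis by blast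
qed

theorem principal_modulus_T: "principal_modulus G T"
  unfolding principal_modulus_def
  using T_hol T_in_function_field function_field_rational by (auto simp: upper_half_plane_def)

text \<open>A second principal modulus \<open>f\<close> with the same expansion is finite at the cusps where \<open>T\<close> is, since
  \<open>T = R(f)/S(f)\<close> with \<open>deg R > deg S\<close>.\<close>

theorem principal_modulus_unique:
  assumes f: "principal_modulus G f" "has_principal_expansion f \<kappa>" and "Im \<tau>\<^sub>0 > 0"
  shows "f \<tau>\<^sub>0 = T \<tau>\<^sub>0"
proof -
  have f_hol: "f holomorphic_on {\<tau>. Im \<tau> > 0}" and fF: "f \<in> function_field G"
    using f(1) by (auto simp: principal_modulus_def upper_half_plane_def)
  have inv: "\<And>M \<tau>. M \<in> G \<Longrightarrow> Im \<tau> > 0 \<Longrightarrow> f (moebius M \<tau>) = f \<tau>"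
    using fF by (auto simp: function_field_def upper_half_plane_def)
  have cusp: "meromorphic_at_cusp f (mat2 (of_int a) (of_int b) (of_int c) (of_int d))"
    if "a * d - b * c = 1" for a b c d
    using fF that unfolding function_field_def SL2Z_def by blast
  obtain R S where RS: "\<forall>\<^sub>F \<tau> in cosparse {\<tau>. Im \<tau> > 0}. poly S (f \<tau>) \<noteq> 0 \<and> T \<tau> = poly R (f \<tau>) / poly S (f \<tau>)"
    using f(1) T_in_function_field unfolding principal_modulus_def upper_half_plane_def by blast
  have ev: "\<forall>\<^sub>F \<tau> in at z. T \<tau> * poly S (f \<tau>) = poly R (f \<tau>) \<and> poly S (f \<tau>) \<noteq> 0" if "Im z > 0" for z
    using eventually_cosparse_imp_eventually_at[OF RS, of z UNIV] that by (auto elim!: eventually_mono simp: field_simps)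
  \<comment> \<open>The rational identity holds off a sparse set only; cleared of denominators, both
    sides are continuous, so it holds everywhere.\<close>
  have eq: "T z * poly S (f z) = poly R (f z)" if "Im z > 0" for z
  proof (rule LIM_unique)
    have "isCont (\<lambda>z. T z * poly S (f z)) z" "isCont (\<lambda>z. poly R (f z)) z"
      by (rule isCont_holomorphic_upper_half_plane[OF _ that], intro holomorphic_intros T_hol f_hol)+
    then show "(\<lambda>z. T z * poly S (f z)) \<midarrow>z\<rightarrow> T z * poly S (f z)" "(\<lambda>z. T z * poly S (f z)) \<midarrow>z\<rightarrow> poly R (f z)"
      unfolding isCont_def using Lim_transform_eventually[of "\<lambda>z. poly R (f z)" _ "at z" "\<lambda>z. T z * poly S (f z)"]
        eventually_mono[OF ev[OF that]] by (auto elim!: eventually_mono)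
  qed
  have S0: "S \<noteq> 0"
  proof
    assume "S = 0"
    then have "\<forall>\<^sub>F \<tau> in at \<i>. False" using ev[of \<i>] by simp
    then show False by simp
  qed
  have R0: "R \<noteq> 0"
  proof
    assume "R = 0"
    have "Im \<i> > 0" by simp
    from ev[OF this] eventually_at_upper_half_plane[OF this] have "\<forall>\<^sub>F \<tau> in at \<i>. False"
      by eventually_elim (use \<open>R = 0\<close> T_nonzero in auto)
    then show False by simp
  qed
  obtain X1 where X1: "X1 \<ge> 1" "\<And>x. norm x \<ge> X1 \<Longrightarrow>
     norm (lead_coeff R) / 2 * norm x ^ degree R \<le> norm (poly R x) \<and> norm (poly R x) \<le> 2 * norm (lead_coeff R) * norm x ^ degree R"
    using poly_growth[OF R0] by blast
  obtain X2 where X2: "X2 \<ge> 1" "\<And>x. norm x \<ge> X2 \<Longrightarrow>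
     norm (lead_coeff S) / 2 * norm x ^ degree S \<le> norm (poly S x) \<and> norm (poly S x) \<le> 2 * norm (lead_coeff S) * norm x ^ degree S"
    using poly_growth[OF S0] by blast
  define r s where "r = norm (lead_coeff R)" and "s = norm (lead_coeff S)"
  have rs: "r > 0" "s > 0" using R0 S0 by (simp_all add: r_def s_def)
  \<comment> \<open>Otherwise R(f)/S(f) would remain bounded as f tends to infinity, whereas
    \<open>T\<close> tends to infinity together with \<open>f\<close> as \<tau> does.\<close>
  have deg: "degree R > degree S"
  proof (rule ccontr)
    assume "\<not> degree R > degree S"
    then have le: "degree R \<le> degree S" by simp
    have "\<forall>\<^sub>F \<tau> in at_i_infinity. norm (f \<tau>) \<ge> max X1 X2"
      using expansion_at_infinity[OF f(2)] unfolding filterlim_at_top by blast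
    moreover have "\<forall>\<^sub>F \<tau> in at_i_infinity. norm (T \<tau>) \<ge> 4 * r / s + 1"
      using expansion_at_infinity[OF T_exp] unfolding filterlim_at_top by blast
    ultimately have "\<forall>\<^sub>F \<tau> in at_i_infinity. False"
      using eventually_Im_gt_at_i_infinity[of 0]
    proof eventually_elim
      case (elim \<tau>)
      define x where "x = norm (f \<tau>)"
      have x: "x \<ge> 1" "x \<ge> X1" "x \<ge> X2" using elim X1(1) by (auto simp: x_def)
      have xs: "x ^ degree S > 0" using x by simp
      have "norm (T \<tau>) * (s / 2 * x ^ degree S) \<le> norm (T \<tau>) * norm (poly S (f \<tau>))"
        using X2(2)[of "f \<tau>"] x by (intro mult_left_mono) (auto simp: x_def s_def)
      also have "\<dots> = norm (poly R (f \<tau>))" using eq[OF elim(3)] by (simp add: norm_mult[symmetric])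
      also have "\<dots> \<le> 2 * r * x ^ degree R" using X1(2)[of "f \<tau>"] x by (auto simp: x_def r_def)
      also have "\<dots> \<le> 2 * r * x ^ degree S" using le x rs by (intro mult_left_mono power_increasing) auto
      finally have "(norm (T \<tau>) * (s / 2)) * x ^ degree S \<le> (2 * r) * x ^ degree S" by (simp add: mult_ac)
      then have "norm (T \<tau>) * (s / 2) \<le> 2 * r" using xs by simp
      then have "norm (T \<tau>) \<le> 4 * r / s" using rs by (simp add: field_simps)
      then show ?case using elim by simp
    qed
    then show False by simp
  qed
  have f_cusp: "cusp_bounded f (a, b, c, d)" if det: "a * d - b * c = 1" and Tb: "cusp_bounded T (a, b, c, d)" for a b c d
  proof -
    obtain B Y where BY: "\<And>\<tau>. Im \<tau> > 0 \<Longrightarrow> Im \<tau> > Y \<Longrightarrow> norm (T (mob a b c d \<tau>)) \<le> B"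
      using Tb by (auto simp: cusp_bounded_def)
    \<comment> \<open>Beyond \<open>X1\<close> and \<open>X2\<close> both polynomials are within a
      factor 2 of their leading terms; since deg R > deg S, |f| > 4 s |B| / r would then force |T| >
      |B|.\<close>
    define C where "C = max (max X1 X2) (4 * s * \<bar>B\<bar> / r + 1)"
    have "norm (f (mob a b c d \<tau>)) \<le> C" if \<tau>: "Im \<tau> > 0" "Im \<tau> > Y" for \<tau>
    proof (rule ccontr)
      define z where "z = mob a b c d \<tau>"
      define x where "x = norm (f z)"
      assume "\<not> norm (f (mob a b c d \<tau>)) \<le> C"
      then have x: "x \<ge> 1" "x \<ge> X1" "x \<ge> X2" "x > 4 * s * \<bar>B\<bar> / r"
        using X1(1) by (auto simp: x_def z_def C_def)
      have z: "Im z > 0" unfolding z_def using det \<tau> by (intro Im_mob_pos) auto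
      have xs: "x ^ degree S > 0" using x by simp
      have "r / 2 * x ^ degree R \<le> norm (poly R (f z))" using X1(2)[of "f z"] x by (auto simp: x_def r_def)
      also have "\<dots> = norm (T z) * norm (poly S (f z))" using eq[OF z] by (simp add: norm_mult[symmetric])
      also have "\<dots> \<le> \<bar>B\<bar> * (2 * s * x ^ degree S)"
        using X2(2)[of "f z"] x BY[OF \<tau>] by (intro mult_mono) (auto simp: x_def s_def z_def)
      finally have "r / 2 * x ^ degree R \<le> \<bar>B\<bar> * (2 * s * x ^ degree S)" .
      moreover have "x ^ Suc (degree S) \<le> x ^ degree R" using deg x by (intro power_increasing) auto
      then have "r / 2 * x ^ Suc (degree S) \<le> r / 2 * x ^ degree R" using rs by (intro mult_left_mono) auto
      ultimately have "(r / 2 * x) * x ^ degree S \<le> (\<bar>B\<bar> * (2 * s)) * x ^ degree S" by (simp add: mult_ac)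
      then have "r / 2 * x \<le> \<bar>B\<bar> * (2 * s)" using xs by simp
      then have "x \<le> 4 * s * \<bar>B\<bar> / r" using rs by (simp add: field_simps)
      then show False using x by simp
    qed
    then show ?thesis unfolding cusp_bounded_def by auto
  qed
  define E where "E = (\<lambda>\<tau>. f \<tau> - T \<tau>)"
  have E_lim: "(E \<longlongrightarrow> 0) at_i_infinity"
    using tendsto_diff[OF expansion_tendsto(2)[OF f(2)] expansion_tendsto(2)[OF T_exp]]
    by (simp add: E_def)
  have "\<forall>\<^sub>F \<tau> in at_i_infinity. norm (E \<tau>) < 1"
    using tendsto_norm_zero[OF E_lim] by (rule order_tendstoD) simp
  then obtain Y' where Y': "\<And>\<tau>. Im \<tau> > Y' \<Longrightarrow> norm (E \<tau>) < 1" by (auto simp: eventually_at_i_infinity)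
  have E_inv: "E (moebius M \<tau>) = E \<tau>" if "M \<in> G" "Im \<tau> > 0" for M \<tau>
    using inv[OF that] T_inv[OF that] by (simp add: E_def)
  have E_hol: "E holomorphic_on {\<tau>. Im \<tau> > 0}"
    unfolding E_def by (intro holomorphic_intros f_hol T_hol)
  have E_cusp: "cusp_bounded E (a, b, c, d)" if "a * d - b * c = 1" "cusp_bounded T (a, b, c, d)" for a b c d
    unfolding E_def by (intro cusp_bounded_diff f_cusp that)
  obtain e where e: "\<And>\<tau>. Im \<tau> > 0 \<Longrightarrow> E \<tau> = e"
    using bounded_invariant_constant[OF E_hol E_inv E_cusp less_imp_le[OF Y']] by blast
  have "\<forall>\<^sub>F \<tau> in at_i_infinity. E \<tau> = e"
    using eventually_Im_gt_at_i_infinity[of 0] by eventually_elim (rule e)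
  then have "((\<lambda>_. e) \<longlongrightarrow> 0) at_i_infinity" using E_lim by (simp add: tendsto_cong)
  then have "e = 0" using tendsto_const_iff[OF at_i_infinity_neq_bot] by blast
  then show ?thesis using e[OF assms(3)] by (simp add: E_def)
qed

end

section \<open>Eta quotients as principal moduli\<close>

text \<open>The condition on the divisors \<open>g\<close> of \<open>N\<close> is Ligozat's formula for the order of the eta quotient
  at a cusp \<open>a/c\<close> with \<open>gcd(c, N) = g\<close>, up to the positive factor \<open>24N\<close>; the cusps exempted from it are the
  images of \<open>i\<infinity>\<close>.  An entry \<open>(e, a, b, c, d)\<close> of \<open>ws\<close> stands for \<open>(ae, b; cN, de)\<close>.\<close>

definition eta_data_ok :: "int \<Rightarrow> (int \<times> int \<times> int \<times> int \<times> int) list \<Rightarrow> (int \<times> int) list \<Rightarrow>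
    (int \<times> int \<times> int \<times> int) list \<Rightarrow> bool" where
  "eta_data_ok N ws rs gs \<longleftrightarrow>
     N > 1 \<and> (\<Sum>(n, r)\<leftarrow>rs. r) = 0 \<and> (\<Sum>(n, r)\<leftarrow>rs. n * r) = - 24 \<and>
     (\<forall>(n, r)\<in>set rs. n > 0 \<and> N mod n = 0) \<and>
     ford_chain N 0 1 gs \<and> (\<forall>(a, b, c, d)\<in>set gs. c mod N = 0 \<and> al_ok 1 rs (a, b, c, d)) \<and>
     (\<forall>(e, a, b, c, d)\<in>set ws. e > 0 \<and> N mod e = 0 \<and> gcd e (N div e) = 1 \<and> al_ok e rs (a * e, b, c * N, d * e)) \<and>
     (\<forall>g\<in>set [1..N]. N mod g = 0 \<longrightarrow> g = N \<or> (\<exists>(e, a, b, c, d)\<in>set ws. g * e = N) \<or>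
        (\<Sum>(n, r)\<leftarrow>rs. r * (gcd n g)\<^sup>2 * (N div n)) \<ge> 0)"

text \<open>\<open>T\<close> has to agree with the eta quotient on the upper half-plane only, where
  the group acts; the list \<open>ws\<close> provides one matrix for each coset other than
  Gamma0(N).\<close>

locale eta_data =
  fixes N :: int and ws :: "(int \<times> int \<times> int \<times> int \<times> int) list" and rs :: "(int \<times> int) list"
    and gs :: "(int \<times> int \<times> int \<times> int) list" and S :: "nat set" and T :: "complex \<Rightarrow> complex"
  assumes ok: "eta_data_ok N ws rs gs"
    and S: "S = insert 1 ((\<lambda>(e, _). nat e) ` set ws)"
    and T: "\<And>\<tau>. Im \<tau> > 0 \<Longrightarrow> T \<tau> = eta_quot rs \<tau>"
begin

lemma N: "N > 1" using ok by (simp add: eta_data_ok_def)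

lemma rs_pos: "\<forall>(n, r)\<in>set rs. n > 0" using ok by (auto simp: eta_data_ok_def)

lemma rs_dvd: "(n, r) \<in> set rs \<Longrightarrow> n dvd N" using ok by (auto simp: eta_data_ok_def)

lemma T_translate: "Im \<tau> > 0 \<Longrightarrow> T (\<tau> + of_int k) = T \<tau>"
  using ok by (simp add: T eta_quot_plus_of_int eta_data_ok_def)

lemma T_al_ok:
  assumes "al_ok e rs (a, b, c, d)" "Im \<tau> > 0"
  shows "T (mob a b c d \<tau>) = T \<tau>"
proof -
  have "a * d - b * c > 0" using assms(1) by (simp add: al_ok_def)
  then have "Im (mob a b c d \<tau>) > 0" using assms(2) by (intro Im_mob_pos) auto
  then show ?thesis using eta_quot_al_invariant[OF assms] assms(2) by (simp add: T)
qed

lemma T_Gamma0: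
  assumes "a * d - b * c = 1" "N dvd c" "Im \<tau> > 0"
  shows "T (mob a b c d \<tau>) = T \<tau>"
proof (rule Gamma0_invariant[OF N T_translate _ _ assms])
  fix a b c d assume "(a, b, c, d) \<in> set gs"
  then have "c mod N = 0" and ok1: "al_ok 1 rs (a, b, c, d)" using ok by (auto simp: eta_data_ok_def)
  then show "N dvd c \<and> a * d - b * c = 1 \<and> (\<forall>\<tau>. Im \<tau> > 0 \<longrightarrow> T (mob a b c d \<tau>) = T \<tau>)"
    using T_al_ok[OF ok1] ok1 by (auto simp: al_ok_def)
qed (use ok in \<open>auto simp: eta_data_ok_def\<close>)

text \<open>One matrix under which \<open>T\<close> is invariant for every \<open>e\<close> in
  \<open>S\<close>: the identity if e = 1, otherwise the entry of \<open>ws\<close>.\<close>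

lemma S_cases:
  assumes "e \<in> S"
  obtains a b c d where "e > 0" "int e dvd N" "coprime (int e) (N div int e)"
    "a * d * int e - b * c * (N div int e) = 1"
    "\<And>\<tau>. Im \<tau> > 0 \<Longrightarrow> T (mob (a * int e) b (c * N) (d * int e) \<tau>) = T \<tau>"
proof (cases "e = 1")
  case True
  show ?thesis by (rule that[of 1 1 0 0]) (use True in \<open>auto simp: mob_def\<close>)
next
  case False
  then obtain e' a b c d where w: "(e', a, b, c, d) \<in> set ws" "e = nat e'"
    using assms S by auto
  then have e': "e' > 0" "e' dvd N" "gcd e' (N div e') = 1" and al: "al_ok e' rs (a * e', b, c * N, d * e')"
    using ok by (auto simp: eta_data_ok_def)
  obtain N' where N': "N = e' * N'" using e'(2) by blast
  have "(a * e') * (d * e') - b * (c * N) = e'"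
    using al by (simp only: al_ok_def prod.case)
  moreover have "(a * e') * (d * e') - b * (c * N) = e' * (a * d * e' - b * c * N')"
    unfolding N' by (simp only: algebra_simps)
  ultimately have "a * d * e' - b * c * N' = 1" using e'(1) by simp
  then show ?thesis using e' T_al_ok[OF al] w(2)
    by (intro that[of a d b c]) (auto simp: N' coprime_iff_gcd_eq_1)
qed

lemma moebius_eq_mob:
  assumes "e > 0"
  shows "moebius ((1 / sqrt (real e)) *\<^sub>R mat2 (of_int a * real e) (of_int b) (of_int c * real (nat N)) (of_int d * real e)) =
    mob (a * int e) b (c * N) (d * int e)" (is "moebius ?M = _")
proof
  fix \<tau>
  define k where "k = complex_of_real (1 / sqrt (real e))"
  have "k \<noteq> 0" using assms by (simp add: k_def)
  moreover have "moebius ?M \<tau> = (k * (of_int (a * int e) * \<tau> + of_int b)) / (k * (of_int (c * N) * \<tau> + of_int (d * int e)))"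
    using N unfolding moebius_def mat2_def by (simp add: k_def algebra_simps)
  ultimately show "moebius ?M \<tau> = mob (a * int e) b (c * N) (d * int e) \<tau>" by (simp add: mob_def)
qed

lemma Gamma0_plusE:
  assumes "M \<in> Gamma0_plus (nat N) S"
  obtains a b c d e where "e \<in> S" "e > 0" "int e dvd N" "a * d * int e - b * c * (N div int e) = 1"
    "M = (1 / sqrt (real e)) *\<^sub>R mat2 (of_int a * real e) (of_int b) (of_int c * real (nat N)) (of_int d * real e)"
    "moebius M = mob (a * int e) b (c * N) (d * int e)"
proof -
  obtain a b c d e where e: "e \<in> S" and M: "M = (1 / sqrt (real e)) *\<^sub>R mat2 (of_int a * real e) (of_int b) (of_int c * real (nat N)) (of_int d * real e)"
    and det: "of_int a * of_int d * real e - of_int b * of_int c * real (nat N) / real e = (1 :: real)"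
    using assms unfolding Gamma0_plus_def by blast
  have e': "e > 0" "int e dvd N" by (rule S_cases[OF e]; assumption)+
  obtain N' where N': "N = int e * N'" using e'(2) by blast
  have "real (nat N) = real e * of_int N'" using N by (simp add: N')
  then have "real_of_int (a * d * int e - b * c * N') = of_int 1" using det e'(1) by simp
  then have "a * d * int e - b * c * (N div int e) = 1" using e'(1) by (simp only: of_int_eq_iff) (simp add: N')
  moreover have "moebius M = mob (a * int e) b (c * N) (d * int e)"
    unfolding M using e'(1) by (rule moebius_eq_mob)
  ultimately show ?thesis using that e e' M by blast
qed

lemma mat2_in_Gamma0_plus:
  assumes "a * d - b * c = 1" "N dvd c"
  shows "mat2 (of_int a) (of_int b) (of_int c) (of_int d) \<in> Gamma0_plus (nat N) S"
proof -
  obtain c' where c': "c = N * c'" using assms(2) by blast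
  have "real_of_int (a * d - b * c) = 1" unfolding assms(1) by simp
  then show ?thesis
    unfolding Gamma0_plus_def using N
    by (intro CollectI exI[of _ a] exI[of _ b] exI[of _ c'] exI[of _ d] exI[of _ 1])
       (auto simp: S c' mult_ac)
qed

lemma T_invariant:
  assumes "M \<in> Gamma0_plus (nat N) S" "Im \<tau> > 0"
  shows "T (moebius M \<tau>) = T \<tau>"
  using assms(1)
proof (rule Gamma0_plusE)
  fix a b c d e
  assume e: "e \<in> S" "e > 0" "int e dvd N" and det: "a * d * int e - b * c * (N div int e) = 1"
    and M: "moebius M = mob (a * int e) b (c * N) (d * int e)"
  obtain a0 b0 c0 d0 where W: "a0 * d0 * int e - b0 * c0 * (N div int e) = 1"
    "\<And>\<tau>. Im \<tau> > 0 \<Longrightarrow> T (mob (a0 * int e) b0 (c0 * N) (d0 * int e) \<tau>) = T \<tau>"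
    by (rule S_cases[OF e(1)]) (rule that; assumption)
  obtain N' where N': "N = int e * N'" using e(3) by blast
  have ND: "N div int e = N'" using e(2) by (simp add: N')
  define z where "z = mob (a0 * int e) b0 (c0 * N) (d0 * int e) \<tau>"
  have det0: "(a0 * int e) * (d0 * int e) - b0 * (c0 * N) = int e * (a0 * d0 * int e - b0 * c0 * N')"
    by (simp add: N' algebra_simps)
  then have pos: "(a0 * int e) * (d0 * int e) - b0 * (c0 * N) > 0" using W(1) e(2) by (simp add: ND)
  then have z: "Im z > 0" unfolding z_def by (intro Im_mob_pos assms(2))
  have nz: "of_int (c0 * N) * \<tau> + of_int (d0 * int e) \<noteq> (0 :: complex)"
    using pos by (intro mob_denominator_nonzero[OF assms(2)]) auto
  \<comment> \<open>The given matrix times the inverse of the chosen one for the same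
    \<open>e\<close>. The factor 1/e from the determinant cancels, and the lower left entry is
    divisible by N, so the product lies in Gamma0(N).\<close>
  define A B C D where "A = a * d0 * int e - b * c0 * N'" and "B = b * a0 - a * b0"
    and "C = N * (c * d0 - d * c0)" and "D = d * a0 * int e - c * b0 * N'"
  have k: "a0 * d0 * int e = 1 + b0 * c0 * N'" using W(1) by (simp add: ND)
  have "A * (a0 * int e) + B * (c0 * N) = a * int e * (a0 * d0 * int e - b0 * c0 * N')"
       "A * b0 + B * (d0 * int e) = b * (a0 * d0 * int e - b0 * c0 * N')"
       "C * (a0 * int e) + D * (c0 * N) = c * N * (a0 * d0 * int e - b0 * c0 * N')"
       "C * b0 + D * (d0 * int e) = d * int e * (a0 * d0 * int e - b0 * c0 * N')"
    by (simp_all add: A_def B_def C_def D_def N' algebra_simps)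
  then have "mob (a * int e) b (c * N) (d * int e) \<tau> = mob A B C D z"
    unfolding z_def mob_mob[OF nz] using W(1) by (simp add: ND)
  moreover have "A * D - B * C = (a * d * int e - b * c * N') * (a0 * d0 * int e - b0 * c0 * N')"
    by (simp add: A_def B_def C_def D_def N' algebra_simps)
  then have "A * D - B * C = 1" using W(1) det by (simp add: ND)
  then have "T (mob A B C D z) = T z" by (rule T_Gamma0[OF _ _ z]) (simp add: C_def)
  moreover have "T z = T \<tau>" unfolding z_def by (rule W(2)[OF assms(2)])
  ultimately show ?thesis by (simp add: M)
qed

text \<open>The behaviour at a/c depends on g = gcd(c, N) only. If g e = N with \<open>e\<close> in
  \<open>S\<close>, write c = g c'; then c' N = e c, so a matrix of the coset \<open>e\<close> with
  first column (ae, c' N) sends infinity to a/c. In the other case Ligozat's formula gives a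
  nonnegative order.\<close>

lemma cusp_finite_or_infinity:
  assumes det: "a * d - b * c = 1"
  shows "(\<exists>B Y. \<forall>\<tau>. Im \<tau> > 0 \<longrightarrow> Im \<tau> > Y \<longrightarrow> norm (T (mob a b c d \<tau>)) \<le> B) \<or>
    (\<exists>M \<alpha> \<beta>. M \<in> Gamma0_plus (nat N) S \<and> \<alpha> > 0 \<and>
       (\<forall>\<tau>. Im \<tau> > 0 \<longrightarrow> mob a b c d \<tau> = moebius M (of_real \<alpha> * \<tau> + of_real \<beta>)))"
proof -
  define g where "g = gcd c N"
  have g: "g > 0" "g dvd N" using N by (auto simp: g_def)
  consider e where "e \<in> S" "g * int e = N" | "(\<Sum>(n, r)\<leftarrow>rs. r * (gcd n g)\<^sup>2 * (N div n)) \<ge> 0"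
  proof -
    have "g \<in> set [1..N]" using g zdvd_imp_le[of g N] N by auto
    then have "g = N \<or> (\<exists>(e, a, b, c, d)\<in>set ws. g * e = N) \<or> (\<Sum>(n, r)\<leftarrow>rs. r * (gcd n g)\<^sup>2 * (N div n)) \<ge> 0"
      using ok g(2) by (auto simp: eta_data_ok_def)
    then consider "g = N" | e a b c d where "(e, a, b, c, d) \<in> set ws" "g * e = N" | "(\<Sum>(n, r)\<leftarrow>rs. r * (gcd n g)\<^sup>2 * (N div n)) \<ge> 0"
      by blast
    then show ?thesis
    proof cases
      case 1
      show ?thesis by (rule that(1)[of 1]) (use 1 in \<open>auto simp: S\<close>)
    next
      case (2 e a b c d)
      have e: "e > 0" using 2(1) ok by (auto simp: eta_data_ok_def)
      have "nat e \<in> (\<lambda>(e, _). nat e) ` set ws" using 2(1) by force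
      then show ?thesis using 2(2) e by (intro that(1)[of "nat e"]) (auto simp: S)
    next
      case 3
      then show ?thesis by (rule that(2))
    qed
  qed
  then show ?thesis
  proof cases
    case (1 e)
    have e: "e > 0" "int e dvd N" "coprime (int e) (N div int e)"
      by (rule S_cases[OF 1(1)]; assumption)+
    have Ng: "N div int e = g" using 1(2) e(1) by (metis nonzero_mult_div_cancel_right of_nat_0_less_iff less_irrefl)
    obtain c' where c': "c = g * c'" unfolding g_def by (meson gcd_dvd1 dvdE)
    have "gcd c N = g * gcd c' (int e)"
      unfolding c' 1(2)[symmetric] using g(1) by (simp add: gcd_mult_distrib_int[symmetric])
    then have "coprime c' (int e)" using g(1) by (simp add: g_def[symmetric] coprime_iff_gcd_eq_1)
    moreover have "coprime a c" by (rule coprime_of_det[OF det])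
    ultimately have "coprime (a * int e) (c' * g)"
      using e(3) unfolding Ng c' by (simp add: coprime_commute)
    then obtain d1 b1 where bz: "(a * int e) * d1 - b1 * (c' * g) = 1"
      using bezout_int[of "a * int e" "c' * g"] by (metis coprime_iff_gcd_eq_1 diff_minus_eq_add mult.commute mult_minus_left)
    define M where "M = (1 / sqrt (real e)) *\<^sub>R mat2 (of_int a * real e) (of_int b1) (of_int c' * real (nat N)) (of_int d1 * real e)"
    have MG: "M \<in> Gamma0_plus (nat N) S"
    proof -
      have "real (nat N) = of_int g * real e" using N by (simp add: 1(2)[symmetric])
      moreover have "real_of_int (a * int e * d1 - b1 * (c' * g)) = 1" unfolding bz by simp
      ultimately have "of_int a * of_int d1 * real e - of_int b1 * of_int c' * real (nat N) / real e = (1 :: real)"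
        using e(1) by (simp add: mult_ac)
      then show ?thesis unfolding Gamma0_plus_def M_def using 1(1) by blast
    qed
    \<comment> \<open>Chosen so that the integral form of \<open>M\<close> times
      \<open>(1, \<beta>; 0, e)\<close> is e times \<open>(a, b; c, d)\<close>; the facts
      \<open>c1\<close> and \<open>c2\<close> are its second column.\<close>
    define \<beta> where "\<beta> = d1 * int e * b - b1 * d"
    have "mob a b c d \<tau> = moebius M (of_real (1 / e) * \<tau> + of_real (\<beta> / e))" if \<tau>: "Im \<tau> > 0" for \<tau>
    proof -
      have z: "of_real (1 / e) * \<tau> + of_real (\<beta> / e) = mob 1 \<beta> 0 (int e) \<tau>"
        by (simp add: mob_def add_divide_distrib)
      have nz: "of_int 0 * \<tau> + of_int (int e) \<noteq> (0 :: complex)" using e(1) by simp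
      have Ne: "N = g * int e" using 1(2) by simp
      have ade: "a * int e * d1 = 1 + b1 * (c' * g)" using bz by simp
      have ad: "a * d = 1 + b * c" using det by simp
      have c1: "(a * int e) * \<beta> + b1 * int e = int e * b"
      proof -
        have "(a * int e) * \<beta> + b1 * int e = int e * ((a * int e * d1) * b - b1 * (a * d) + b1)"
          by (simp add: \<beta>_def algebra_simps)
        also have "\<dots> = int e * b" unfolding ade ad by (simp add: c' algebra_simps)
        finally show ?thesis .
      qed
      have c2: "(c' * N) * \<beta> + (d1 * int e) * int e = int e * d"
      proof -
        have "(c' * N) * \<beta> + (d1 * int e) * int e = int e * (d1 * int e * (1 + b * c) - b1 * (c' * g) * d)"
          by (simp add: \<beta>_def Ne c' algebra_simps)
        also have "\<dots> = int e * ((a * int e * d1) * d - b1 * (c' * g) * d)"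
          unfolding ad[symmetric] by (simp add: algebra_simps)
        also have "\<dots> = int e * d" unfolding ade by (simp add: algebra_simps)
        finally show ?thesis .
      qed
      have "moebius M = mob (a * int e) b1 (c' * N) (d1 * int e)"
        unfolding M_def using e(1) by (rule moebius_eq_mob)
      then have "moebius M (of_real (1 / e) * \<tau> + of_real (\<beta> / e)) = mob (int e * a) (int e * b) (int e * c) (int e * d) \<tau>"
        unfolding z by (simp only: mob_mob[OF nz] c1 c2) (simp add: c' Ne mult_ac)
      also have "\<dots> = (of_nat e * (of_int a * \<tau> + of_int b)) / (of_nat e * (of_int c * \<tau> + of_int d))"
        by (simp add: mob_def algebra_simps)
      also have "\<dots> = mob a b c d \<tau>" using e(1) by (simp add: mob_def)
      finally show ?thesis ..
    qed
    then show ?thesis using MG e(1) by (intro disjI2 exI[of _ M] exI[of _ "1 / real e"] exI[of _ "\<beta> / real e"]) auto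
  next
    case 2
    \<comment> \<open>Multiplication by N clears the denominators, and gcd(n, g) = gcd(n, c) because
      n divides N. So the integer sum tested in \<open>eta_data_ok\<close> has the sign of the
      order.\<close>
    have "real_of_int N * cusp_order rs' c = of_int (\<Sum>(n, r)\<leftarrow>rs'. r * (gcd n g)\<^sup>2 * (N div n))" if "set rs' \<subseteq> set rs" for rs'
      using that
    proof (induction rs')
      case (Cons p rs')
      obtain n r where p: "p = (n, r)" by fastforce
      have n: "n > 0" "n dvd N" using Cons.prems rs_pos rs_dvd by (auto simp: p)
      then obtain k where k: "N = n * k" by blast
      have "gcd n g = gcd n c"
      proof -
        have "gcd n g = gcd (gcd n N) c" by (simp add: g_def gcd.commute gcd.left_commute)
        also have "gcd n N = n" using n by (simp add: gcd_proj1_iff)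
        finally show ?thesis .
      qed
      then show ?case using Cons n by (simp add: p cusp_order_def k algebra_simps)
    qed (simp add: cusp_order_def)
    from this[of rs] 2 have "real_of_int N * cusp_order rs c \<ge> 0" by simp
    then have ord: "pi / 12 * cusp_order rs c \<ge> 0" using N by (simp add: zero_le_mult_iff)
    obtain K where K: "K > 0" "((\<lambda>\<tau>. norm (eta_quot rs (mob a b c d \<tau>)) *
        exp (pi / 12 * cusp_order rs c * Im \<tau>)) \<longlongrightarrow> K) at_i_infinity"
      using norm_eta_quot_cusp[OF det rs_pos] ok by (auto simp: eta_data_ok_def)
    obtain B Y where BY: "\<And>\<tau>. Im \<tau> > Y \<Longrightarrow> norm (eta_quot rs (mob a b c d \<tau>)) \<le> B"
      using bounded_of_exp_asymptotics[OF ord K(2)] by blast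
    have "norm (T (mob a b c d \<tau>)) \<le> B" if "Im \<tau> > 0" "Im \<tau> > Y" for \<tau>
      using BY[OF that(2)] Im_mob_pos[OF that(1), of a d b c] det by (simp add: T)
    then show ?thesis by blast
  qed
qed

lemma hauptmodul_eta_quot:
  assumes "(\<Sum>(n, r)\<leftarrow>rs. if n = 1 then r else 0) = int k"
  shows "hauptmodul (Gamma0_plus (nat N) S) (nat N) T (- of_nat k)"
proof
  show "nat N > 0" using N by simp
  show "det2 M > 0" if "M \<in> Gamma0_plus (nat N) S" for M
    using that
  proof (rule Gamma0_plusE)
    fix a b c d e
    assume e: "e > 0" "int e dvd N" and det: "a * d * int e - b * c * (N div int e) = 1"
      and M: "M = (1 / sqrt (real e)) *\<^sub>R mat2 (of_int a * real e) (of_int b) (of_int c * real (nat N)) (of_int d * real e)"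
    obtain N' where N': "N = int e * N'" using e(2) by blast
    have "det2 M = (1 / sqrt (real e))\<^sup>2 * (real e * of_int (a * d * int e - b * c * N'))"
      using N by (simp add: M det2_def mat2_def N' power2_eq_square algebra_simps)
    also have "a * d * int e - b * c * N' = 1" using det e(1) by (simp add: N')
    finally show "det2 M > 0" using e(1) by simp
  qed
  show "mat2 (of_int a) (of_int b) (of_int c) (of_int d) \<in> Gamma0_plus (nat N) S"
    if "a * d - b * c = 1" "int (nat N) dvd c" for a b c d
    using mat2_in_Gamma0_plus[OF that(1)] that(2) N by simp
  show "mat2 1 1 0 1 \<in> Gamma0_plus (nat N) S"
    using mat2_in_Gamma0_plus[of 1 1 1 0] by simp
  have "(\<lambda>\<tau>. eta_quot rs \<tau>) holomorphic_on {\<tau>. Im \<tau> > 0}"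
    using rs_pos by (intro holomorphic_eta_quot holomorphic_on_ident) auto
  then show "T holomorphic_on {\<tau>. Im \<tau> > 0}"
    by (rule holomorphic_transform) (simp add: T)
  show "T \<tau> \<noteq> 0" if "Im \<tau> > 0" for \<tau>
    using eta_quot_nonzero[OF that rs_pos] by (simp add: T that)
  have "has_principal_expansion (eta_quot rs) (- of_int (int k))"
    using ok assms by (intro eta_quot_principal_expansion rs_pos) (auto simp: eta_data_ok_def)
  moreover have "\<forall>\<^sub>F \<tau> in at_i_infinity. T \<tau> = eta_quot rs \<tau>"
    using eventually_Im_gt_at_i_infinity[of 0] by eventually_elim (rule T)
  then have "(\<lambda>\<tau>. T \<tau> - (inverse (qexp \<tau>) + - of_nat k)) \<in> O[at_i_infinity](qexp) \<longleftrightarrow>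
      (\<lambda>\<tau>. eta_quot rs \<tau> - (inverse (qexp \<tau>) + - of_nat k)) \<in> O[at_i_infinity](qexp)"
    by (intro landau_o.big.in_cong) (auto elim: eventually_mono)
  ultimately show "has_principal_expansion T (- of_nat k)"
    by (simp add: has_principal_expansion_def)
qed (use T_invariant cusp_finite_or_infinity in auto)

end

section \<open>Frame shapes\<close>

lemma eta_frame_superset:
  assumes "finite A" "Poly_Mapping.keys \<pi> \<subseteq> A"
  shows "eta_frame \<pi> \<tau> = (\<Prod>n\<in>A. dedekind_eta (of_nat n * \<tau>) powi Poly_Mapping.lookup \<pi> n)"
  unfolding eta_frame_def using assms
  by (intro prod.mono_neutral_left) (auto simp: in_keys_iff)

text \<open>The exponents change sign because of the inverse. Comparing them through a sum over the
  list covers all \<open>n\<close> at once, also those that do not occur, and is decided by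
  simplification for concrete lists.\<close>

lemma inverse_eta_frame:
  assumes "Im \<tau> > 0" "\<forall>(n, r)\<in>set rs. n > 0" "distinct (map fst rs)"
    and lookup: "\<And>n. Poly_Mapping.lookup \<pi> n = - (\<Sum>(k, r)\<leftarrow>rs. if nat k = n then r else 0)"
  shows "1 / eta_frame \<pi> \<tau> = eta_quot rs \<tau>"
proof -
  define A where "A = nat ` fst ` set rs"
  have "Poly_Mapping.keys \<pi> \<subseteq> A"
  proof
    fix n assume "n \<in> Poly_Mapping.keys \<pi>"
    then have "(\<Sum>(k, r)\<leftarrow>rs. if nat k = n then r else 0) \<noteq> 0" by (simp add: lookup in_keys_iff)
    moreover have "(\<Sum>(k, r)\<leftarrow>rs'. if nat k = n then r else 0) = 0" if "n \<notin> nat ` fst ` set rs'" for rs' :: "(int \<times> int) list"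
      using that by (induction rs') auto
    ultimately show "n \<in> A" by (auto simp: A_def)
  qed
  then have "eta_frame \<pi> \<tau> = (\<Prod>n\<in>A. dedekind_eta (of_nat n * \<tau>) powi Poly_Mapping.lookup \<pi> n)"
    by (intro eta_frame_superset) (auto simp: A_def)
  then have "1 / eta_frame \<pi> \<tau> = (\<Prod>n\<in>A. dedekind_eta (of_nat n * \<tau>) powi (\<Sum>(k, r)\<leftarrow>rs. if nat k = n then r else 0))"
    by (simp add: lookup power_int_minus prod_inversef[symmetric] inverse_eq_divide[symmetric])
  also have "\<dots> = eta_quot rs \<tau>"
    unfolding A_def using assms(2,3)
  proof (induction rs)
    case (Cons p rs)
    obtain k r where p: "p = (k, r)" by fastforce
    define s where "s n = (\<Sum>(k, r)\<leftarrow>rs. if nat k = n then r else 0)" for n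
    have k: "k > 0" using Cons.prems by (simp add: p)
    have nk: "nat k \<notin> nat ` fst ` set rs"
    proof
      assume "nat k \<in> nat ` fst ` set rs"
      then obtain k' r' where "(k', r') \<in> set rs" "nat k = nat k'" by auto
      moreover have "k' > 0" using Cons.prems \<open>(k', r') \<in> set rs\<close> by auto
      ultimately show False using Cons.prems k by (force simp: p)
    qed
    have s0: "s (nat k) = 0"
    proof -
      have "(\<Sum>(k', r)\<leftarrow>rs'. if nat k' = nat k then r else 0) = 0" if "nat k \<notin> nat ` fst ` set rs'" for rs' :: "(int \<times> int) list"
        using that by (induction rs') auto
      then show ?thesis using nk by (simp add: s_def)
    qed
    have "(\<Prod>n\<in>nat ` fst ` set rs. dedekind_eta (of_nat n * \<tau>) powi ((if nat k = n then r else 0) + s n)) =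
        (\<Prod>n\<in>nat ` fst ` set rs. dedekind_eta (of_nat n * \<tau>) powi s n)"
      using nk by (intro prod.cong) auto
    also have "\<dots> = eta_quot rs \<tau>" unfolding s_def using Cons by (simp add: p)
    finally show ?case using nk k s0 by (simp add: p s_def[symmetric])
  qed (auto simp: eta_quot_def)
  finally show ?thesis .
qed

lemma lookup_frame_quotient:
  "Poly_Mapping.lookup (frame_quotient ns ds) n = int (count_list ns n) - int (count_list ds n)"
proof -
  have "Poly_Mapping.lookup (\<Sum>n\<leftarrow>ns. Poly_Mapping.single n (1::int)) n = int (count_list ns n)" for ns
    by (induction ns) (auto simp: lookup_add lookup_single when_def)
  then show ?thesis by (simp add: frame_quotient_def lookup_minus)
qed

lemma lookup_coxeter_frame:
  "Poly_Mapping.lookup (coxeter_frame X) n = (\<Sum>R\<in>#X. Poly_Mapping.lookup (coxeter_frame_type R) n)"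
  by (induction X) (auto simp: coxeter_frame_def lookup_add)

text \<open>Leaves for a single root system only the evaluation of \<open>eta_data_ok\<close>, the
  identification of its group and the comparison of exponents and component number.\<close>

lemma niemeier_case:
  assumes data: "eta_data_ok N ws rs gs" and size: "(\<Sum>(n, r)\<leftarrow>rs. if n = 1 then r else 0) = int (size X)"
    and grp: "niemeier_group X = Gamma0_plus (nat N) (insert 1 ((\<lambda>(e, _). nat e) ` set ws))"
    and dist: "distinct (map fst rs)"
    and lookup: "\<And>n. Poly_Mapping.lookup (coxeter_frame X) n = - (\<Sum>(k, r)\<leftarrow>rs. if nat k = n then r else 0)"
    and T: "T = (\<lambda>\<tau>. 1 / eta_frame (coxeter_frame X) \<tau>)"
  shows "principal_modulus (niemeier_group X) T \<and>
         has_principal_expansion T (- of_nat (size X)) \<and>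
         (\<forall>f. principal_modulus (niemeier_group X) f \<and>
               has_principal_expansion f (- of_nat (size X)) \<longrightarrow>
               (\<forall>\<tau>\<in>upper_half_plane. f \<tau> = T \<tau>))"
proof -
  interpret eta_data N ws rs gs "insert 1 ((\<lambda>(e, _). nat e) ` set ws)" T
  proof
    have pos: "\<forall>(n, r)\<in>set rs. n > 0" using data by (auto simp: eta_data_ok_def)
    show "T \<tau> = eta_quot rs \<tau>" if "Im \<tau> > 0" for \<tau>
      unfolding T using inverse_eta_frame[OF that pos dist lookup] .
  qed (rule data refl)+
  interpret hauptmodul "niemeier_group X" "nat N" T "- of_nat (size X)"
    unfolding grp by (rule hauptmodul_eta_quot[OF size])
  show ?thesis
    using principal_modulus_T T_exp principal_modulus_unique unfolding upper_half_plane_def by blast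
qed

section \<open>The Niemeier root systems\<close>

lemma coxeter_number_eq: "niemeier X \<Longrightarrow> R \<in># X \<Longrightarrow> coxeter_number X = coxeter_number_type R"
  using niemeier_properties(3) by metis

lemma niemeier_A_component: "X \<in> niemeier_A \<Longrightarrow> \<exists>n. An n \<in># X"
  by (auto simp: niemeier_A_def)

lemma niemeier_D_component: "X \<in> niemeier_D \<Longrightarrow> (\<exists>n. Dn n \<in># X) \<and> (\<forall>n. An n \<notin># X)"
  by (auto simp: niemeier_D_def)

lemma niemeier_group_A:
  assumes "X \<in> niemeier_A" "R \<in># X"
  shows "niemeier_group X = Gamma0_plus (coxeter_number_type R) {1}"
  using assms coxeter_number_eq[of X R] by (simp add: niemeier_group_def niemeier_def Gamma0_def)

lemma niemeier_group_D:
  assumes "X \<in> niemeier_D" "R \<in># X"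
  shows "niemeier_group X = Gamma0_plus (coxeter_number_type R) {1, coxeter_number_type R div 2}"
proof -
  \<comment> \<open>Needed because the definition of the group tests for A-type first; the two lists
    are told apart by the presence of an A component.\<close>
  have "X \<notin> niemeier_A" using assms(1) niemeier_A_component niemeier_D_component by blast
  then show ?thesis using assms coxeter_number_eq[of X R]
    by (simp add: niemeier_group_def niemeier_def Let_def)
qed

lemma niemeier_group_E6: "niemeier_group (replicate_mset 4 E6) = Gamma0_plus 12 {1, 4}"
proof -
  have "replicate_mset 4 E6 \<notin> niemeier_A" "replicate_mset 4 E6 \<notin> niemeier_D"
    using niemeier_A_component[of "replicate_mset 4 E6"] niemeier_D_component[of "replicate_mset 4 E6"] by auto
  then show ?thesis by (simp add: niemeier_group_def)
qed

lemma niemeier_group_E8: "niemeier_group (replicate_mset 3 E8) = Gamma0_plus 30 {1, 6, 10, 15}"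
proof -
  have "replicate_mset 3 E8 \<notin> niemeier_A" "replicate_mset 3 E8 \<notin> niemeier_D"
    using niemeier_A_component[of "replicate_mset 3 E8"] niemeier_D_component[of "replicate_mset 3 E8"] by auto
  moreover have "replicate_mset 3 E8 \<noteq> replicate_mset 4 E6"
    by (auto dest: arg_cong[where f = size])
  ultimately show ?thesis by (simp add: niemeier_group_def)
qed

text \<open>Chosen by a greedy search for a covering of \<open>[0, 1]\<close> by isometric intervals.\<close>

definition ford_gens :: "int \<Rightarrow> (int \<times> int \<times> int \<times> int) list" where
  "ford_gens N = (
     if N = 2 then
       [(- 1, - 1, 2, 1)]
     else if N = 3 then
       [(- 1, 0, 3, - 1), (- 2, - 1, 3, 1)]
     else if N = 4 then
       [(- 1, 0, 4, - 1), (- 3, - 1, 4, 1)]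
     else if N = 5 then
       [(- 1, 0, 5, - 1), (- 2, - 1, 5, 2), (- 3, 1, 5, - 2), (- 4, - 1, 5, 1)]
     else if N = 6 then
       [(- 1, 0, 6, - 1), (- 5, 2, 12, - 5), (- 7, - 3, 12, 5), (- 5, - 1, 6, 1)]
     else if N = 7 then
       [(- 1, 0, 7, - 1), (- 2, - 1, 7, 3), (- 3, - 1, 7, 2), (- 4, 1, 7, - 2), (- 5, 2, 7, - 3), (-
       6, - 1, 7, 1)]
     else if N = 8 then
       [(- 1, 0, 8, - 1), (- 3, 1, 8, - 3), (- 5, - 2, 8, 3), (- 7, - 1, 8, 1)]
     else if N = 9 then
       [(- 1, 0, 9, - 1), (- 2, - 1, 9, 4), (- 4, - 1, 9, 2), (- 5, 1, 9, - 2), (- 7, 3, 9, - 4), (-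
       8, - 1, 9, 1)]
     else if N = 10 then
       [(- 1, 0, 10, - 1), (- 3, - 1, 10, 3), (- 9, 4, 20, - 9), (- 11, - 5, 20, 9), (- 7, 2, 10, -
       3), (- 9, - 1, 10, 1)]
     else if N = 12 then
       [(- 1, 0, 12, - 1), (- 5, 1, 24, - 5), (- 7, 2, 24, - 7), (- 5, 2, 12, - 5), (- 7, - 3, 12,
       5), (- 17, - 5, 24, 7), (- 19, - 4, 24, 5), (- 11, - 1, 12, 1)]
     else if N = 13 then
       [(- 1, 0, 13, - 1), (- 2, - 1, 13, 6), (- 3, - 1, 13, 4), (- 4, - 1, 13, 3), (- 5, - 2, 13,
       5), (- 6, - 1, 13, 2), (- 7, 1, 13, - 2), (- 8, 3, 13, - 5), (- 9, 2, 13, - 3), (- 10, 3, 13,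
       - 4), (- 11, 5, 13, - 6), (- 12, - 1, 13, 1)]
     else if N = 14 then
       [(- 1, 0, 14, - 1), (- 3, 1, 14, - 5), (- 5, 1, 14, - 3), (- 13, 6, 28, - 13), (- 15, - 7,
       28, 13), (- 9, - 2, 14, 3), (- 11, - 4, 14, 5), (- 13, - 1, 14, 1)]
     else if N = 16 then
       [(- 1, 0, 16, - 1), (- 3, - 1, 16, 5), (- 5, - 1, 16, 3), (- 7, 3, 16, - 7), (- 9, - 4, 16,
       7), (- 11, 2, 16, - 3), (- 13, 4, 16, - 5), (- 15, - 1, 16, 1)]
     else if N = 18 then
       [(- 1, 0, 18, - 1), (- 5, - 1, 36, 7), (- 7, - 1, 36, 5), (- 5, - 2, 18, 7), (- 7, - 2, 18,
       5), (- 17, 8, 36, - 17), (- 19, - 9, 36, 17), (- 11, 3, 18, - 5), (- 13, 5, 18, - 7), (- 29,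
       4, 36, - 5), (- 31, 6, 36, - 7), (- 17, - 1, 18, 1)]
     else if N = 22 then
       [(- 1, 0, 22, - 1), (- 3, - 1, 22, 7), (- 5, 2, 22, - 9), (- 7, - 1, 22, 3), (- 9, 2, 22, -
       5), (- 21, 10, 44, - 21), (- 23, - 11, 44, 21), (- 13, - 3, 22, 5), (- 15, 2, 22, - 3), (-
       17, - 7, 22, 9), (- 19, 6, 22, - 7), (- 21, - 1, 22, 1)]
     else if N = 25 then
       [(- 1, 0, 25, - 1), (- 2, - 1, 25, 12), (- 3, - 1, 25, 8), (- 4, - 1, 25, 6), (- 6, - 1, 25,
       4), (- 7, - 2, 25, 7), (- 8, - 1, 25, 3), (- 9, - 4, 25, 11), (- 11, - 4, 25, 9), (- 12, - 1,
       25, 2), (- 13, 1, 25, - 2), (- 14, 5, 25, - 9), (- 16, 7, 25, - 11), (- 17, 2, 25, - 3), (-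
       18, 5, 25, - 7), (- 19, 3, 25, - 4), (- 21, 5, 25, - 6), (- 22, 7, 25, - 8), (- 23, 11, 25, -
       12), (- 24, - 1, 25, 1)]
     else if N = 30 then
       [(- 1, 0, 30, - 1), (- 7, 1, 90, - 13), (- 11, 1, 120, - 11), (- 7, - 2, 60, 17), (- 13, 1,
       90, - 7), (- 19, 3, 120, - 19), (- 11, 2, 60, - 11), (- 7, 3, 30, - 13), (- 17, - 2, 60, 7),
       (- 19, 6, 60, - 19), (- 11, 4, 30, - 11), (- 13, 3, 30, - 7), (- 29, 14, 60, - 29), (- 31, -
       15, 60, 29), (- 17, - 4, 30, 7), (- 19, - 7, 30, 11), (- 41, - 13, 60, 19), (- 43, 5, 60, -
       7), (- 23, - 10, 30, 13), (- 49, - 9, 60, 11), (- 101, - 16, 120, 19), (- 77, - 6, 90, 7), (-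
       53, 15, 60, - 17), (- 109, - 10, 120, 11), (- 83, - 12, 90, 13), (- 29, - 1, 30, 1)]
     else if N = 46 then
       [(- 1, 0, 46, - 1), (- 3, - 1, 46, 15), (- 5, - 1, 46, 9), (- 7, - 2, 46, 13), (- 9, - 1, 46,
       5), (- 11, 5, 46, - 21), (- 13, - 2, 46, 7), (- 15, - 1, 46, 3), (- 17, 7, 46, - 19), (- 19,
       7, 46, - 17), (- 21, 5, 46, - 11), (- 45, 22, 92, - 45), (- 47, - 23, 92, 45), (- 25, - 6,
       46, 11), (- 27, - 10, 46, 17), (- 29, - 12, 46, 19), (- 31, 2, 46, - 3), (- 33, 5, 46, - 7),
       (- 35, - 16, 46, 21), (- 37, 4, 46, - 5), (- 39, 11, 46, - 13), (- 41, 8, 46, - 9), (- 43,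
       14, 46, - 15), (- 45, - 1, 46, 1)]
     else [])"

theorem proposition2p1:
  fixes X :: root_system and T :: "complex \<Rightarrow> complex"
  assumes "niemeier X"
    and T_def: "T = (\<lambda>\<tau>. 1 / eta_frame (coxeter_frame X) \<tau>)"
  shows "principal_modulus (niemeier_group X) T \<and>
         has_principal_expansion T (- of_nat (size X)) \<and>
         (\<forall>f. principal_modulus (niemeier_group X) f \<and>
               has_principal_expansion f (- of_nat (size X)) \<longrightarrow>
               (\<forall>\<tau>\<in>upper_half_plane. f \<tau> = T \<tau>))"
proof -
  note case_simps = lookup_coxeter_frame lookup_frame_quotient coxeter_frame_type.simps
  from assms(1) consider
      "X = replicate_mset 24 (An 1)"
    | "X = replicate_mset 12 (An 2)"
    | "X = replicate_mset 8 (An 3)"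
    | "X = replicate_mset 6 (An 4)"
    | "X = replicate_mset 4 (An 5) + {#Dn 4#}"
    | "X = replicate_mset 4 (An 6)"
    | "X = replicate_mset 2 (An 7) + replicate_mset 2 (Dn 5)"
    | "X = replicate_mset 3 (An 8)"
    | "X = replicate_mset 2 (An 9) + {#Dn 6#}"
    | "X = {#An 11, Dn 7, E6#}"
    | "X = replicate_mset 2 (An 12)"
    | "X = {#An 15, Dn 9#}"
    | "X = {#An 17, E7#}"
    | "X = {#An 24#}"
    | "X = replicate_mset 6 (Dn 4)"
    | "X = replicate_mset 4 (Dn 6)"
    | "X = replicate_mset 3 (Dn 8)"
    | "X = {#Dn 10#} + replicate_mset 2 E7"
    | "X = replicate_mset 2 (Dn 12)"
    | "X = {#Dn 16, E8#}"
    | "X = {#Dn 24#}"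
    | "X = replicate_mset 4 E6"
    | "X = replicate_mset 3 E8"
    unfolding niemeier_def niemeier_A_def niemeier_D_def niemeier_E_def by blast
  then show ?thesis
  proof cases
    case 1
    show ?thesis
    proof (rule niemeier_case[OF _ _ _ _ _ T_def])
      \<comment> \<open>Twenty-four copies of the Frame shape 2/1, inverted. The empty list means
        that only the cusps with g = N are equivalent to infinity.\<close>
      show "eta_data_ok 2 []
          [(1, 24), (2, - 24)] (ford_gens 2)"
        by code_simp
      show "niemeier_group X = Gamma0_plus (nat 2) (insert 1 ((\<lambda>(e, _). nat e) ` set []))"
        using niemeier_group_A[of X "An 1"] by (simp add: 1 niemeier_A_def numeral_2_eq_2)
    qed (auto simp: 1 case_simps)
  next
    case 2
    show ?thesis
    proof (rule niemeier_case[OF _ _ _ _ _ T_def])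
      show "eta_data_ok 3 []
          [(1, 12), (3, - 12)] (ford_gens 3)"
        by code_simp
      show "niemeier_group X = Gamma0_plus (nat 3) (insert 1 ((\<lambda>(e, _). nat e) ` set []))"
        using niemeier_group_A[of X "An 2"] by (simp add: 2 niemeier_A_def)
    qed (auto simp: 2 case_simps)
  next
    case 3
    show ?thesis
    proof (rule niemeier_case[OF _ _ _ _ _ T_def])
      show "eta_data_ok 4 []
          [(1, 8), (4, - 8)] (ford_gens 4)"
        by code_simp
      show "niemeier_group X = Gamma0_plus (nat 4) (insert 1 ((\<lambda>(e, _). nat e) ` set []))"
        using niemeier_group_A[of X "An 3"] by (simp add: 3 niemeier_A_def)
    qed (auto simp: 3 case_simps)
  next
    case 4
    show ?thesis
    proof (rule niemeier_case[OF _ _ _ _ _ T_def])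
      show "eta_data_ok 5 []
          [(1, 6), (5, - 6)] (ford_gens 5)"
        by code_simp
      show "niemeier_group X = Gamma0_plus (nat 5) (insert 1 ((\<lambda>(e, _). nat e) ` set []))"
        using niemeier_group_A[of X "An 4"] by (simp add: 4 niemeier_A_def)
    qed (auto simp: 4 case_simps)
  next
    case 5
    show ?thesis
    proof (rule niemeier_case[OF _ _ _ _ _ T_def])
      show "eta_data_ok 6 []
          [(1, 5), (2, - 1), (3, 1), (6, - 5)] (ford_gens 6)"
        by code_simp
      show "niemeier_group X = Gamma0_plus (nat 6) (insert 1 ((\<lambda>(e, _). nat e) ` set []))"
        using niemeier_group_A[of X "An 5"] by (simp add: 5 niemeier_A_def)
    qed (auto simp: 5 case_simps)
  next
    case 6
    show ?thesis
    proof (rule niemeier_case[OF _ _ _ _ _ T_def])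
      show "eta_data_ok 7 []
          [(1, 4), (7, - 4)] (ford_gens 7)"
        by code_simp
      show "niemeier_group X = Gamma0_plus (nat 7) (insert 1 ((\<lambda>(e, _). nat e) ` set []))"
        using niemeier_group_A[of X "An 6"] by (simp add: 6 niemeier_A_def)
    qed (auto simp: 6 case_simps)
  next
    case 7
    show ?thesis
    proof (rule niemeier_case[OF _ _ _ _ _ T_def])
      show "eta_data_ok 8 []
          [(1, 4), (2, - 2), (4, 2), (8, - 4)] (ford_gens 8)"
        by code_simp
      show "niemeier_group X = Gamma0_plus (nat 8) (insert 1 ((\<lambda>(e, _). nat e) ` set []))"
        using niemeier_group_A[of X "An 7"] by (simp add: 7 niemeier_A_def)
    qed (auto simp: 7 case_simps)
  next
    case 8
    show ?thesis
    proof (rule niemeier_case[OF _ _ _ _ _ T_def])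
      show "eta_data_ok 9 []
          [(1, 3), (9, - 3)] (ford_gens 9)"
        by code_simp
      show "niemeier_group X = Gamma0_plus (nat 9) (insert 1 ((\<lambda>(e, _). nat e) ` set []))"
        using niemeier_group_A[of X "An 8"] by (simp add: 8 niemeier_A_def)
    qed (auto simp: 8 case_simps)
  next
    case 9
    show ?thesis
    proof (rule niemeier_case[OF _ _ _ _ _ T_def])
      show "eta_data_ok 10 []
          [(1, 3), (2, - 1), (5, 1), (10, - 3)] (ford_gens 10)"
        by code_simp
      show "niemeier_group X = Gamma0_plus (nat 10) (insert 1 ((\<lambda>(e, _). nat e) ` set []))"
        using niemeier_group_A[of X "An 9"] by (simp add: 9 niemeier_A_def)
    qed (auto simp: 9 case_simps)
  next
    case 10
    show ?thesis
    proof (rule niemeier_case[OF _ _ _ _ _ T_def])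
      show "eta_data_ok 12 []
          [(1, 3), (2, - 2), (3, - 1), (4, 1), (6, 2), (12, - 3)] (ford_gens 12)"
        by code_simp
      show "niemeier_group X = Gamma0_plus (nat 12) (insert 1 ((\<lambda>(e, _). nat e) ` set []))"
        using niemeier_group_A[of X "An 11"] by (simp add: 10 niemeier_A_def)
    qed (auto simp: 10 case_simps)
  next
    case 11
    show ?thesis
    proof (rule niemeier_case[OF _ _ _ _ _ T_def])
      show "eta_data_ok 13 []
          [(1, 2), (13, - 2)] (ford_gens 13)"
        by code_simp
      show "niemeier_group X = Gamma0_plus (nat 13) (insert 1 ((\<lambda>(e, _). nat e) ` set []))"
        using niemeier_group_A[of X "An 12"] by (simp add: 11 niemeier_A_def)
    qed (auto simp: 11 case_simps)
  next
    case 12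
    show ?thesis
    proof (rule niemeier_case[OF _ _ _ _ _ T_def])
      show "eta_data_ok 16 []
          [(1, 2), (2, - 1), (8, 1), (16, - 2)] (ford_gens 16)"
        by code_simp
      show "niemeier_group X = Gamma0_plus (nat 16) (insert 1 ((\<lambda>(e, _). nat e) ` set []))"
        using niemeier_group_A[of X "An 15"] by (simp add: 12 niemeier_A_def)
    qed (auto simp: 12 case_simps)
  next
    case 13
    show ?thesis
    proof (rule niemeier_case[OF _ _ _ _ _ T_def])
      show "eta_data_ok 18 []
          [(1, 2), (2, - 1), (3, - 1), (6, 1), (9, 1), (18, - 2)] (ford_gens 18)"
        by code_simp
      show "niemeier_group X = Gamma0_plus (nat 18) (insert 1 ((\<lambda>(e, _). nat e) ` set []))"
        using niemeier_group_A[of X "An 17"] by (simp add: 13 niemeier_A_def)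
    qed (auto simp: 13 case_simps)
  next
    case 14
    show ?thesis
    proof (rule niemeier_case[OF _ _ _ _ _ T_def])
      show "eta_data_ok 25 []
          [(1, 1), (25, - 1)] (ford_gens 25)"
        by code_simp
      show "niemeier_group X = Gamma0_plus (nat 25) (insert 1 ((\<lambda>(e, _). nat e) ` set []))"
        using niemeier_group_A[of X "An 24"] by (simp add: 14 niemeier_A_def)
    qed (auto simp: 14 case_simps)
  next
    case 15
    show ?thesis
    proof (rule niemeier_case[OF _ _ _ _ _ T_def])
      \<comment> \<open>With a = c = d = 1 the determinant condition reads e - b (N/e) = 1. In the
        D-type cases N = 2e, hence b = (e - 1)/2; here the matrix is
        \<open>(3, 1; 6, 3)\<close>.\<close>
      show "eta_data_ok 6 [(3, 1, 1, 1, 1)]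
          [(1, 6), (2, - 6), (3, 6), (6, - 6)] (ford_gens 6)"
        by code_simp
      show "niemeier_group X = Gamma0_plus (nat 6) (insert 1 ((\<lambda>(e, _). nat e) ` set [(3, 1, 1, 1, 1)]))"
        using niemeier_group_D[of X "Dn 4"] by (simp add: 15 niemeier_D_def)
    qed (auto simp: 15 case_simps)
  next
    case 16
    show ?thesis
    proof (rule niemeier_case[OF _ _ _ _ _ T_def])
      show "eta_data_ok 10 [(5, 1, 2, 1, 1)]
          [(1, 4), (2, - 4), (5, 4), (10, - 4)] (ford_gens 10)"
        by code_simp
      show "niemeier_group X = Gamma0_plus (nat 10) (insert 1 ((\<lambda>(e, _). nat e) ` set [(5, 1, 2, 1, 1)]))"
        using niemeier_group_D[of X "Dn 6"] by (simp add: 16 niemeier_D_def)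
    qed (auto simp: 16 case_simps)
  next
    case 17
    show ?thesis
    proof (rule niemeier_case[OF _ _ _ _ _ T_def])
      show "eta_data_ok 14 [(7, 1, 3, 1, 1)]
          [(1, 3), (2, - 3), (7, 3), (14, - 3)] (ford_gens 14)"
        by code_simp
      show "niemeier_group X = Gamma0_plus (nat 14) (insert 1 ((\<lambda>(e, _). nat e) ` set [(7, 1, 3, 1, 1)]))"
        using niemeier_group_D[of X "Dn 8"] by (simp add: 17 niemeier_D_def)
    qed (auto simp: 17 case_simps)
  next
    case 18
    show ?thesis
    proof (rule niemeier_case[OF _ _ _ _ _ T_def])
      show "eta_data_ok 18 [(9, 1, 4, 1, 1)]
          [(1, 3), (2, - 3), (3, - 2), (6, 2), (9, 3), (18, - 3)] (ford_gens 18)"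
        by code_simp
      show "niemeier_group X = Gamma0_plus (nat 18) (insert 1 ((\<lambda>(e, _). nat e) ` set [(9, 1, 4, 1, 1)]))"
        using niemeier_group_D[of X "Dn 10"] by (simp add: 18 niemeier_D_def)
    qed (auto simp: 18 case_simps)
  next
    case 19
    show ?thesis
    proof (rule niemeier_case[OF _ _ _ _ _ T_def])
      show "eta_data_ok 22 [(11, 1, 5, 1, 1)]
          [(1, 2), (2, - 2), (11, 2), (22, - 2)] (ford_gens 22)"
        by code_simp
      show "niemeier_group X = Gamma0_plus (nat 22) (insert 1 ((\<lambda>(e, _). nat e) ` set [(11, 1, 5, 1, 1)]))"
        using niemeier_group_D[of X "Dn 12"] by (simp add: 19 niemeier_D_def)
    qed (auto simp: 19 case_simps)
  next
    case 20
    show ?thesis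
    proof (rule niemeier_case[OF _ _ _ _ _ T_def])
      show "eta_data_ok 30 [(15, 1, 7, 1, 1)]
          [(1, 2), (2, - 2), (3, - 1), (5, - 1), (6, 1), (10, 1), (15, 2), (30, - 2)] (ford_gens 30)"
        by code_simp
      show "niemeier_group X = Gamma0_plus (nat 30) (insert 1 ((\<lambda>(e, _). nat e) ` set [(15, 1, 7, 1, 1)]))"
        using niemeier_group_D[of X "Dn 16"] by (simp add: 20 niemeier_D_def)
    qed (auto simp: 20 case_simps)
  next
    case 21
    show ?thesis
    proof (rule niemeier_case[OF _ _ _ _ _ T_def])
      show "eta_data_ok 46 [(23, 1, 11, 1, 1)]
          [(1, 1), (2, - 1), (23, 1), (46, - 1)] (ford_gens 46)"
        by code_simp
      show "niemeier_group X = Gamma0_plus (nat 46) (insert 1 ((\<lambda>(e, _). nat e) ` set [(23, 1, 11, 1, 1)]))"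
        using niemeier_group_D[of X "Dn 24"] by (simp add: 21 niemeier_D_def)
    qed (auto simp: 21 case_simps)
  next
    case 22
    show ?thesis
    proof (rule niemeier_case[OF _ _ _ _ _ T_def])
      show "eta_data_ok 12 [(4, 1, 1, 1, 1)]
          [(1, 4), (2, - 4), (3, - 4), (4, 4), (6, 4), (12, - 4)] (ford_gens 12)"
        by code_simp
      show "niemeier_group X = Gamma0_plus (nat 12) (insert 1 ((\<lambda>(e, _). nat e) ` set [(4, 1, 1, 1, 1)]))"
        using niemeier_group_E6 by (simp add: 22)
    qed (auto simp: 22 case_simps)
  next
    case 23
    show ?thesis
    proof (rule niemeier_case[OF _ _ _ _ _ T_def])
      \<comment> \<open>Again a = c = d = 1, so b = (e - 1)/(N/e) with N/e = 5, 3, 2. These three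
        values of g are the ones at which the quotient is allowed a pole besides g = 30.\<close>
      show "eta_data_ok 30 [(6, 1, 1, 1, 1), (10, 1, 3, 1, 1), (15, 1, 7, 1, 1)]
          [(1, 3), (2, - 3), (3, - 3), (5, - 3), (6, 3), (10, 3), (15, 3), (30, - 3)] (ford_gens 30)"
        by code_simp
      show "niemeier_group X = Gamma0_plus (nat 30) (insert 1 ((\<lambda>(e, _). nat e) ` set [(6, 1, 1, 1, 1), (10, 1, 3, 1, 1), (15, 1, 7, 1, 1)]))"
        using niemeier_group_E8 by (simp add: 23)
    qed (auto simp: 23 case_simps)
  qed
qed

end
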